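(* Let $m\ge 1$ be an integer, let $p,q\in\{1,2,\dots,2m-1\}$, let $c$ be a coefficient on $I=[-1,1]$ having $x=0$ as its single zero, of right order $p$ and left order $q$ (as specified in the context), and let $L_0^{pq}$ be the minimal closed symmetric operator in $L_2(I)$ generated by $l_{2m}[y]=(-1)^m(c\,y^{(m)})^{(m)}$. Then the spectrum of any self-adjoint extension (in $L_2(I)$) of $L_0^{pq}$ is discrete.
   Context: Let $I=[-1,1]$ and let $m\ge1$ be an integer. The coefficient. Let $p,q\in\{1,\dots,2m-1\}$. The function $c:I\to\mathbb R$ has a single zero on $I$, at $x=0$, and has the form $$c(x)=\begin{cases}x^p a(x), & x\in[0,1],\\ (-x)^q b(x), & x\in[-1,0],\end{cases}$$ where $a,b$ are real-valued functions on $I$ represented by power series $a(z)=a_0+\sum_{j\ge1}a_jz^j$, $a_0\neq0$, and $b(z)=b_0+\sum_{j\ge1}b_jz^j$, $b_0\ne0$, convergent for $|z|<1$. Since $0$ is the only zero of $c$ on $I$, $a$ does not vanish (and has constant sign) on $[0,1]$, and $b$ does not vanish (and has constant sign) on $[-1,0]$. The signs of $a$ and $b$ are otherwise unrestricted. One says that $0$ is a zero of $c$ of right order $p$ and left order $q$. The operator. Consider the differential expression $l_{2m}[y](x)=(-1)^m\bigl(c(x)y^{(m)}\bigr)^{(m)}(x)$, $x\in I$. Let $D_0'$ be the set of all infinitely differentiable functions $y$ on $I$ vanishing identically outside some segment $[\alpha,\beta]$ with $-1<\alpha<\beta<1$ (the segment may depend on $y$), and let $L_0'$ be the operator in $L_2(I)$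 with domain $D_0'$ acting by $L_0'y=l_{2m}[y]$. The operator $L_0'$ is taken as a densely defined symmetric operator in $L_2(I)$; its closure is denoted $L_0^{pq}$ and is called the minimal closed symmetric operator generated by $l_{2m}$ in $L_2(I)$. It is a real operator (it commutes with complex conjugation), so its two deficiency numbers are equal. The spectrum of a self-adjoint operator is called discrete if it consists only of isolated eigenvalues of finite multiplicity. *)

theory Defs
  imports "HOL-Analysis.Analysis"
begin

section \<open>The complex Hilbert space \<open>L\<^sub>2(I)\<close>, \<open>I = [-1,1]\<close>\<close>

definition square_integrable :: "(real \<Rightarrow> complex) \<Rightarrow> bool" where
  "square_integrable f \<longleftrightarrow>
     f \<in> borel_measurable (lebesgue_on {-1..1}) \<and>
     integrable (lebesgue_on {-1..1}) (\<lambda>x. (cmod (f x))\<^sup>2)"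

lemma square_integrable_zero: "square_integrable (\<lambda>x. 0)"
  by (simp add: square_integrable_def)

lemma square_integrable_add:
  assumes "square_integrable f" "square_integrable g"
  shows "square_integrable (\<lambda>x. f x + g x)"
proof -
  have meas: "(\<lambda>x. f x + g x) \<in> borel_measurable (lebesgue_on {-1..1})"
    using assms by (auto simp: square_integrable_def)
  have "integrable (lebesgue_on {-1..1}) (\<lambda>x. (cmod (f x + g x))\<^sup>2)"
  proof (rule Bochner_Integration.integrable_bound)
    show "integrable (lebesgue_on {-1..1}) (\<lambda>x. 2 * (cmod (f x))\<^sup>2 + 2 * (cmod (g x))\<^sup>2)"
      using assms by (auto simp: square_integrable_def)
    show "(\<lambda>x. (cmod (f x + g x))\<^sup>2) \<in> borel_measurable (lebesgue_on {-1..1})"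
      using meas by measurable
    have "(cmod (a + b))\<^sup>2 \<le> 2 * (cmod a)\<^sup>2 + 2 * (cmod b)\<^sup>2" for a b
    proof -
      have "(cmod (a + b))\<^sup>2 \<le> (cmod a + cmod b)\<^sup>2"
        by (simp add: norm_triangle_ineq power_mono)
      also have "\<dots> \<le> 2 * (cmod a)\<^sup>2 + 2 * (cmod b)\<^sup>2"
        using sum_squares_bound[of "cmod a" "cmod b"] by (simp add: power2_sum)
      finally show ?thesis .
    qed
    then show "AE x in lebesgue_on {-1..1}. norm ((cmod (f x + g x))\<^sup>2)
                 \<le> norm (2 * (cmod (f x))\<^sup>2 + 2 * (cmod (g x))\<^sup>2)"
      by (intro AE_I2) (simp add: abs_of_nonneg)
  qed
  with meas show ?thesis by (simp add: square_integrable_def)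
qed

lemma square_integrable_cmult:
  "square_integrable f \<Longrightarrow> square_integrable (\<lambda>x. z * f x)"
  by (auto simp: square_integrable_def norm_mult power_mult_distrib)

lemma square_integrable_prod:
  assumes "square_integrable f" "square_integrable g"
  shows "integrable (lebesgue_on {-1..1}) (\<lambda>x. f x * cnj (g x))"
proof (rule Bochner_Integration.integrable_bound)
  show "integrable (lebesgue_on {-1..1}) (\<lambda>x. (cmod (f x))\<^sup>2 + (cmod (g x))\<^sup>2)"
    using assms by (auto simp: square_integrable_def)
  have "f \<in> borel_measurable (lebesgue_on {-1..1})" "g \<in> borel_measurable (lebesgue_on {-1..1})"
    using assms by (auto simp: square_integrable_def)
  then show "(\<lambda>x. f x * cnj (g x)) \<in> borel_measurable (lebesgue_on {-1..1})"
    by (intro borel_measurable_times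
        measurable_compose[OF _ borel_measurable_continuous_onI[OF continuous_on_cnj[OF continuous_on_id]]])
  have "cmod a * cmod b \<le> (cmod a)\<^sup>2 + (cmod b)\<^sup>2" for a b
    using sum_squares_bound[of "cmod a" "cmod b"]
      mult_nonneg_nonneg[OF norm_ge_zero norm_ge_zero, of a b] by linarith
  then show "AE x in lebesgue_on {-1..1}. norm (f x * cnj (g x))
               \<le> norm ((cmod (f x))\<^sup>2 + (cmod (g x))\<^sup>2)"
    by (intro AE_I2) (simp add: norm_mult)
qed

text \<open>Elements are classes of square integrable functions modulo equality almost everywhere on
  \<open>I\<close>; the values of a function outside \<open>I\<close> are irrelevant. The partial quotient leaves
  \<open>abs_L2I f\<close> meaningless unless \<open>f\<close> is square integrable.\<close>

quotient_type L2I = "real \<Rightarrow> complex" / partial: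
  "\<lambda>f g. square_integrable f \<and> square_integrable g \<and> (AE x in lebesgue_on {-1..1}. f x = g x)"
proof (rule part_equivpI)
  show "\<exists>x. square_integrable x \<and> square_integrable x \<and> (AE t in lebesgue_on {-1..1}. x t = x t)"
    using square_integrable_zero by auto
next
  let ?M = "lebesgue_on {-1..1::real}"
  show "symp (\<lambda>f g. square_integrable f \<and> square_integrable g \<and> (AE x in ?M. f x = g x))"
  proof (rule sympI, elim conjE, intro conjI)
    fix f g :: "real \<Rightarrow> complex" assume "AE x in ?M. f x = g x"
    then show "AE x in ?M. g x = f x" by eventually_elim simp
  qed
  show "transp (\<lambda>f g. square_integrable f \<and> square_integrable g \<and> (AE x in ?M. f x = g x))"
  proof (rule transpI, elim conjE, intro conjI)
    fix f g h :: "real \<Rightarrow> complex" assume "AE x in ?M. f x = g x" "AE x in ?M. g x = h x"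
    then show "AE x in ?M. f x = h x" by eventually_elim simp
  qed
qed

lift_definition scaleC :: "complex \<Rightarrow> L2I \<Rightarrow> L2I" (infixr \<open>*\<^sub>C\<close> 75) is "\<lambda>z f x. z * f x"
  by (auto intro: square_integrable_cmult)

lift_definition cinner :: "L2I \<Rightarrow> L2I \<Rightarrow> complex"
  is "\<lambda>f g. (LINT x|lebesgue_on {-1..1}. f x * cnj (g x))"
proof -
  fix f f' g g' :: "real \<Rightarrow> complex"
  assume 1: "square_integrable f \<and> square_integrable f' \<and> (AE x in lebesgue_on {-1..1}. f x = f' x)"
     and 2: "square_integrable g \<and> square_integrable g' \<and> (AE x in lebesgue_on {-1..1}. g x = g' x)"
  from 1 2 have "AE x in lebesgue_on {-1..1}. f x * cnj (g x) = f' x * cnj (g' x)" by auto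
  then show "(LINT x|lebesgue_on {-1..1}. f x * cnj (g x)) = (LINT x|lebesgue_on {-1..1}. f' x * cnj (g' x))"
    using 1 2 by (intro integral_cong_AE)
      (auto dest: square_integrable_prod intro: borel_measurable_integrable)
qed

text \<open>The underlying real inner product \<open>Re \<langle>f,g\<rangle>\<close> gives the usual norm and topology
  of \<open>L\<^sub>2(I)\<close>.\<close>

instantiation L2I :: real_inner
begin

lift_definition zero_L2I :: L2I is "\<lambda>x. 0" by (simp add: square_integrable_zero)
lift_definition plus_L2I :: "L2I \<Rightarrow> L2I \<Rightarrow> L2I" is "\<lambda>f g x. f x + g x"
  by (auto intro: square_integrable_add)
definition scaleR_L2I :: "real \<Rightarrow> L2I \<Rightarrow> L2I" where "scaleR_L2I r f = scaleC (of_real r) f"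
definition uminus_L2I :: "L2I \<Rightarrow> L2I" where "uminus_L2I f = scaleC (-1) f"
definition minus_L2I :: "L2I \<Rightarrow> L2I \<Rightarrow> L2I" where "minus_L2I f g = f + scaleC (-1) g"
definition inner_L2I :: "L2I \<Rightarrow> L2I \<Rightarrow> real" where "inner_L2I f g = Re (cinner f g)"
definition norm_L2I :: "L2I \<Rightarrow> real" where "norm_L2I f = sqrt (inner f f)"
definition sgn_L2I :: "L2I \<Rightarrow> L2I" where "sgn_L2I f = inverse (norm f) *\<^sub>R f"
definition dist_L2I :: "L2I \<Rightarrow> L2I \<Rightarrow> real" where "dist_L2I f g = norm (f - g)"
definition uniformity_L2I :: "(L2I \<times> L2I) filter" where
  "uniformity_L2I = (INF e\<in>{0 <..}. principal {(x, y). dist x y < e})"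
definition open_L2I :: "L2I set \<Rightarrow> bool" where
  "open_L2I U \<longleftrightarrow> (\<forall>x\<in>U. \<forall>\<^sub>F (x', y) in uniformity. x' = x \<longrightarrow> y \<in> U)"

lemma cinner_add_left: "cinner (f + g) h = cinner f h + cinner g h"
proof (transfer, elim conjE)
  fix f g h
  assume "square_integrable f" "square_integrable g" "square_integrable h"
  then show "(LINT x|lebesgue_on {-1..1}. (f x + g x) * cnj (h x)) =
      (LINT x|lebesgue_on {-1..1}. f x * cnj (h x)) + (LINT x|lebesgue_on {-1..1}. g x * cnj (h x))"
    unfolding distrib_right by (intro Bochner_Integration.integral_add square_integrable_prod)
qed

lemma cinner_scaleC_left: "cinner (z *\<^sub>C f) g = z * cinner f g"
  by transfer (simp add: mult.assoc)

lemma cinner_commute: "cinner f g = cnj (cinner g f)"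
proof (transfer, elim conjE)
  fix f g :: "real \<Rightarrow> complex"
  show "(LINT x|lebesgue_on {-1..1}. f x * cnj (g x)) =
      cnj (LINT x|lebesgue_on {-1..1}. g x * cnj (f x))"
    unfolding Bochner_Integration.integral_cnj[symmetric] by (simp add: mult.commute)
qed

lemma cinner_eq_zero_iff:
  "Im (cinner f f) = 0 \<and> 0 \<le> Re (cinner f f) \<and> (Re (cinner f f) = 0 \<longleftrightarrow> f = 0)"
proof (transfer, elim conjE)
  fix f assume f: "square_integrable f"
  let ?M = "lebesgue_on {-1..1::real}"
  have int: "integrable ?M (\<lambda>x. (cmod (f x))\<^sup>2)" using f by (simp add: square_integrable_def)
  have eq: "(LINT x|?M. f x * cnj (f x)) = of_real (LINT x|?M. (cmod (f x))\<^sup>2)"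
    by (subst complex_norm_square[symmetric]) (rule integral_complex_of_real)
  have "(LINT x|?M. (cmod (f x))\<^sup>2) = 0 \<longleftrightarrow> (AE x in ?M. f x = 0)"
    by (subst integral_nonneg_eq_0_iff_AE[OF int]) auto
  then show "Im (LINT x|?M. f x * cnj (f x)) = 0 \<and> 0 \<le> Re (LINT x|?M. f x * cnj (f x)) \<and>
      (Re (LINT x|?M. f x * cnj (f x)) = 0 \<longleftrightarrow>
       square_integrable f \<and> square_integrable (\<lambda>x. 0) \<and> (AE x in ?M. f x = 0))"
    unfolding eq using f square_integrable_zero by (simp add: integral_nonneg)
qed

instance
proof
  fix f g h :: L2I and r s :: real
  show "f + g + h = f + (g + h)"
    by transfer (auto simp: add.assoc intro!: square_integrable_add)
  show "f + g = g + f"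
    by transfer (auto simp: add.commute intro!: square_integrable_add)
  show "0 + f = f" by transfer auto
  show "- f + f = 0" unfolding uminus_L2I_def
    by transfer (auto simp: square_integrable_zero)
  show "f - g = f + - g" by (simp add: minus_L2I_def uminus_L2I_def)
  show "r *\<^sub>R (f + g) = r *\<^sub>R f + r *\<^sub>R g" unfolding scaleR_L2I_def
    by transfer (auto simp: distrib_left intro!: square_integrable_add square_integrable_cmult)
  show "(r + s) *\<^sub>R f = r *\<^sub>R f + s *\<^sub>R f" unfolding scaleR_L2I_def
    by transfer (auto simp: distrib_right intro!: square_integrable_add square_integrable_cmult)
  show "r *\<^sub>R s *\<^sub>R f = (r * s) *\<^sub>R f" unfolding scaleR_L2I_def
    by transfer (auto simp: mult.assoc intro!: square_integrable_cmult)
  show "1 *\<^sub>R f = f" unfolding scaleR_L2I_def by transfer auto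
  show "sgn f = inverse (norm f) *\<^sub>R f" by (rule sgn_L2I_def)
  show "dist f g = norm (f - g)" by (rule dist_L2I_def)
  show "(uniformity :: (L2I \<times> L2I) filter) = (INF e\<in>{0 <..}. principal {(x, y). dist x y < e})"
    by (rule uniformity_L2I_def)
  show "open U = (\<forall>x\<in>U. \<forall>\<^sub>F (x', y) in uniformity. x' = x \<longrightarrow> y \<in> U)" for U :: "L2I set"
    by (rule open_L2I_def)
  show "inner f g = inner g f" unfolding inner_L2I_def by (subst cinner_commute) simp
  show "inner (f + g) h = inner f h + inner g h" by (simp add: inner_L2I_def cinner_add_left)
  show "inner (r *\<^sub>R f) g = r * inner f g"
    by (simp add: inner_L2I_def scaleR_L2I_def cinner_scaleC_left)
  show "0 \<le> inner f f" "(inner f f = 0) = (f = 0)"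
    using cinner_eq_zero_iff[of f] by (simp_all add: inner_L2I_def)
  show "norm f = sqrt (inner f f)" by (rule norm_L2I_def)
qed

end

global_interpretation complex_L2I: vector_space scaleC
proof
  fix f g :: L2I and z w :: complex
  show "z *\<^sub>C (f + g) = z *\<^sub>C f + z *\<^sub>C g"
    by transfer (auto simp: distrib_left intro!: square_integrable_add square_integrable_cmult)
  show "(z + w) *\<^sub>C f = z *\<^sub>C f + w *\<^sub>C f"
    by transfer (auto simp: distrib_right intro!: square_integrable_add square_integrable_cmult)
  show "z *\<^sub>C w *\<^sub>C f = (z * w) *\<^sub>C f"
    by transfer (auto simp: mult.assoc intro!: square_integrable_cmult)
  show "1 *\<^sub>C f = f" by transfer auto
qed


section \<open>Unbounded operators in \<open>L\<^sub>2(I)\<close>\<close>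

text \<open>An operator is identified with its graph, so that \<open>\<subseteq>\<close> is the extension relation,
  \<^const>\<open>Domain\<close> is the domain, and the closure of an operator is the topological
  \<^const>\<open>closure\<close> of its graph.\<close>

definition linear_operator :: "(L2I \<times> L2I) set \<Rightarrow> bool" where
  "linear_operator A \<longleftrightarrow> single_valued A \<and> (0, 0) \<in> A \<and>
     (\<forall>f u g v. (f, u) \<in> A \<longrightarrow> (g, v) \<in> A \<longrightarrow> (f + g, u + v) \<in> A) \<and>
     (\<forall>z f u. (f, u) \<in> A \<longrightarrow> (z *\<^sub>C f, z *\<^sub>C u) \<in> A)"

definition densely_defined :: "(L2I \<times> L2I) set \<Rightarrow> bool" where
  "densely_defined A \<longleftrightarrow> closure (Domain A) = UNIV"

definition symmetric_operator :: "(L2I \<times> L2I) set \<Rightarrow> bool" where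
  "symmetric_operator A \<longleftrightarrow> (\<forall>(f, u)\<in>A. \<forall>(g, v)\<in>A. cinner u g = cinner f v)"

definition adjoint_operator :: "(L2I \<times> L2I) set \<Rightarrow> (L2I \<times> L2I) set" where
  "adjoint_operator A = {(g, v). \<forall>(f, u)\<in>A. cinner u g = cinner f v}"

definition self_adjoint_operator :: "(L2I \<times> L2I) set \<Rightarrow> bool" where
  "self_adjoint_operator A \<longleftrightarrow>
     linear_operator A \<and> densely_defined A \<and> adjoint_operator A = A"

definition resolvent_set :: "(L2I \<times> L2I) set \<Rightarrow> complex set" where
  "resolvent_set A = {z. \<exists>R. bounded_linear R \<and>
     {(f, u - z *\<^sub>C f) | f u. (f, u) \<in> A} = {(R g, g) | g. True}}"

definition op_spectrum :: "(L2I \<times> L2I) set \<Rightarrow> complex set" where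
  "op_spectrum A = - resolvent_set A"

definition eigenspace :: "(L2I \<times> L2I) set \<Rightarrow> complex \<Rightarrow> L2I set" where
  "eigenspace A z = {f. (f, z *\<^sub>C f) \<in> A}"

definition eigenvalue :: "(L2I \<times> L2I) set \<Rightarrow> complex \<Rightarrow> bool" where
  "eigenvalue A z \<longleftrightarrow> (\<exists>f\<in>eigenspace A z. f \<noteq> 0)"

definition finite_multiplicity :: "(L2I \<times> L2I) set \<Rightarrow> complex \<Rightarrow> bool" where
  "finite_multiplicity A z \<longleftrightarrow> (\<exists>B. finite B \<and> eigenspace A z \<subseteq> complex_L2I.span B)"

definition discrete_spectrum :: "(L2I \<times> L2I) set \<Rightarrow> bool" where
  "discrete_spectrum A \<longleftrightarrow> (\<forall>z\<in>op_spectrum A.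
     z isolated_in op_spectrum A \<and> eigenvalue A z \<and> finite_multiplicity A z)"


section \<open>The coefficient\<close>

text \<open>The series are only required to converge to \<open>a\<close>, \<open>b\<close> for \<open>\<bar>x\<bar> < 1\<close>. Continuity of
  \<open>a\<close> on \<open>[0,1]\<close> and of \<open>b\<close> on \<open>[-1,0]\<close> ties their values at the endpoints \<open>\<plusminus>1\<close> to the
  series; by Abel's limit theorem it is automatic if the series represents the function at the
  endpoint as well.\<close>

definition degenerate_coefficient :: "nat \<Rightarrow> nat \<Rightarrow> (real \<Rightarrow> real) \<Rightarrow> bool" where
  "degenerate_coefficient p q c \<longleftrightarrow>
     (\<forall>x\<in>{-1..1}. c x = 0 \<longleftrightarrow> x = 0) \<and>
     (\<exists>(a :: real \<Rightarrow> real) (b :: real \<Rightarrow> real) (\<alpha> :: nat \<Rightarrow> real) (\<beta> :: nat \<Rightarrow> real).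
        (\<forall>x. \<bar>x\<bar> < 1 \<longrightarrow> (\<lambda>j. \<alpha> j * x ^ j) sums a x) \<and> \<alpha> 0 \<noteq> 0 \<and> continuous_on {0..1} a \<and>
        (\<forall>x. \<bar>x\<bar> < 1 \<longrightarrow> (\<lambda>j. \<beta> j * x ^ j) sums b x) \<and> \<beta> 0 \<noteq> 0 \<and> continuous_on {-1..0} b \<and>
        (\<forall>x\<in>{0..1}. c x = x ^ p * a x) \<and>
        (\<forall>x\<in>{-1..0}. c x = (- x) ^ q * b x))"


section \<open>The minimal operator\<close>

definition nth_derivative :: "nat \<Rightarrow> (real \<Rightarrow> complex) \<Rightarrow> real \<Rightarrow> complex" where
  "nth_derivative k = (\<lambda>f x. vector_derivative f (at x)) ^^ k"

text \<open>A function that vanishes near the endpoints of \<open>I\<close> is identified with its extension by zero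
  to \<open>\<real>\<close>.\<close>

definition test_functions :: "(real \<Rightarrow> complex) set" where
  "test_functions = {y. (\<forall>k x. nth_derivative k y differentiable (at x)) \<and>
     (\<exists>\<alpha> \<beta>. -1 < \<alpha> \<and> \<alpha> < \<beta> \<and> \<beta> < 1 \<and> (\<forall>x. x \<notin> {\<alpha>..\<beta>} \<longrightarrow> y x = 0))}"

text \<open>The outer derivatives are taken pointwise. If \<open>c\<close> is a degenerate coefficient, they exist
  at every \<open>x \<noteq> 0\<close> in \<open>(-1,1)\<close>; the
  result is bounded on \<open>I\<close>, hence square integrable. The value at \<open>x = 0\<close>, where \<open>c y\<^sup>(\<^sup>m\<^sup>)\<close> need not
  be differentiable, does not affect the element of \<open>L\<^sub>2(I)\<close>.\<close>

definition diff_expr :: "nat \<Rightarrow> (real \<Rightarrow> real) \<Rightarrow> (real \<Rightarrow> complex) \<Rightarrow> real \<Rightarrow> complex" where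
  "diff_expr m c y x =
     (-1) ^ m * nth_derivative m (\<lambda>t. of_real (c t) * nth_derivative m y t) x"

definition preminimal_operator :: "nat \<Rightarrow> (real \<Rightarrow> real) \<Rightarrow> (L2I \<times> L2I) set" where
  "preminimal_operator m c = {(abs_L2I y, abs_L2I (diff_expr m c y)) | y. y \<in> test_functions}"

definition minimal_operator :: "nat \<Rightarrow> (real \<Rightarrow> real) \<Rightarrow> (L2I \<times> L2I) set" where
  "minimal_operator m c = closure (preminimal_operator m c)"

text \<open>Symmetry of the operator on test functions is implied by the existence of a self-adjoint
  extension, so it need not be assumed separately.\<close>

lemma symmetric_if_self_adjoint_extension:
  assumes "self_adjoint_operator A" "minimal_operator m c \<subseteq> A"
  shows "symmetric_operator (preminimal_operator m c)"
proof -
  have "preminimal_operator m c \<subseteq> A"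
    using assms(2) closure_subset unfolding minimal_operator_def by blast
  moreover have "A \<subseteq> adjoint_operator A"
    using assms(1) by (simp add: self_adjoint_operator_def)
  ultimately show ?thesis
    unfolding symmetric_operator_def adjoint_operator_def by blast
qed

end

theory Submission
  imports Defs "HOL-Complex_Analysis.Great_Picard"
begin

text \<open>A self-adjoint operator \<open>A\<close> has discrete spectrum as soon as its domain, with the graph norm,
  embeds compactly in \<open>L\<^sub>2(I)\<close> (\<open>discrete_spectrum_if_compactly_embedded\<close>): the spectrum then consists
  of eigenvalues, and an orthonormal sequence of eigenvectors with bounded eigenvalues would have a
  convergent subsequence, which is absurd. It therefore suffices that bounded sequences of pairs
  \<open>(f\<^sub>n, A f\<^sub>n)\<close> have a subsequence along which \<open>f\<^sub>n\<close> converges.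

  A symmetric extension acts on its domain as the adjoint of the minimal operator. Hence for
  \<open>u = A f\<close> the equation \<open>l[f] = u\<close> holds weakly against test functions supported inside \<open>(0,1)\<close>,
  and likewise inside \<open>(-1,0)\<close>. The degenerate point is never tested, and the two halves are treated
  separately; reflection reduces the left one to the right one.

  On \<open>(0,1)\<close> the expression \<open>l\<close> has the explicit right inverse \<open>G\<close>: integrate \<open>m\<close> times from \<open>0\<close>,
  divide by \<open>c\<close>, integrate \<open>m\<close> times from \<open>1\<close> (the signs cancel). Applied to a square integrable function, the
  first step produces a factor \<open>s\<^bsup>m - 1/2\<^esup>\<close>, and \<open>\<bar>c(s)\<bar> \<ge> \<kappa> s\<^bsup>2m - 1\<^esup>\<close> because the order of the zero is at most
  \<open>2m - 1\<close>; what remains is \<open>s\<^bsup>1/2 - m\<^esup>\<close>, and multiplied by the kernel \<open>(s - x)\<^bsup>m - 1\<^esup>\<close> of the last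
  step it is dominated by the integrable function \<open>s\<^bsup>-1/2\<^esup>\<close>. Therefore \<open>G\<close> maps bounded sets of
  \<open>L\<^sub>2\<close> to bounded equicontinuous sets of functions on \<open>[0,1]\<close>, and it is compact by the
  Arzela-Ascoli theorem (\<open>G_compact\<close>).

  The kernel of \<open>G\<close> is symmetric and \<open>G (l[y]) = y\<close> for test functions \<open>y\<close>, so \<open>f - G u\<close> is
  orthogonal to all \<open>l[y]\<close>. Differentiation has codimension one in the space of test functions, and
  multiplication by \<open>c\<close> is a bijection of it, so the functions \<open>l[y]\<close> have finite codimension there
  (\<open>range_diff_expr_finite_codim\<close>). Test functions separate square integrable functions, and thus
  \<open>f - G u\<close> ranges over a finite-dimensional space, where bounded sequences have convergent
  subsequences. Adding the compact part \<open>G u\<close> gives the claim (\<open>half_interval_compactness\<close>).\<close>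

section \<open>The Hilbert space \<open>L\<^sub>2(I)\<close>\<close>

abbreviation MI :: "real measure" where "MI \<equiv> lebesgue_on {-1..1}"

lemma cinner_abs_L2I:
  "square_integrable f \<Longrightarrow> square_integrable g \<Longrightarrow>
    cinner (abs_L2I f) (abs_L2I g) = (LINT x|MI. f x * cnj (g x))"
  by (rule cinner.abs_eq) auto

lemma L2I_cases:
  obtains f where "square_integrable f" "w = abs_L2I f"
  using L2I.abs_induct[of "\<lambda>w. \<exists>f. square_integrable f \<and> w = abs_L2I f" w] by blast

lemma abs_L2I_eqI:
  "square_integrable f \<Longrightarrow> square_integrable g \<Longrightarrow> AE x in MI. f x = g x \<Longrightarrow> abs_L2I f = abs_L2I g"
  using Quotient3_rel_abs[OF Quotient3_L2I] by blast

lemma abs_L2I_add: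
  "square_integrable f \<Longrightarrow> square_integrable g \<Longrightarrow> abs_L2I f + abs_L2I g = abs_L2I (\<lambda>x. f x + g x)"
  by (rule plus_L2I.abs_eq) auto

lemma abs_L2I_scaleC: "square_integrable f \<Longrightarrow> z *\<^sub>C abs_L2I f = abs_L2I (\<lambda>x. z * f x)"
  by (rule scaleC.abs_eq) auto

lemma square_integrable_diff:
  "square_integrable f \<Longrightarrow> square_integrable g \<Longrightarrow> square_integrable (\<lambda>x. f x - g x)"
  using square_integrable_add[OF _ square_integrable_cmult[of g "-1"]] by simp

lemma abs_L2I_diff:
  "square_integrable f \<Longrightarrow> square_integrable g \<Longrightarrow> abs_L2I f - abs_L2I g = abs_L2I (\<lambda>x. f x - g x)"
  unfolding minus_L2I_def by (subst abs_L2I_scaleC, assumption, subst abs_L2I_add)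
    (use square_integrable_cmult[of g "-1"] in auto)

lemma scaleR_eq_scaleC: "r *\<^sub>R (w::L2I) = of_real r *\<^sub>C w"
  by (rule scaleR_L2I_def)

lemma cinner_diff_left: "cinner (f - g) h = cinner f h - cinner g h"
  unfolding minus_L2I_def cinner_add_left cinner_scaleC_left by simp

lemma cinner_add_right: "cinner h (f + g) = cinner h f + cinner h g"
  by (subst (1 2 3) cinner_commute) (simp add: cinner_add_left)

lemma cinner_scaleC_right: "cinner h (z *\<^sub>C f) = cnj z * cinner h f"
  by (subst (1 2) cinner_commute) (simp add: cinner_scaleC_left)

lemma cinner_zero_left [simp]: "cinner 0 g = 0"
  using cinner_scaleC_left[of 0 0 g] by simp

lemma cinner_zero_right [simp]: "cinner g 0 = 0"
  using cinner_scaleC_right[of g 0 0] by simp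

lemma cinner_self: "cinner f f = of_real ((norm f)\<^sup>2)"
  using cinner_eq_zero_iff[of f] by (simp add: complex_eq_iff norm_L2I_def inner_L2I_def)

lemma norm_scaleC: "norm (z *\<^sub>C f) = cmod z * norm (f::L2I)"
proof -
  have "complex_of_real ((norm (z *\<^sub>C f))\<^sup>2) = of_real ((cmod z * norm f)\<^sup>2)"
    unfolding cinner_self[symmetric] cinner_scaleC_left cinner_scaleC_right
    unfolding cinner_self power_mult_distrib of_real_mult complex_norm_square[of z] by (simp only: mult_ac)
  then have "(norm (z *\<^sub>C f))\<^sup>2 = (cmod z * norm f)\<^sup>2" by (simp only: of_real_eq_iff)
  then show ?thesis by (simp add: power2_eq_iff_nonneg)
qed

lemma norm_abs_L2I:
  assumes "square_integrable f"
  shows "(norm (abs_L2I f))\<^sup>2 = (LINT x|MI. (cmod (f x))\<^sup>2)"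
proof -
  have "complex_of_real ((norm (abs_L2I f))\<^sup>2) = (LINT x|MI. f x * cnj (f x))"
    unfolding cinner_self[symmetric] by (rule cinner_abs_L2I[OF assms assms])
  also have "\<dots> = of_real (LINT x|MI. (cmod (f x))\<^sup>2)"
    by (subst complex_norm_square[symmetric]) (rule integral_complex_of_real)
  finally show ?thesis by (simp only: of_real_eq_iff)
qed

lemma cmod_cinner_le: "cmod (cinner f g) \<le> 2 * (norm f * norm g)"
proof -
  have re: "\<bar>Re (cinner f g)\<bar> \<le> norm f * norm g" for f g
    using Cauchy_Schwarz_ineq2[of f g] by (simp add: inner_L2I_def)
  have "\<bar>Im (cinner f g)\<bar> \<le> norm f * norm g"
    using re[of "\<i> *\<^sub>C f" g] by (simp add: cinner_scaleC_left norm_scaleC)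
  with re[of f g] show ?thesis using cmod_le[of "cinner f g"] by linarith
qed

lemma tendsto_cinner [tendsto_intros]:
  assumes "(f \<longlongrightarrow> a) F" "(g \<longlongrightarrow> b) F"
  shows "((\<lambda>n. cinner (f n) (g n)) \<longlongrightarrow> cinner a b) F"
proof -
  have bb: "bounded_bilinear cinner"
  proof
    show "\<exists>K. \<forall>a b. norm (cinner a b) \<le> norm a * norm b * K"
      using cmod_cinner_le by (intro exI[of _ 2]) (auto simp: mult_ac)
  qed (simp_all add: cinner_add_left cinner_add_right scaleR_eq_scaleC cinner_scaleC_left
        cinner_scaleC_right scaleR_conv_of_real)
  show ?thesis by (rule bounded_bilinear.tendsto[OF bb assms])
qed

lemma tendsto_scaleC [tendsto_intros]:
  assumes "(z \<longlongrightarrow> a) F" "(g \<longlongrightarrow> (b::L2I)) F"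
  shows "((\<lambda>n. z n *\<^sub>C g n) \<longlongrightarrow> a *\<^sub>C b) F"
proof -
  have bb: "bounded_bilinear scaleC"
  proof
    show "\<exists>K. \<forall>a b. norm (a *\<^sub>C b) \<le> norm a * norm b * K"
      by (intro exI[of _ 1]) (simp add: norm_scaleC)
  qed (simp_all add: complex_L2I.scale_left_distrib complex_L2I.scale_right_distrib scaleR_eq_scaleC
        scaleR_conv_of_real mult_ac)
  show ?thesis by (rule bounded_bilinear.tendsto[OF bb assms])
qed

lemma integrable_if_square_integrable:
  assumes "square_integrable f"
  shows "integrable MI f" and "(LINT x|MI. cmod (f x)) \<le> 2 * norm (abs_L2I f)"
proof -
  have one: "square_integrable (\<lambda>x. 1)" by (simp add: square_integrable_def integrable_const_ivl)
  show "integrable MI f" using square_integrable_prod[OF assms one] by simp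
  have n: "square_integrable (\<lambda>x. of_real (cmod (f x)))"
    using assms unfolding square_integrable_def by (auto intro: measurable_compose[OF borel_measurable_norm])
  have "complex_of_real (LINT x|MI. cmod (f x)) = cinner (abs_L2I (\<lambda>x. of_real (cmod (f x)))) (abs_L2I (\<lambda>x. 1))"
    using n one by (simp add: cinner_abs_L2I)
  then have "(LINT x|MI. cmod (f x)) = inner (abs_L2I (\<lambda>x. of_real (cmod (f x)))) (abs_L2I (\<lambda>x. 1))"
    unfolding inner_L2I_def by (metis Re_complex_of_real)
  also have "\<dots> \<le> norm (abs_L2I (\<lambda>x. of_real (cmod (f x)))) * norm (abs_L2I (\<lambda>x. 1))"
    by (rule norm_cauchy_schwarz)
  also have "norm (abs_L2I (\<lambda>x. of_real (cmod (f x)))) = norm (abs_L2I f)"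
    by (rule power2_eq_imp_eq)
      (simp_all only: norm_abs_L2I[OF n] norm_abs_L2I[OF assms] norm_of_real abs_norm_cancel norm_ge_zero)
  finally have "(LINT x|MI. cmod (f x)) \<le> norm (abs_L2I f) * norm (abs_L2I (\<lambda>x. 1))" .
  moreover have "norm (abs_L2I (\<lambda>x. 1)) \<le> 2"
  proof -
    have "(norm (abs_L2I (\<lambda>x. 1)))\<^sup>2 = 2" by (simp add: norm_abs_L2I[OF one] measure_restrict_space)
    then show ?thesis by (simp add: power2_le_imp_le)
  qed
  ultimately show "(LINT x|MI. cmod (f x)) \<le> 2 * norm (abs_L2I f)"
    by (metis mult.commute mult_left_mono norm_ge_zero order_trans)
qed

text \<open>The Riesz-Fischer argument: a subsequence with geometrically decreasing increments converges
  almost everywhere, and Fatou's lemma turns the pointwise limit into a limit in norm.\<close>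

lemma L2I_Cauchy_convergent:
  fixes X :: "nat \<Rightarrow> L2I"
  assumes "Cauchy X"
  shows "convergent X"
proof -
  have "\<exists>N. \<forall>m\<ge>N. \<forall>n\<ge>N. norm (X m - X n) < (1/2)^k" for k
    using CauchyD[OF assms, of "(1/2)^k"] by auto
  then obtain N where N: "\<And>k m n. m \<ge> N k \<Longrightarrow> n \<ge> N k \<Longrightarrow> norm (X m - X n) < (1/2)^k" by metis
  define r where "r k = (\<Sum>i\<le>k. N i + 1)" for k
  have r: "strict_mono r" by (rule strict_monoI_Suc) (simp add: r_def)
  have rN: "r k \<ge> N j" if "j \<le> k" for j k
  proof -
    have "N j + 1 \<le> r k" unfolding r_def by (rule member_le_sum) (use that in auto)
    then show ?thesis by simp
  qed
  have "\<forall>k. \<exists>f. square_integrable f \<and> X (r k) = abs_L2I f" using L2I_cases by metis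
  then obtain f where f: "\<And>k. square_integrable (f k)" and Xf: "\<And>k. X (r k) = abs_L2I (f k)" by metis
  have meas: "f k \<in> borel_measurable MI" for k using f by (simp add: square_integrable_def)
  have d: "square_integrable (\<lambda>x. f j x - f k x)" for j k by (intro square_integrable_diff f)
  have nd: "(LINT x|MI. (cmod (f j x - f k x))\<^sup>2) = (norm (X (r j) - X (r k)))\<^sup>2" for j k
    using norm_abs_L2I[OF d] by (simp add: Xf abs_L2I_diff f)
  define h where "h k x = cmod (f (Suc k) x - f k x)" for k x
  have hi: "integrable MI (h k)" for k
    unfolding h_def using integrable_if_square_integrable(1)[OF d] by (rule integrable_norm)
  have hle: "(LINT x|MI. h k x) \<le> 2 * (1/2)^k" for k
  proof -
    have "(LINT x|MI. h k x) \<le> 2 * norm (X (r (Suc k)) - X (r k))"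
      unfolding h_def using integrable_if_square_integrable(2)[OF d] by (simp add: Xf abs_L2I_diff f)
    also have "norm (X (r (Suc k)) - X (r k)) \<le> (1/2)^k"
      by (rule less_imp_le, rule N) (rule rN, simp)+
    finally show ?thesis by simp
  qed
  \<comment> \<open>along the fast subsequence the increments are summable almost everywhere\<close>
  have "(\<integral>\<^sup>+ x. (\<Sum>k. ennreal (h k x)) \<partial>MI) = (\<Sum>k. \<integral>\<^sup>+ x. ennreal (h k x) \<partial>MI)"
    by (rule nn_integral_suminf) (use hi borel_measurable_integrable in measurable)
  also have "\<dots> = (\<Sum>k. ennreal (LINT x|MI. h k x))"
    by (intro suminf_cong nn_integral_eq_integral hi) (simp add: h_def)
  also have "\<dots> \<le> (\<Sum>k. ennreal (2 * (1/2)^k))"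
    by (intro suminf_le ennreal_leI hle) auto
  also have "\<dots> < \<infinity>"
    by (subst suminf_ennreal2) (auto intro!: summable_mult summable_geometric)
  finally have "(\<integral>\<^sup>+ x. (\<Sum>k. ennreal (h k x)) \<partial>MI) \<noteq> \<infinity>" by simp
  then have "AE x in MI. (\<Sum>k. ennreal (h k x)) \<noteq> \<infinity>"
    by (intro nn_integral_PInf_AE) (use hi borel_measurable_integrable in measurable)
  then have "AE x in MI. convergent (\<lambda>k. f k x)"
  proof eventually_elim
    case (elim x)
    then have "summable (\<lambda>k. h k x)" by (intro summable_suminf_not_top) (auto simp: h_def)
    then have "summable (\<lambda>k. f (Suc k) x - f k x)" unfolding h_def by (rule summable_norm_cancel)
    then have "convergent (\<lambda>n. \<Sum>k<n. f (Suc k) x - f k x)" by (simp add: summable_iff_convergent)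
    then have "convergent (\<lambda>n. f n x - f 0 x)" by (simp only: sum_lessThan_telescope[of "\<lambda>k. f k x"])
    from convergent_add[OF this convergent_const[of "f 0 x"]] show ?case by simp
  qed
  then have lim: "AE x in MI. (\<lambda>k. f k x) \<longlonglongrightarrow> lim (\<lambda>k. f k x)"
    by eventually_elim (simp add: convergent_LIMSEQ_iff)
  define g where "g x = lim (\<lambda>k. f k x)" for x
  have gm: "g \<in> borel_measurable MI"
    unfolding g_def using meas by (rule borel_measurable_lim_metric)
  have fatou: "(\<integral>\<^sup>+ x. ennreal ((cmod (g x - f j x))\<^sup>2) \<partial>MI) \<le> ennreal (((1/2)^j)\<^sup>2)" for j
  proof -
    have "(\<integral>\<^sup>+ x. ennreal ((cmod (g x - f j x))\<^sup>2) \<partial>MI)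
        = (\<integral>\<^sup>+ x. liminf (\<lambda>k. ennreal ((cmod (f k x - f j x))\<^sup>2)) \<partial>MI)"
    proof (rule nn_integral_cong_AE)
      show "AE x in MI. ennreal ((cmod (g x - f j x))\<^sup>2) = liminf (\<lambda>k. ennreal ((cmod (f k x - f j x))\<^sup>2))"
        using lim
      proof eventually_elim
        case (elim x)
        then have "(\<lambda>k. ennreal ((cmod (f k x - f j x))\<^sup>2)) \<longlonglongrightarrow> ennreal ((cmod (g x - f j x))\<^sup>2)"
          unfolding g_def by (intro tendsto_intros)
        then show ?case by (rule lim_imp_Liminf[OF sequentially_bot, symmetric])
      qed
    qed
    also have "\<dots> \<le> liminf (\<lambda>k. \<integral>\<^sup>+ x. ennreal ((cmod (f k x - f j x))\<^sup>2) \<partial>MI)"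
      by (rule nn_integral_liminf) (use meas in measurable)
    also have "\<dots> \<le> ennreal (((1/2)^j)\<^sup>2)"
    proof (rule Liminf_le)
      show "\<forall>\<^sub>F k in sequentially. (\<integral>\<^sup>+ x. ennreal ((cmod (f k x - f j x))\<^sup>2) \<partial>MI) \<le> ennreal (((1/2)^j)\<^sup>2)"
        using eventually_ge_at_top[of j]
      proof eventually_elim
        case (elim k)
        have "(\<integral>\<^sup>+ x. ennreal ((cmod (f k x - f j x))\<^sup>2) \<partial>MI) = ennreal ((norm (X (r k) - X (r j)))\<^sup>2)"
          by (subst nn_integral_eq_integral) (use d[of k j] nd in \<open>auto simp: square_integrable_def\<close>)
        also have "\<dots> \<le> ennreal (((1/2)^j)\<^sup>2)"
          by (intro ennreal_leI power_mono less_imp_le N rN elim norm_ge_zero order_refl)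
        finally show ?case .
      qed
    qed simp
    finally show ?thesis .
  qed
  have sd: "square_integrable (\<lambda>x. g x - f j x)" for j
    unfolding square_integrable_def
  proof
    show m: "(\<lambda>x. g x - f j x) \<in> borel_measurable MI" using gm meas by measurable
    have "(\<lambda>x. (cmod (g x - f j x))\<^sup>2) \<in> borel_measurable MI" using m by measurable
    moreover have "(\<integral>\<^sup>+ x. ennreal (norm ((cmod (g x - f j x))\<^sup>2)) \<partial>MI) < \<infinity>"
      using fatou[of j] by (simp add: le_less_trans)
    ultimately show "integrable MI (\<lambda>x. (cmod (g x - f j x))\<^sup>2)" by (simp add: integrable_iff_bounded)
  qed
  have sg: "square_integrable g"
    using square_integrable_add[OF sd[of 0] f[of 0]] by simp
  have nb: "norm (abs_L2I g - X (r j)) \<le> (1/2)^j" for j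
  proof (rule power2_le_imp_le)
    have "ennreal ((norm (abs_L2I g - X (r j)))\<^sup>2) = (\<integral>\<^sup>+ x. ennreal ((cmod (g x - f j x))\<^sup>2) \<partial>MI)"
      using sd[of j] unfolding Xf abs_L2I_diff[OF sg f] norm_abs_L2I[OF sd]
      by (intro nn_integral_eq_integral[symmetric]) (auto simp: square_integrable_def)
    also note fatou
    finally show "(norm (abs_L2I g - X (r j)))\<^sup>2 \<le> ((1/2)^j)\<^sup>2" by (simp add: ennreal_le_iff)
  qed simp
  have "(\<lambda>j. X (r j)) \<longlonglongrightarrow> abs_L2I g"
  proof (rule LIMSEQ_I)
    fix e :: real assume "e > 0"
    then obtain n where n: "(1/2)^n < e" using real_arch_pow_inv[of e "1/2"] by auto
    have "norm (X (r j) - abs_L2I g) < e" if "j \<ge> n" for j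
    proof -
      have "norm (X (r j) - abs_L2I g) \<le> (1/2)^j" using nb[of j] by (simp add: norm_minus_commute)
      also have "\<dots> \<le> (1/2)^n" using that by (intro power_decreasing) auto
      finally show ?thesis using n by simp
    qed
    then show "\<exists>no. \<forall>n\<ge>no. norm (X (r n) - abs_L2I g) < e" by blast
  qed
  then have "X \<longlonglongrightarrow> abs_L2I g"
    using Cauchy_converges_subseq[OF assms r] by (simp add: o_def)
  then show ?thesis by (rule convergentI)
qed

text \<open>The witness is the residual of the best approximation of a vector outside the subspace; the best
  approximation exists by completeness and the parallelogram law.\<close>

lemma orthogonal_to_closed_subspace:
  fixes S :: "L2I set"
  assumes cl: "closed S" and ne: "0 \<in> S"
    and add: "\<And>f g. f \<in> S \<Longrightarrow> g \<in> S \<Longrightarrow> f + g \<in> S"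
    and scale: "\<And>z f. f \<in> S \<Longrightarrow> z *\<^sub>C f \<in> S"
    and proper: "S \<noteq> UNIV"
  obtains h where "h \<noteq> 0" "\<And>f. f \<in> S \<Longrightarrow> cinner f h = 0"
proof -
  obtain g where g: "g \<notin> S" using proper by blast
  have scaleR: "r *\<^sub>R f \<in> S" if "f \<in> S" for r f using scale[OF that] by (simp add: scaleR_eq_scaleC)
  define d where "d = (INF f\<in>S. norm (g - f))"
  have bdd: "bdd_below ((\<lambda>f. norm (g - f)) ` S)" by (rule bdd_belowI[of _ 0]) auto
  have d_le: "d \<le> norm (g - f)" if "f \<in> S" for f unfolding d_def by (rule cINF_lower[OF bdd that])
  have d0: "d \<ge> 0" unfolding d_def using ne by (intro cINF_greatest) auto
  have "\<exists>f\<in>S. norm (g - f) < d + inverse (real (Suc n))" for n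
    using cINF_less_iff[OF _ bdd, of "d + inverse (real (Suc n))"] ne d_def
    by (metis add_less_cancel_left add.right_neutral empty_iff inverse_positive_iff_positive of_nat_0_less_iff zero_less_Suc)
  then obtain F where F: "\<And>n. F n \<in> S" "\<And>n. norm (g - F n) < d + inverse (real (Suc n))" by metis
  \<comment> \<open>parallelogram law, with the midpoint of \<open>F m\<close> and \<open>F n\<close> again a competitor\<close>
  have par: "(norm (F m - F n))\<^sup>2 \<le> 2 * (norm (g - F m))\<^sup>2 + 2 * (norm (g - F n))\<^sup>2 - 4 * d\<^sup>2" for m n
  proof -
    have "d \<le> norm (g - (1/2) *\<^sub>R (F m + F n))" by (intro d_le scaleR add F)
    then have "d\<^sup>2 \<le> (norm (g - (1/2) *\<^sub>R (F m + F n)))\<^sup>2" using d0 by (intro power_mono) auto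
    moreover have "(norm (F m - F n))\<^sup>2 + 4 * (norm (g - (1/2) *\<^sub>R (F m + F n)))\<^sup>2
        = 2 * (norm (g - F m))\<^sup>2 + 2 * (norm (g - F n))\<^sup>2"
      unfolding power2_norm_eq_inner by (simp add: inner_simps inner_commute algebra_simps)
    ultimately show ?thesis by simp
  qed
  have lim1: "(\<lambda>n. norm (g - F n)) \<longlonglongrightarrow> d"
  proof (rule tendsto_sandwich)
    show "\<forall>\<^sub>F n in sequentially. d \<le> norm (g - F n)" using d_le F by simp
    show "\<forall>\<^sub>F n in sequentially. norm (g - F n) \<le> d + inverse (real (Suc n))"
      using F(2) by (simp add: less_imp_le)
    show "(\<lambda>n. d + inverse (real (Suc n))) \<longlonglongrightarrow> d"
      using tendsto_add[OF tendsto_const LIMSEQ_inverse_real_of_nat] by simp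
  qed auto
  have "Cauchy F"
  proof (rule CauchyI)
    fix e :: real assume e: "e > 0"
    have "(\<lambda>n. (norm (g - F n))\<^sup>2 - d\<^sup>2) \<longlonglongrightarrow> d\<^sup>2 - d\<^sup>2" by (intro tendsto_intros lim1)
    then have "\<forall>\<^sub>F n in sequentially. (norm (g - F n))\<^sup>2 - d\<^sup>2 < e\<^sup>2 / 4"
      by (rule order_tendstoD) (use e in simp)
    then obtain N where N: "\<And>n. n \<ge> N \<Longrightarrow> (norm (g - F n))\<^sup>2 - d\<^sup>2 < e\<^sup>2 / 4"
      by (auto simp: eventually_sequentially)
    have "norm (F m - F n) < e" if "m \<ge> N" "n \<ge> N" for m n
    proof (rule power_less_imp_less_base[of _ 2])
      show "(norm (F m - F n))\<^sup>2 < e\<^sup>2"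
        using par[of m n] N[OF that(1)] N[OF that(2)] by linarith
    qed (use e in simp)
    then show "\<exists>M. \<forall>m\<ge>M. \<forall>n\<ge>M. norm (F m - F n) < e" by blast
  qed
  then obtain f0 where f0: "F \<longlonglongrightarrow> f0" using L2I_Cauchy_convergent by (auto simp: convergent_def)
  have f0S: "f0 \<in> S" using closed_sequentially[OF cl] F f0 by blast
  have nf0: "norm (g - f0) = d"
    using LIMSEQ_unique[OF lim1 tendsto_norm[OF tendsto_diff[OF tendsto_const f0]]] by simp
  have orth: "inner f (g - f0) = 0" if f: "f \<in> S" for f
  proof (rule ccontr)
    assume ne: "inner f (g - f0) \<noteq> 0"
    then have nz: "inner f f \<noteq> 0" by auto
    \<comment> \<open>the step along \<open>f\<close> that would shorten the residual most\<close>
    define t where "t = inner f (g - f0) / inner f f"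
    have expand: "(norm (v - t *\<^sub>R f))\<^sup>2 = (norm v)\<^sup>2 - 2 * t * inner f v + t * (t * inner f f)" for v
      unfolding power2_norm_eq_inner by (simp add: inner_diff_left inner_diff_right inner_commute[of v f] algebra_simps)
    have "d \<le> norm (g - (f0 + t *\<^sub>R f))" by (intro d_le add scaleR f0S f)
    then have "(norm (g - f0))\<^sup>2 \<le> (norm ((g - f0) - t *\<^sub>R f))\<^sup>2"
      using d0 nf0 by (intro power_mono) (auto simp: algebra_simps)
    also have "\<dots> = (norm (g - f0))\<^sup>2 - 2 * t * inner f (g - f0) + t * (t * inner f f)"
      by (rule expand)
    also have "\<dots> = (norm (g - f0))\<^sup>2 - (inner f (g - f0))\<^sup>2 / inner f f"
      using nz by (simp add: t_def power2_eq_square)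
    finally have "(inner f (g - f0))\<^sup>2 / inner f f \<le> 0" by simp
    moreover have "(inner f (g - f0))\<^sup>2 / inner f f > 0"
      using ne nz inner_ge_zero[of f] by (intro divide_pos_pos) (auto simp: less_le)
    ultimately show False by simp
  qed
  have "cinner f (g - f0) = 0" if f: "f \<in> S" for f
  proof -
    have "Re (cinner f (g - f0)) = 0" using orth[OF f] by (simp add: inner_L2I_def)
    moreover have "Re (cinner (\<i> *\<^sub>C f) (g - f0)) = 0"
      using orth[OF scale[OF f]] by (simp add: inner_L2I_def)
    ultimately show ?thesis by (simp add: cinner_scaleC_left complex_eq_iff)
  qed
  moreover have "g - f0 \<noteq> 0" using g f0S by auto
  ultimately show thesis using that by blast
qed

section \<open>Compact embedding of the domain implies a discrete spectrum\<close>

text \<open>Compactness of the embedding of the domain, normed by the graph norm, in sequential form.\<close>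

definition compactly_embedded_domain :: "(L2I \<times> L2I) set \<Rightarrow> bool" where
  "compactly_embedded_domain A \<longleftrightarrow> (\<forall>f u K. (\<forall>n. (f n, u n) \<in> A \<and> norm (f n) \<le> K \<and> norm (u n) \<le> K) \<longrightarrow>
     (\<exists>r. strict_mono (r::nat \<Rightarrow> nat) \<and> convergent (\<lambda>n. f (r n) :: L2I)))"

definition complex_subspace :: "L2I set \<Rightarrow> bool" where
  "complex_subspace W \<longleftrightarrow> 0 \<in> W \<and> (\<forall>f\<in>W. \<forall>g\<in>W. f + g \<in> W) \<and> (\<forall>z. \<forall>f\<in>W. z *\<^sub>C f \<in> W)"

text \<open>Induction on the number of functionals: either the last one vanishes on the subspace, or the
  subspace is the sum of the kernel of that functional and a line. Continuity of the functionals
  keeps both components of a bounded sequence bounded. The span is used for eigenspaces, the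
  subsequences for the solution spaces of the differential equation.\<close>

lemma finite_dimensional_if_separated:
  assumes "finite \<Phi>" "complex_subspace W" "\<And>f. f \<in> W \<Longrightarrow> (\<forall>\<phi>\<in>\<Phi>. cinner f \<phi> = 0) \<Longrightarrow> f = 0"
  shows "(\<exists>B. finite B \<and> W \<subseteq> complex_L2I.span B) \<and>
    (\<forall>f K. (\<forall>n. f n \<in> W \<and> norm (f n) \<le> K) \<longrightarrow> (\<exists>r. strict_mono (r::nat \<Rightarrow> nat) \<and> convergent (\<lambda>n. f (r n))))"
  using assms
proof (induction \<Phi> arbitrary: W rule: finite_induct)
  case empty
  then have W: "W \<subseteq> {0}" by auto
  have "finite {}" "W \<subseteq> complex_L2I.span {}" using W by auto
  moreover have "\<exists>r. strict_mono (r::nat \<Rightarrow> nat) \<and> convergent (\<lambda>n. f (r n))" if "\<forall>n. f n \<in> W" for f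
  proof -
    have "f = (\<lambda>n. 0)" using that W by auto
    then show ?thesis using strict_mono_id convergent_const by fastforce
  qed
  ultimately show ?case by blast
next
  case (insert \<phi> \<Phi>)
  define W' where "W' = {f\<in>W. cinner f \<phi> = 0}"
  have W'sub: "complex_subspace W'"
    using insert.prems(1) by (auto simp: complex_subspace_def W'_def cinner_add_left cinner_scaleC_left)
  have W'sep: "f = 0" if "f \<in> W'" "\<forall>\<phi>\<in>\<Phi>. cinner f \<phi> = 0" for f
    using that insert.prems(2) by (auto simp: W'_def)
  note IH = insert.IH[OF W'sub W'sep]
  show ?case
  proof (cases "W' = W")
    case True then show ?thesis using IH by simp
  next
    case False
    then obtain e0 where e0: "e0 \<in> W" "cinner e0 \<phi> \<noteq> 0" by (auto simp: W'_def)
    define e where "e = inverse (cinner e0 \<phi>) *\<^sub>C e0"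
    have e: "e \<in> W" "cinner e \<phi> = 1"
      using e0 insert.prems(1) by (auto simp: e_def complex_subspace_def cinner_scaleC_left)
    define Q where "Q f = f - cinner f \<phi> *\<^sub>C e" for f
    have Q: "Q f \<in> W'" if "f \<in> W" for f
    proof -
      have "f + (- cinner f \<phi>) *\<^sub>C e \<in> W" using that e insert.prems(1) unfolding complex_subspace_def by blast
      then have "Q f \<in> W" by (simp add: Q_def)
      then show ?thesis using e by (simp add: W'_def Q_def cinner_diff_left cinner_scaleC_left)
    qed
    have fQ: "f = Q f + cinner f \<phi> *\<^sub>C e" for f by (simp add: Q_def)
    obtain B where B: "finite B" "W' \<subseteq> complex_L2I.span B" using IH by blast
    have "f \<in> complex_L2I.span (insert e B)" if "f \<in> W" for f
    proof -
      have "Q f \<in> complex_L2I.span (insert e B)" using Q[OF that] B complex_L2I.span_mono[of B "insert e B"] by blast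
      moreover have "cinner f \<phi> *\<^sub>C e \<in> complex_L2I.span (insert e B)"
        by (intro complex_L2I.span_scale complex_L2I.span_base) simp
      ultimately show ?thesis using fQ complex_L2I.span_add by metis
    qed
    moreover have "\<exists>r. strict_mono (r::nat \<Rightarrow> nat) \<and> convergent (\<lambda>n. f (r n))"
      if f: "\<forall>n. f n \<in> W \<and> norm (f n) \<le> K" for f :: "nat \<Rightarrow> L2I" and K
    proof -
      have K: "0 \<le> K" using f norm_ge_zero order_trans by blast
      have cb: "cmod (cinner (f n) \<phi>) \<le> 2 * (K * norm \<phi>)" for n
        using cmod_cinner_le[of "f n" \<phi>] f mult_right_mono[of "norm (f n)" K "norm \<phi>"] by fastforce
      then have "bounded (range (\<lambda>n. cinner (f n) \<phi>))" by (auto simp: bounded_iff)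
      then obtain l r1 where r1: "strict_mono (r1::nat\<Rightarrow>nat)" and l: "((\<lambda>n. cinner (f n) \<phi>) \<circ> r1) \<longlonglongrightarrow> l"
        using bounded_imp_convergent_subsequence by blast
      have "norm (Q (f (r1 n))) \<le> K + 2 * (K * norm \<phi>) * norm e" for n
      proof -
        have "norm (Q (f (r1 n))) \<le> norm (f (r1 n)) + norm (cinner (f (r1 n)) \<phi> *\<^sub>C e)"
          unfolding Q_def by (rule norm_triangle_ineq4)
        also have "\<dots> \<le> K + 2 * (K * norm \<phi>) * norm e"
          unfolding norm_scaleC using f cb by (intro add_mono mult_right_mono) auto
        finally show ?thesis .
      qed
      then obtain r2 where r2: "strict_mono (r2::nat\<Rightarrow>nat)" "convergent (\<lambda>n. Q (f (r1 (r2 n))))"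
        using IH[THEN conjunct2, rule_format, of "\<lambda>n. Q (f (r1 n))"] Q f by blast
      have "(\<lambda>n. cinner (f (r1 (r2 n))) \<phi>) \<longlonglongrightarrow> l"
        using LIMSEQ_subseq_LIMSEQ[OF l r2(1)] by (simp add: o_def)
      then have "(\<lambda>n. cinner (f (r1 (r2 n))) \<phi> *\<^sub>C e) \<longlonglongrightarrow> l *\<^sub>C e" by (intro tendsto_intros)
      then have "convergent (\<lambda>n. Q (f (r1 (r2 n))) + cinner (f (r1 (r2 n))) \<phi> *\<^sub>C e)"
        using r2(2) by (intro convergent_add) (auto intro: convergentI)
      then have "convergent (\<lambda>n. f ((r1 \<circ> r2) n))" using fQ by simp
      then show ?thesis using strict_mono_o[OF r1 r2(1)] by blast
    qed
    ultimately show ?thesis using B(1) by (metis finite_insert subsetI)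
  qed
qed

context
  fixes A :: "(L2I \<times> L2I) set"
  assumes sa: "self_adjoint_operator A"
begin

lemma
  shows graph_zero: "(0, 0) \<in> A"
    and graph_add: "(f, u) \<in> A \<Longrightarrow> (g, v) \<in> A \<Longrightarrow> (f + g, u + v) \<in> A"
    and graph_scale: "(f, u) \<in> A \<Longrightarrow> (z *\<^sub>C f, z *\<^sub>C u) \<in> A"
  using sa by (auto simp: self_adjoint_operator_def linear_operator_def)

lemma graph_mem_iff: "(g, v) \<in> A \<longleftrightarrow> (\<forall>(f, u)\<in>A. cinner u g = cinner f v)"
proof -
  have "A = adjoint_operator A" using sa by (simp add: self_adjoint_operator_def)
  then have "(g, v) \<in> A \<longleftrightarrow> (g, v) \<in> adjoint_operator A" by simp
  then show ?thesis unfolding adjoint_operator_def by simp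
qed

lemma graph_symmetric: "(f, u) \<in> A \<Longrightarrow> (g, v) \<in> A \<Longrightarrow> cinner u g = cinner f v"
  using graph_mem_iff by blast

lemma graph_closed:
  assumes "\<And>n. (f n, u n) \<in> A" "f \<longlonglongrightarrow> g" "u \<longlonglongrightarrow> v"
  shows "(g, v) \<in> A"
  unfolding graph_mem_iff
proof (clarify)
  fix h w assume h: "(h, w) \<in> A"
  have "(\<lambda>n. cinner w (f n)) \<longlonglongrightarrow> cinner w g" "(\<lambda>n. cinner h (u n)) \<longlonglongrightarrow> cinner h v"
    by (intro tendsto_intros assms)+
  moreover have "cinner w (f n) = cinner h (u n)" for n using graph_symmetric[OF h assms(1)] .
  ultimately show "cinner w g = cinner h v" using LIMSEQ_unique by force
qed

lemma eigenvalue_real: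
  assumes "(f, z *\<^sub>C f) \<in> A" "f \<noteq> 0"
  shows "cnj z = z"
  using graph_symmetric[OF assms(1,1)] assms(2) by (simp add: cinner_scaleC_left cinner_scaleC_right cinner_self)

context
  assumes cpt: "compactly_embedded_domain A"
begin

text \<open>A normalized sequence on which \<open>A - z\<close> tends to zero would, by compactness, have a subsequence
  converging to an eigenvector.\<close>

lemma bounded_below:
  assumes no: "\<And>f. (f, z *\<^sub>C f) \<in> A \<Longrightarrow> f = 0"
  obtains d where "d > 0" "\<And>f u. (f, u) \<in> A \<Longrightarrow> d * norm f \<le> norm (u - z *\<^sub>C f)"
proof -
  have "\<exists>d>0. \<forall>(f, u)\<in>A. d * norm f \<le> norm (u - z *\<^sub>C f)"
  proof (rule ccontr)
    assume neg: "\<not> ?thesis"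
    have "\<exists>f u. (f, u) \<in> A \<and> norm f = 1 \<and> norm (u - z *\<^sub>C f) < inverse (real (Suc n))" for n
    proof -
      obtain f u where fu: "(f, u) \<in> A" "norm (u - z *\<^sub>C f) < inverse (real (Suc n)) * norm f"
        using neg by (metis (no_types, lifting) case_prodI2 inverse_positive_iff_positive not_le of_nat_0_less_iff zero_less_Suc)
      then have nf: "norm f > 0" by (cases "f = 0") auto
      define k where "k = complex_of_real (inverse (norm f))"
      have "k *\<^sub>C u - z *\<^sub>C k *\<^sub>C f = k *\<^sub>C (u - z *\<^sub>C f)"
        by (simp add: complex_L2I.scale_right_diff_distrib mult.commute)
      then have "norm (k *\<^sub>C u - z *\<^sub>C k *\<^sub>C f) = inverse (norm f) * norm (u - z *\<^sub>C f)"
        using nf by (simp add: norm_scaleC k_def norm_inverse)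
      also have "\<dots> < inverse (norm f) * (inverse (real (Suc n)) * norm f)"
        using fu nf by (intro mult_strict_left_mono) auto
      also have "\<dots> = inverse (real (Suc n))" using nf by simp
      finally have "norm (k *\<^sub>C u - z *\<^sub>C k *\<^sub>C f) < inverse (real (Suc n))" .
      moreover have "norm (k *\<^sub>C f) = 1" using nf by (simp add: norm_scaleC k_def norm_inverse)
      ultimately show ?thesis using graph_scale[OF fu(1)] by blast
    qed
    then obtain f u where A: "\<And>n. (f n, u n) \<in> A" and n1: "\<And>n. norm (f n) = 1"
      and small: "\<And>n. norm (u n - z *\<^sub>C f n) < inverse (real (Suc n))" by metis
    have "norm (u n) \<le> 1 + cmod z" for n
    proof -
      have "norm (u n) \<le> norm (u n - z *\<^sub>C f n) + norm (z *\<^sub>C f n)"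
        using norm_triangle_ineq[of "u n - z *\<^sub>C f n" "z *\<^sub>C f n"] by simp
      also have "norm (u n - z *\<^sub>C f n) \<le> 1"
        using small[of n] by (rule order.trans[OF less_imp_le]) (simp add: inverse_le_1_iff)
      finally show ?thesis by (simp add: norm_scaleC n1)
    qed
    then obtain r where r: "strict_mono r" "convergent (\<lambda>n. f (r n))"
      using cpt[unfolded compactly_embedded_domain_def, rule_format, of f u "1 + cmod z"] A n1 by auto
    then obtain g where g: "(\<lambda>n. f (r n)) \<longlonglongrightarrow> g" by (auto simp: convergent_def)
    have "(\<lambda>n. u n - z *\<^sub>C f n) \<longlonglongrightarrow> 0"
      using small by (intro Lim_null_comparison[OF _ LIMSEQ_inverse_real_of_nat] always_eventually allI less_imp_le)
    then have "(\<lambda>n. u (r n) - z *\<^sub>C f (r n)) \<longlonglongrightarrow> 0"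
      using LIMSEQ_subseq_LIMSEQ[OF _ r(1)] by (fastforce simp: o_def)
    then have "(\<lambda>n. (u (r n) - z *\<^sub>C f (r n)) + z *\<^sub>C f (r n)) \<longlonglongrightarrow> 0 + z *\<^sub>C g"
      by (intro tendsto_intros g)
    then have "(\<lambda>n. u (r n)) \<longlonglongrightarrow> z *\<^sub>C g" by simp
    with g have "(g, z *\<^sub>C g) \<in> A" using graph_closed[of "\<lambda>n. f (r n)" "\<lambda>n. u (r n)"] A by blast
    then have "g = 0" by (rule no)
    moreover have "norm g = 1" using LIMSEQ_unique[OF tendsto_norm[OF g]] by (simp add: n1)
    ultimately show False by simp
  qed
  then show thesis using that by blast
qed

text \<open>The range of \<open>A - z\<close> is closed since \<open>A - z\<close> is bounded below, and a vector orthogonal to it is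
  an eigenvector for \<open>cnj z\<close>. Eigenvalues being real, such a vector is an eigenvector for \<open>z\<close>.\<close>

lemma resolvent_if_not_eigenvalue:
  assumes no: "\<And>f. (f, z *\<^sub>C f) \<in> A \<Longrightarrow> f = 0"
  shows "z \<in> resolvent_set A"
proof -
  obtain d where d: "d > 0" "\<And>f u. (f, u) \<in> A \<Longrightarrow> d * norm f \<le> norm (u - z *\<^sub>C f)"
    using bounded_below[OF no] by blast
  define S where "S = {u - z *\<^sub>C f | f u. (f, u) \<in> A}"
  have lin: "(u - z *\<^sub>C f) + (v - z *\<^sub>C g) = (u + v) - z *\<^sub>C (f + g)"
    "w *\<^sub>C (u - z *\<^sub>C f) = w *\<^sub>C u - z *\<^sub>C w *\<^sub>C f" for f u g v w
    by (simp_all add: complex_L2I.scale_right_distrib complex_L2I.scale_right_diff_distrib mult.commute)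
  have Sadd: "a + b \<in> S" if "a \<in> S" "b \<in> S" for a b
    using that graph_add unfolding S_def mem_Collect_eq by (metis lin(1))
  have Sscale: "w *\<^sub>C a \<in> S" if "a \<in> S" for a w
    using that graph_scale unfolding S_def mem_Collect_eq by (metis lin(2))
  have S0: "0 \<in> S" using graph_zero unfolding S_def mem_Collect_eq by (intro exI[of _ 0]) auto
  have clS: "closed S"
  proof (unfold closed_sequential_limits, clarify)
    fix s l assume s: "\<forall>n. s n \<in> S" and l: "s \<longlonglongrightarrow> l"
    from s obtain f u where A: "\<And>n. (f n, u n) \<in> A" and sn: "\<And>n. s n = u n - z *\<^sub>C f n"
      unfolding S_def mem_Collect_eq by metis
    have "Bseq s" using l by (intro convergent_imp_Bseq convergentI)
    then obtain K where K: "\<And>n. norm (s n) \<le> K" by (auto simp: Bseq_def)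
    have K0: "K \<ge> 0" using K[of 0] norm_ge_zero order_trans by blast
    have nf: "norm (f n) \<le> K / d" for n
      using d(2)[OF A[of n]] K[of n] d(1) by (simp add: sn field_simps)
    have nu: "norm (u n) \<le> K + cmod z * (K / d)" for n
    proof -
      have "norm (u n) \<le> norm (s n) + norm (z *\<^sub>C f n)"
        using norm_triangle_ineq[of "s n" "z *\<^sub>C f n"] by (simp add: sn)
      also have "\<dots> \<le> K + cmod z * (K / d)"
        unfolding norm_scaleC by (intro add_mono mult_left_mono K nf) auto
      finally show ?thesis .
    qed
    define L where "L = max (K / d) (K + cmod z * (K / d))"
    have "\<forall>n. (f n, u n) \<in> A \<and> norm (f n) \<le> L \<and> norm (u n) \<le> L"
      using A nf nu unfolding L_def by (meson max.coboundedI1 max.coboundedI2)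
    then obtain r g where r: "strict_mono r" and g: "(\<lambda>n. f (r n)) \<longlonglongrightarrow> g"
      using cpt unfolding compactly_embedded_domain_def convergent_def by blast
    have "(\<lambda>n. s (r n)) \<longlonglongrightarrow> l" using LIMSEQ_subseq_LIMSEQ[OF l r] by (simp add: o_def)
    then have "(\<lambda>n. s (r n) + z *\<^sub>C f (r n)) \<longlonglongrightarrow> l + z *\<^sub>C g" by (intro tendsto_intros g)
    then have "(\<lambda>n. u (r n)) \<longlonglongrightarrow> l + z *\<^sub>C g" by (simp add: sn)
    with g A have "(g, l + z *\<^sub>C g) \<in> A" using graph_closed[of "\<lambda>n. f (r n)" "\<lambda>n. u (r n)"] by blast
    then show "l \<in> S" unfolding S_def by force
  qed
  have SU: "S = UNIV"
  proof (rule ccontr)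
    assume "S \<noteq> UNIV"
    then obtain h where h: "h \<noteq> 0" "\<And>a. a \<in> S \<Longrightarrow> cinner a h = 0"
      using orthogonal_to_closed_subspace[OF clS S0 Sadd Sscale] by blast
    have "(h, cnj z *\<^sub>C h) \<in> A"
      unfolding graph_mem_iff
    proof clarify
      fix f u assume "(f, u) \<in> A"
      then have "cinner (u - z *\<^sub>C f) h = 0" by (intro h(2)) (auto simp: S_def)
      then show "cinner u h = cinner f (cnj z *\<^sub>C h)"
        by (simp add: cinner_diff_left cinner_scaleC_left cinner_scaleC_right)
    qed
    moreover from eigenvalue_real[OF this h(1)] have "cnj z = z" by simp
    ultimately show False using no h(1) by simp
  qed
  have "\<exists>f u. (f, u) \<in> A \<and> u - z *\<^sub>C f = g" for g
  proof -
    have "g \<in> S" using SU by simp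
    then show ?thesis unfolding S_def by auto
  qed
  then obtain R U where RU: "\<And>g. (R g, U g) \<in> A" "\<And>g. U g - z *\<^sub>C R g = g" by metis
  have uniq: "f = R (u - z *\<^sub>C f)" if "(f, u) \<in> A" for f u
  proof -
    let ?g = "u - z *\<^sub>C f"
    have "(f + (-1) *\<^sub>C R ?g, u + (-1) *\<^sub>C U ?g) \<in> A" by (intro graph_add that graph_scale RU)
    then have "(f - R ?g, u - U ?g) \<in> A" by simp
    moreover have "u - U ?g = z *\<^sub>C (f - R ?g)"
      using RU(2)[of ?g] by (simp add: complex_L2I.scale_right_diff_distrib algebra_simps)
    ultimately have "f - R ?g = 0" using no by metis
    then show ?thesis by simp
  qed
  have "bounded_linear R"
  proof (rule bounded_linear_intro[where K="1/d"])
    fix g h show "R (g + h) = R g + R h"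
      using uniq[OF graph_add[OF RU(1)[of g] RU(1)[of h]]] by (metis RU(2) lin(1))
  next
    fix k g show "R (k *\<^sub>R g) = k *\<^sub>R R g"
      using uniq[OF graph_scale[OF RU(1)[of g], of "of_real k"]] unfolding scaleR_eq_scaleC
      by (metis RU(2) lin(2))
  next
    fix g show "norm (R g) \<le> norm g * (1/d)"
      using d(2)[OF RU(1)[of g]] d(1) by (simp add: RU(2) field_simps)
  qed
  moreover have "{(f, u - z *\<^sub>C f) | f u. (f, u) \<in> A} = {(R g, g) | g. True}"
  proof (intro subset_antisym subsetI; clarify)
    fix f u assume "(f, u) \<in> A" then show "\<exists>g. (f, u - z *\<^sub>C f) = (R g, g) \<and> True" using uniq by blast
  next
    fix g show "\<exists>f u. (R g, g) = (f, u - z *\<^sub>C f) \<and> (f, u) \<in> A" using RU by metis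
  qed
  ultimately show ?thesis unfolding resolvent_set_def by blast
qed

text \<open>Eigenvectors belonging to distinct eigenvalues are orthogonal,
  while by compactness normalized eigenvectors for \<open>w n \<rightarrow> z\<close> would converge to an eigenvector
  for \<open>z\<close>.\<close>

lemma eigenvalue_isolated:
  assumes z: "(h, z *\<^sub>C h) \<in> A" "h \<noteq> 0"
  shows "\<exists>e>0. \<forall>w f. (f, w *\<^sub>C f) \<in> A \<and> f \<noteq> 0 \<and> dist z w < e \<longrightarrow> w = z"
proof (rule ccontr)
  assume neg: "\<not> ?thesis"
  have "\<exists>w f. (f, w *\<^sub>C f) \<in> A \<and> norm f = 1 \<and> dist z w < inverse (real (Suc n)) \<and> w \<noteq> z" for n
  proof -
    obtain w f where wf: "(f, w *\<^sub>C f) \<in> A" "f \<noteq> 0" "dist z w < inverse (real (Suc n))" "w \<noteq> z"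
      using neg by (metis inverse_positive_iff_positive of_nat_0_less_iff zero_less_Suc)
    let ?k = "complex_of_real (inverse (norm f))"
    have "(?k *\<^sub>C f, w *\<^sub>C ?k *\<^sub>C f) \<in> A" using graph_scale[OF wf(1), of ?k] by (simp add: mult.commute)
    moreover have "norm (?k *\<^sub>C f) = 1" using wf(2) by (simp add: norm_scaleC norm_inverse)
    ultimately show ?thesis using wf by blast
  qed
  then obtain w f where A: "\<And>n. (f n, w n *\<^sub>C f n) \<in> A" and n1: "\<And>n. norm (f n) = 1"
    and wz: "\<And>n. dist z (w n) < inverse (real (Suc n))" and ne: "\<And>n. w n \<noteq> z" by metis
  have w: "w \<longlonglongrightarrow> z"
  proof -
    have "(\<lambda>n. dist (w n) z) \<longlonglongrightarrow> 0"
      by (rule tendsto_sandwich[OF _ _ tendsto_const LIMSEQ_inverse_real_of_nat])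
        (use wz in \<open>auto simp: dist_commute less_imp_le\<close>)
    then show ?thesis by (rule tendsto_dist_iff[THEN iffD2])
  qed
  then obtain K where K: "\<And>n. cmod (w n) \<le> K"
    using convergent_imp_Bseq[OF convergentI[OF w]] by (auto simp: Bseq_def)
  have "\<forall>n. (f n, w n *\<^sub>C f n) \<in> A \<and> norm (f n) \<le> max 1 K \<and> norm (w n *\<^sub>C f n) \<le> max 1 K"
    using A n1 K by (auto simp: norm_scaleC le_max_iff_disj)
  then obtain r g where r: "strict_mono r" and g: "(\<lambda>n. f (r n)) \<longlonglongrightarrow> g"
    using cpt[unfolded compactly_embedded_domain_def convergent_def, rule_format, of f "\<lambda>n. w n *\<^sub>C f n" "max 1 K"] by blast
  have "(\<lambda>n. w (r n)) \<longlonglongrightarrow> z" using LIMSEQ_subseq_LIMSEQ[OF w r] by (simp add: o_def)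
  then have "(\<lambda>n. w (r n) *\<^sub>C f (r n)) \<longlonglongrightarrow> z *\<^sub>C g" by (intro tendsto_intros g)
  with g A have gA: "(g, z *\<^sub>C g) \<in> A" using graph_closed[of "\<lambda>n. f (r n)" "\<lambda>n. w (r n) *\<^sub>C f (r n)"] by blast
  have orth: "cinner (f n) g = 0" for n
  proof -
    have "w n * cinner (f n) g = cnj z * cinner (f n) g"
      using graph_symmetric[OF A gA] by (simp add: cinner_scaleC_left cinner_scaleC_right)
    then show ?thesis using ne[of n] eigenvalue_real[OF z] by simp
  qed
  have "(\<lambda>n. cinner (f (r n)) g) \<longlonglongrightarrow> cinner g g" by (intro tendsto_intros g)
  then have "cinner g g = 0" using orth LIMSEQ_unique[OF _ tendsto_const] by simp
  moreover have "norm g = 1" using LIMSEQ_unique[OF tendsto_norm[OF g]] by (simp add: n1)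
  ultimately show False by (simp add: cinner_self)
qed

text \<open>The unit sphere of an eigenspace is compact, so finitely many of its points are within
  distance \<open>1\<close> of all others; a unit vector orthogonal to these points would have distance
  \<open>\<surd>2\<close> from them.\<close>

lemma eigenspace_finite: "finite_multiplicity A z"
proof -
  let ?E = "eigenspace A z"
  let ?S = "{f \<in> ?E. norm f = 1}"
  have sub: "complex_subspace ?E"
    using graph_zero graph_add graph_scale unfolding complex_subspace_def eigenspace_def
    by (auto simp: complex_L2I.scale_right_distrib mult.commute) (metis complex_L2I.scale_scale mult.commute)
  have "seq_compact ?S"
  proof (rule seq_compactI)
    fix f :: "nat \<Rightarrow> L2I" assume f: "\<forall>n. f n \<in> ?S"
    then have "\<forall>n. (f n, z *\<^sub>C f n) \<in> A \<and> norm (f n) \<le> max 1 (cmod z) \<and> norm (z *\<^sub>C f n) \<le> max 1 (cmod z)"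
      by (auto simp: eigenspace_def norm_scaleC)
    then obtain r g where r: "strict_mono r" and g: "(\<lambda>n. f (r n)) \<longlonglongrightarrow> g"
      using cpt[unfolded compactly_embedded_domain_def convergent_def, rule_format, of f "\<lambda>n. z *\<^sub>C f n" "max 1 (cmod z)"] by blast
    have "(\<lambda>n. z *\<^sub>C f (r n)) \<longlonglongrightarrow> z *\<^sub>C g" by (intro tendsto_intros g)
    with g have "(g, z *\<^sub>C g) \<in> A"
      by (rule graph_closed[rotated]) (use f in \<open>simp add: eigenspace_def\<close>)
    moreover have "norm g = 1" using LIMSEQ_unique[OF tendsto_norm[OF g]] f by simp
    ultimately have "g \<in> ?S" by (simp add: eigenspace_def)
    moreover have "(f \<circ> r) \<longlonglongrightarrow> g" unfolding o_def by (rule g)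
    ultimately show "\<exists>l\<in>?S. \<exists>r. strict_mono r \<and> (f \<circ> r) \<longlonglongrightarrow> l"
      using r by blast
  qed
  from seq_compact_imp_totally_bounded[OF this, rule_format, OF zero_less_one]
  obtain \<Phi> where \<Phi>: "finite \<Phi>" "\<Phi> \<subseteq> ?S" "?S \<subseteq> (\<Union>\<phi>\<in>\<Phi>. ball \<phi> 1)"
    by (elim exE conjE)
  have "f = 0" if f: "f \<in> ?E" "\<forall>\<phi>\<in>\<Phi>. cinner f \<phi> = 0" for f
  proof (rule ccontr)
    assume f0: "f \<noteq> 0"
    let ?g = "complex_of_real (inverse (norm f)) *\<^sub>C f"
    have "?g \<in> ?S" using f0 f(1) sub by (auto simp: norm_scaleC norm_inverse complex_subspace_def)
    then obtain \<phi> where \<phi>: "\<phi> \<in> \<Phi>" "norm (\<phi> - ?g) < 1" using \<Phi>(3) by (auto simp: dist_norm)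
    have "inner ?g \<phi> = 0" using f(2) \<phi>(1) by (simp add: inner_L2I_def cinner_scaleC_left)
    then have "(norm (\<phi> - ?g))\<^sup>2 = (norm \<phi>)\<^sup>2 + (norm ?g)\<^sup>2"
      unfolding power2_norm_eq_inner by (simp add: inner_diff_left inner_diff_right inner_commute)
    moreover have "norm \<phi> = 1" using \<phi>(1) \<Phi>(2) by auto
    ultimately have "(norm (\<phi> - ?g))\<^sup>2 \<ge> 1" by simp
    moreover have "(norm (\<phi> - ?g))\<^sup>2 < 1" using \<phi>(2) by (simp add: power_less_one_iff)
    ultimately show False by simp
  qed
  from finite_dimensional_if_separated[OF \<Phi>(1) sub this] show ?thesis
    by (simp add: finite_multiplicity_def)
qed

theorem discrete_spectrum_if_compactly_embedded: "discrete_spectrum A"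
  unfolding discrete_spectrum_def
proof
  have ev: "\<exists>f. (f, w *\<^sub>C f) \<in> A \<and> f \<noteq> 0" if "w \<in> op_spectrum A" for w
    using resolvent_if_not_eigenvalue that unfolding op_spectrum_def by blast
  fix z assume z: "z \<in> op_spectrum A"
  then obtain h where h: "(h, z *\<^sub>C h) \<in> A" "h \<noteq> 0" using ev by blast
  have "z isolated_in op_spectrum A"
    unfolding isolated_in_dist_Ex_iff using z eigenvalue_isolated[OF h] ev by metis
  moreover have "eigenvalue A z" using h by (auto simp: eigenvalue_def eigenspace_def)
  ultimately show "z isolated_in op_spectrum A \<and> eigenvalue A z \<and> finite_multiplicity A z"
    using eigenspace_finite by simp
qed

end

end

section \<open>Iterated derivatives and smooth functions\<close>

text \<open>Smoothness is stated for the pointwise iterated derivative, which is what test functions are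
  defined by. Finite orders of differentiability serve as induction parameter: products, inverses
  and series are differentiated once, and the derivative is of the same kind.\<close>

definition differentiable_times :: "nat \<Rightarrow> real set \<Rightarrow> (real \<Rightarrow> complex) \<Rightarrow> bool" where
  "differentiable_times k S f \<longleftrightarrow> (\<forall>j<k. \<forall>x\<in>S. nth_derivative j f differentiable (at x))"

definition smooth_on :: "real set \<Rightarrow> (real \<Rightarrow> complex) \<Rightarrow> bool" where
  "smooth_on S f \<longleftrightarrow> (\<forall>k. \<forall>x\<in>S. nth_derivative k f differentiable (at x))"

lemma smooth_on_iff: "smooth_on S f \<longleftrightarrow> (\<forall>k. differentiable_times k S f)"
  unfolding smooth_on_def differentiable_times_def by blast

lemma nth_derivative_0 [simp]: "nth_derivative 0 f = f"
  by (simp add: nth_derivative_def)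

lemma nth_derivative_Suc:
  "nth_derivative (Suc k) f = nth_derivative k (\<lambda>x. vector_derivative f (at x))"
  unfolding nth_derivative_def funpow_Suc_right by simp

lemma nth_derivative_Suc':
  "nth_derivative (Suc k) f = (\<lambda>x. vector_derivative (nth_derivative k f) (at x))"
  by (simp add: nth_derivative_def)

lemma nth_derivative_add_index: "nth_derivative j (nth_derivative k f) = nth_derivative (j + k) f"
  by (simp add: nth_derivative_def funpow_add)

lemma has_vector_derivative_cong_open:
  assumes "open S" "x \<in> S" "\<And>y. y \<in> S \<Longrightarrow> f y = g y"
  shows "(f has_vector_derivative d) (at x) \<longleftrightarrow> (g has_vector_derivative d) (at x)"
  using has_vector_derivative_transform_within_open[OF _ assms(1,2), of f d g]
    has_vector_derivative_transform_within_open[OF _ assms(1,2), of g d f] assms(3) by auto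

lemma nth_derivative_cong_open:
  assumes "open S" "\<And>y. y \<in> S \<Longrightarrow> f y = g y"
  shows "x \<in> S \<Longrightarrow> nth_derivative k f x = nth_derivative k g x"
proof (induction k arbitrary: x)
  case 0 then show ?case using assms by simp
next
  case (Suc k)
  show ?case unfolding nth_derivative_Suc' vector_derivative_def
    using has_vector_derivative_cong_open[OF assms(1) Suc.prems Suc.IH] by simp
qed

lemma differentiable_iff_ex_vector_derivative:
  "f differentiable (at x) \<longleftrightarrow> (\<exists>d. (f has_vector_derivative d) (at (x::real)))"
  by (metis differentiableI_vector vector_derivative_works)

lemma differentiable_times_cong:
  assumes "open S" "\<And>y. y \<in> S \<Longrightarrow> f y = g y"
  shows "differentiable_times k S f \<longleftrightarrow> differentiable_times k S g"
proof -
  have "nth_derivative j f differentiable (at x) \<longleftrightarrow> nth_derivative j g differentiable (at x)" if "x \<in> S" for j x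
    unfolding differentiable_iff_ex_vector_derivative
    using has_vector_derivative_cong_open[OF assms(1) that nth_derivative_cong_open[OF assms]] by simp
  then show ?thesis by (simp add: differentiable_times_def)
qed

lemma smooth_on_cong:
  "open S \<Longrightarrow> (\<And>y. y \<in> S \<Longrightarrow> f y = g y) \<Longrightarrow> smooth_on S f \<longleftrightarrow> smooth_on S g"
  unfolding smooth_on_iff using differentiable_times_cong by blast

lemma differentiable_times_0 [simp]: "differentiable_times 0 S f"
  by (simp add: differentiable_times_def)

lemma differentiable_times_Suc:
  "differentiable_times (Suc k) S f \<longleftrightarrow>
    (\<forall>x\<in>S. f differentiable (at x)) \<and> differentiable_times k S (\<lambda>x. vector_derivative f (at x))"
  unfolding differentiable_times_def less_Suc_eq_0_disj
  by (auto simp: nth_derivative_Suc[symmetric])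

lemma differentiable_times_SucI:
  assumes S: "open S" and f: "\<And>x. x \<in> S \<Longrightarrow> (f has_vector_derivative f' x) (at x)"
    and "differentiable_times k S f'"
  shows "differentiable_times (Suc k) S f"
proof -
  have "\<And>x. x \<in> S \<Longrightarrow> vector_derivative f (at x) = f' x" using f by (simp add: vector_derivative_at)
  with assms show ?thesis unfolding differentiable_times_Suc
    using differentiable_times_cong[OF S, of "\<lambda>x. vector_derivative f (at x)" f' k]
    by (auto intro: differentiableI_vector)
qed

lemma differentiable_times_mono: "differentiable_times k S f \<Longrightarrow> j \<le> k \<Longrightarrow> differentiable_times j S f"
  by (simp add: differentiable_times_def)

lemma differentiable_timesD:
  assumes "differentiable_times (Suc k) S f" "x \<in> S"
  shows "(f has_vector_derivative vector_derivative f (at x)) (at x)"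
  using assms by (simp add: differentiable_times_Suc vector_derivative_works)

lemma differentiable_times_const: "open S \<Longrightarrow> differentiable_times k S (\<lambda>x. z)"
proof (induction k arbitrary: z)
  case (Suc k)
  then show ?case by (intro differentiable_times_SucI[where f'="\<lambda>x. 0"]) auto
qed simp

lemma differentiable_times_add:
  assumes S: "open S"
  shows "differentiable_times k S f \<Longrightarrow> differentiable_times k S g \<Longrightarrow> differentiable_times k S (\<lambda>x. f x + g x)"
proof (induction k arbitrary: f g)
  case (Suc k)
  show ?case
  proof (rule differentiable_times_SucI[OF S])
    show "((\<lambda>x. f x + g x) has_vector_derivative vector_derivative f (at x) + vector_derivative g (at x)) (at x)"
      if "x \<in> S" for x by (intro has_vector_derivative_add differentiable_timesD[OF Suc.prems(1) that]
            differentiable_timesD[OF Suc.prems(2) that])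
    show "differentiable_times k S (\<lambda>x. vector_derivative f (at x) + vector_derivative g (at x))"
      using Suc by (simp add: differentiable_times_Suc)
  qed
qed simp

lemma differentiable_times_mult:
  assumes S: "open S"
  shows "differentiable_times k S f \<Longrightarrow> differentiable_times k S g \<Longrightarrow> differentiable_times k S (\<lambda>x. f x * g x)"
proof (induction k arbitrary: f g)
  case (Suc k)
  show ?case
  proof (rule differentiable_times_SucI[OF S])
    show "((\<lambda>x. f x * g x) has_vector_derivative
        f x * vector_derivative g (at x) + vector_derivative f (at x) * g x) (at x)" if "x \<in> S" for x
      by (intro has_vector_derivative_mult differentiable_timesD[OF Suc.prems(1) that]
            differentiable_timesD[OF Suc.prems(2) that])
    show "differentiable_times k S (\<lambda>x. f x * vector_derivative g (at x) + vector_derivative f (at x) * g x)"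
      using Suc.prems differentiable_times_mono[OF Suc.prems(1), of k] differentiable_times_mono[OF Suc.prems(2), of k]
      by (intro differentiable_times_add[OF S] Suc.IH) (simp_all add: differentiable_times_Suc)
  qed
qed simp

lemma differentiable_times_inverse:
  assumes S: "open S"
  shows "differentiable_times k S f \<Longrightarrow> (\<And>x. x \<in> S \<Longrightarrow> f x \<noteq> 0) \<Longrightarrow> differentiable_times k S (\<lambda>x. inverse (f x))"
proof (induction k)
  case (Suc k)
  show ?case
  proof (rule differentiable_times_SucI[OF S])
    show "((\<lambda>x. inverse (f x)) has_vector_derivative
        (- 1) * (vector_derivative f (at x) * (inverse (f x) * inverse (f x)))) (at x)" if x: "x \<in> S" for x
    proof -
      have "((\<lambda>x. inverse (f x)) has_derivative
          (\<lambda>h. - (inverse (f x) * (h *\<^sub>R vector_derivative f (at x)) * inverse (f x)))) (at x)"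
        using differentiable_timesD[OF Suc.prems(1) x] Suc.prems(2)[OF x]
        unfolding has_vector_derivative_def by (intro Deriv.has_derivative_inverse) auto
      then show ?thesis unfolding has_vector_derivative_def
        by (rule has_derivative_eq_rhs) (auto simp: fun_eq_iff scaleR_conv_of_real)
    qed
    show "differentiable_times k S (\<lambda>x. (- 1) * (vector_derivative f (at x) * (inverse (f x) * inverse (f x))))"
      using Suc differentiable_times_mono[OF Suc.prems(1), of k]
      by (intro differentiable_times_mult[OF S] differentiable_times_const[OF S])
        (simp_all add: differentiable_times_Suc)
  qed
qed simp

lemma differentiable_times_affine:
  assumes "differentiable_times k UNIV f"
  shows "differentiable_times k UNIV (\<lambda>x. f (s * x + t))"
  using assms
proof (induction k arbitrary: f)
  case (Suc k)
  show ?case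
  proof (rule differentiable_times_SucI)
    show "((\<lambda>x. f (s * x + t)) has_vector_derivative of_real s * vector_derivative f (at (s * x + t))) (at x)" for x
    proof -
      have "((\<lambda>x. s * x + t) has_vector_derivative s) (at x)"
        by (auto intro!: derivative_eq_intros simp: has_real_derivative_iff_has_vector_derivative[symmetric])
      from vector_diff_chain_at[OF this differentiable_timesD[OF Suc.prems]]
      show ?thesis by (simp add: o_def scaleR_conv_of_real)
    qed
    show "differentiable_times k UNIV (\<lambda>x. of_real s * vector_derivative f (at (s * x + t)))"
      using Suc by (intro differentiable_times_mult differentiable_times_const Suc.IH)
        (simp_all add: differentiable_times_Suc)
  qed auto
qed simp

lemma differentiable_times_of_real: "open S \<Longrightarrow> differentiable_times k S of_real"
proof (cases k)
  case (Suc j)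
  assume S: "open S"
  have "((of_real :: real \<Rightarrow> complex) has_vector_derivative 1) (at x)" for x
    using has_vector_derivative_of_real[of "\<lambda>x. x" 1] by (simp add: has_vector_derivative_id)
  then show ?thesis unfolding Suc
    by (intro differentiable_times_SucI[OF S, where f'="\<lambda>x. 1"] differentiable_times_const S) auto
qed simp

lemma smooth_on_const: "open S \<Longrightarrow> smooth_on S (\<lambda>x. z)"
  and smooth_on_add: "open S \<Longrightarrow> smooth_on S f \<Longrightarrow> smooth_on S g \<Longrightarrow> smooth_on S (\<lambda>x. f x + g x)"
  and smooth_on_mult: "open S \<Longrightarrow> smooth_on S f \<Longrightarrow> smooth_on S g \<Longrightarrow> smooth_on S (\<lambda>x. f x * g x)"
  and smooth_on_inverse: "open S \<Longrightarrow> smooth_on S f \<Longrightarrow> (\<And>x. x \<in> S \<Longrightarrow> f x \<noteq> 0) \<Longrightarrow> smooth_on S (\<lambda>x. inverse (f x))"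
  and smooth_on_affine: "smooth_on UNIV f \<Longrightarrow> smooth_on UNIV (\<lambda>x. f (s * x + t))"
  and smooth_on_of_real: "open S \<Longrightarrow> smooth_on S of_real"
  unfolding smooth_on_iff
  by (simp_all add: differentiable_times_const differentiable_times_add differentiable_times_mult
      differentiable_times_inverse differentiable_times_affine differentiable_times_of_real)

lemma smooth_on_power: "open S \<Longrightarrow> smooth_on S f \<Longrightarrow> smooth_on S (\<lambda>x. f x ^ n)"
  by (induction n) (auto intro: smooth_on_const smooth_on_mult)

lemma smooth_on_subset: "smooth_on S f \<Longrightarrow> T \<subseteq> S \<Longrightarrow> smooth_on T f"
  by (auto simp: smooth_on_def)

lemma smooth_on_Un: "smooth_on S f \<Longrightarrow> smooth_on T f \<Longrightarrow> smooth_on (S \<union> T) f"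
  by (auto simp: smooth_on_def)

lemma smooth_on_nth_derivative: "smooth_on S f \<Longrightarrow> smooth_on S (nth_derivative k f)"
  by (simp add: smooth_on_def nth_derivative_add_index)

lemma smooth_on_has_vector_derivative:
  "smooth_on S f \<Longrightarrow> x \<in> S \<Longrightarrow> (nth_derivative k f has_vector_derivative nth_derivative (Suc k) f x) (at x)"
  by (simp add: smooth_on_def nth_derivative_Suc' vector_derivative_works)

lemma smooth_on_antiderivative:
  assumes "open S" "\<And>x. x \<in> S \<Longrightarrow> (f has_vector_derivative g x) (at x)" "smooth_on S g"
  shows "smooth_on S f"
  unfolding smooth_on_iff
proof
  fix k show "differentiable_times k S f"
  proof (cases k)
    case (Suc j)
    then show ?thesis using differentiable_times_SucI[OF assms(1,2)] assms(3) by (simp add: smooth_on_iff)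
  qed simp
qed

lemma nth_derivative_linear:
  assumes "smooth_on UNIV f" "smooth_on UNIV g"
  shows "nth_derivative k (\<lambda>x. z * f x + w * g x) = (\<lambda>x. z * nth_derivative k f x + w * nth_derivative k g x)"
proof (induction k)
  case (Suc k)
  have "((\<lambda>x. z * nth_derivative k f x + w * nth_derivative k g x) has_vector_derivative
      z * nth_derivative (Suc k) f x + w * nth_derivative (Suc k) g x) (at x)" for x
    by (intro has_vector_derivative_add has_vector_derivative_mult_right
        smooth_on_has_vector_derivative[OF assms(1)] smooth_on_has_vector_derivative[OF assms(2)]) auto
  then show ?case unfolding nth_derivative_Suc'[of k "\<lambda>x. z * f x + w * g x"] Suc
    by (intro ext vector_derivative_at)
qed simp

lemma nth_derivative_add:
  "smooth_on UNIV f \<Longrightarrow> smooth_on UNIV g \<Longrightarrow>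
    nth_derivative k (\<lambda>x. f x + g x) = (\<lambda>x. nth_derivative k f x + nth_derivative k g x)"
  using nth_derivative_linear[of f g k 1 1] by simp

lemma nth_derivative_cmult:
  "smooth_on UNIV f \<Longrightarrow> nth_derivative k (\<lambda>x. z * f x) = (\<lambda>x. z * nth_derivative k f x)"
  using nth_derivative_linear[of f f k z 0] by simp

lemma nth_derivative_reflect:
  assumes "smooth_on UNIV f"
  shows "nth_derivative k (\<lambda>x. f (- x)) = (\<lambda>x. (-1) ^ k * nth_derivative k f (- x))"
proof (induction k)
  case (Suc k)
  have "((\<lambda>x. nth_derivative k f (- x)) has_vector_derivative - nth_derivative (Suc k) f (- x)) (at x)" for x
  proof -
    have "(uminus has_vector_derivative (-1)) (at x)"
      by (auto intro!: derivative_eq_intros simp: has_real_derivative_iff_has_vector_derivative[symmetric])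
    from vector_diff_chain_at[OF this smooth_on_has_vector_derivative[OF assms UNIV_I]]
    show ?thesis by (simp add: o_def)
  qed
  then have "((\<lambda>x. (-1) ^ k * nth_derivative k f (- x)) has_vector_derivative
      (-1) ^ k * (- nth_derivative (Suc k) f (- x))) (at x)" for x
    by (intro has_vector_derivative_mult_right)
  then show ?case unfolding nth_derivative_Suc'[of k "\<lambda>x. f (- x)"] Suc
    by (intro ext) (simp add: vector_derivative_at)
qed simp

lemma nth_derivative_zero_outside:
  assumes "\<And>x. x \<notin> {a..b} \<Longrightarrow> f x = 0" "x \<notin> {a..b}"
  shows "nth_derivative k f x = 0"
proof -
  have "nth_derivative k (\<lambda>x. 0) = (\<lambda>x. 0)"
    using nth_derivative_cmult[OF smooth_on_const[OF open_UNIV], of k 0 0] by simp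
  moreover have "nth_derivative k f x = nth_derivative k (\<lambda>x. 0) x"
    by (rule nth_derivative_cong_open[of "- {a..b}"]) (use assms in auto)
  ultimately show ?thesis by simp
qed

text \<open>Termwise differentiation keeps the form of a convergent power series.\<close>

lemma smooth_on_power_series:
  fixes \<alpha> :: "nat \<Rightarrow> real"
  assumes "\<And>x. \<bar>x\<bar> < 1 \<Longrightarrow> summable (\<lambda>j. \<alpha> j * x ^ j)"
  shows "smooth_on {-1<..<1} (\<lambda>x. of_real (\<Sum>j. \<alpha> j * x ^ j))"
proof -
  have "differentiable_times k {-1<..<1} (\<lambda>x. of_real (\<Sum>j. \<alpha> j * x ^ j))"
    if "\<And>x. \<bar>x\<bar> < 1 \<Longrightarrow> summable (\<lambda>j. \<alpha> j * x ^ j)" for k and \<alpha> :: "nat \<Rightarrow> real"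
    using that
  proof (induction k arbitrary: \<alpha>)
    case (Suc k)
    show ?case
    proof (rule differentiable_times_SucI)
      fix x :: real assume x: "x \<in> {-1<..<1}"
      then have "((\<lambda>x. \<Sum>j. \<alpha> j * x ^ j) has_field_derivative (\<Sum>j. diffs \<alpha> j * x ^ j)) (at x)"
        using Suc.prems by (intro termdiffs_strong'[where K=1]) auto
      then show "((\<lambda>x. complex_of_real (\<Sum>j. \<alpha> j * x ^ j)) has_vector_derivative of_real (\<Sum>j. diffs \<alpha> j * x ^ j)) (at x)"
        by (intro has_vector_derivative_of_real) (simp add: has_real_derivative_iff_has_vector_derivative)
    next
      show "differentiable_times k {-1<..<1} (\<lambda>x. complex_of_real (\<Sum>j. diffs \<alpha> j * x ^ j))"
        using Suc.prems by (intro Suc.IH termdiff_converges[where K=1]) auto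
    qed auto
  qed simp
  then show ?thesis using assms by (simp add: smooth_on_iff)
qed

text \<open>The derivative of \<open>s\<^sup>-\<^sup>k exp (-1/s)\<close> is a combination of the same functions for \<open>k + 1\<close> and
  \<open>k + 2\<close>, which makes the family, extended by zero to the left half-line, smooth by induction.\<close>

definition flat :: "nat \<Rightarrow> real \<Rightarrow> real" where
  "flat k s = (if s > 0 then exp (- (1 / s)) / s ^ k else 0)"

text \<open>The case \<open>n = 2\<close> is used: it makes the difference quotient at \<open>0\<close> tend to \<open>0\<close>.\<close>

lemma abs_flat_le: "\<bar>flat k s\<bar> \<le> fact (k + n) * \<bar>s\<bar> ^ n"
proof (cases "s > 0")
  case True
  have "t ^ (k + n) /\<^sub>R fact (k + n) \<le> exp t" if "t \<ge> 0" for t :: real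
    using sum_le_suminf[OF summable_exp_generic, of "{k + n}" t] that by (simp add: exp_def)
  \<comment> \<open>a single term of the exponential series beats the pole of order \<open>k\<close> and leaves \<open>s ^ n\<close>\<close>
  from this[of "1 / s"] have "(1 / s) ^ (k + n) \<le> fact (k + n) * exp (1 / s)"
    using True by (simp add: pos_divide_le_eq mult.commute divide_inverse[symmetric] inverse_eq_divide)
  then have "(1 / s) ^ k \<le> fact (k + n) * exp (1 / s) * s ^ n"
    using True by (simp add: power_add field_simps)
  then show ?thesis using True by (simp add: flat_def exp_minus field_simps)
qed (simp add: flat_def)

lemma flat_has_derivative: "(flat k has_real_derivative flat (k + 2) s - real k * flat (k + 1) s) (at s)"
proof -
  consider "s > 0" | "s < 0" | "s = 0" by linarith
  then show ?thesis
  proof cases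
    case 1
    have "((\<lambda>s. exp (- (1 / s)) / s ^ k) has_real_derivative flat (k + 2) s - real k * flat (k + 1) s) (at s)"
    proof (cases k)
      case 0
      then show ?thesis using 1
        by (auto intro!: derivative_eq_intros simp: flat_def field_simps power2_eq_square)
    next
      case (Suc j)
      have e: "s ^ i = s * s ^ (i - Suc 0)" if "i \<noteq> 0" for i using that by (cases i) auto
      show ?thesis unfolding Suc using 1
        by (auto intro!: derivative_eq_intros simp: flat_def field_simps power2_eq_square) (use e in blast)
    qed
    then show ?thesis
      by (rule has_field_derivative_transform_within_open[where S="{0<..}"]) (use 1 in \<open>auto simp: flat_def\<close>)
  next
    case 2
    have "((\<lambda>s. 0) has_real_derivative flat (k + 2) s - real k * flat (k + 1) s) (at s)"
      using 2 by (simp add: flat_def)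
    then show ?thesis
      by (rule has_field_derivative_transform_within_open[where S="{..<0}"]) (use 2 in \<open>auto simp: flat_def\<close>)
  next
    case 3
    have "(\<lambda>h. (flat k (0 + h) - flat k 0) / h) \<midarrow>0\<rightarrow> 0"
    proof (rule Lim_null_comparison)
      have "norm ((flat k (0 + h) - flat k 0) / h) \<le> fact (k + 2) * \<bar>h\<bar>" if "h \<noteq> 0" for h
      proof -
        have "\<bar>flat k h\<bar> \<le> fact (k + 2) * \<bar>h\<bar> * \<bar>h\<bar>"
          using abs_flat_le[of k h 2] by (simp only: power2_eq_square mult.assoc)
        then have "\<bar>flat k h\<bar> / \<bar>h\<bar> \<le> fact (k + 2) * \<bar>h\<bar>"
          using that by (subst pos_divide_le_eq) simp_all
        then show ?thesis by (simp add: flat_def[of k 0] abs_divide del: fact_Suc)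
      qed
      then show "\<forall>\<^sub>F h in at 0. norm ((flat k (0 + h) - flat k 0) / h) \<le> fact (k + 2) * \<bar>h\<bar>"
        by (auto simp: eventually_at intro: exI[of _ 1])
      show "(\<lambda>h. fact (k + 2) * \<bar>h\<bar> :: real) \<midarrow>0\<rightarrow> 0" by (auto intro!: tendsto_eq_intros)
    qed
    then show ?thesis using 3 by (simp add: DERIV_def flat_def)
  qed
qed

lemma smooth_on_flat: "smooth_on UNIV (\<lambda>s. of_real (flat k s))"
proof -
  have "differentiable_times n UNIV (\<lambda>s. of_real (flat k s))" for n
  proof (induction n arbitrary: k)
    case (Suc n)
    have "((\<lambda>s. complex_of_real (flat k s)) has_vector_derivative
        of_real (flat (k + 2) s) + (- of_nat k) * of_real (flat (k + 1) s)) (at s)" for s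
      using has_vector_derivative_of_real[OF flat_has_derivative[of k s]]
      by simp
    then show ?case
      by (rule differentiable_times_SucI[OF open_UNIV])
        (intro differentiable_times_add differentiable_times_mult differentiable_times_const Suc open_UNIV)
  qed simp
  then show ?thesis by (simp add: smooth_on_iff)
qed

section \<open>Test functions on \<open>(0,1)\<close>\<close>

definition half_test_functions :: "(real \<Rightarrow> complex) set" where
  "half_test_functions = {y. smooth_on UNIV y \<and>
     (\<exists>a b. 0 < a \<and> a < b \<and> b < 1 \<and> (\<forall>x. x \<notin> {a..b} \<longrightarrow> y x = 0))}"

lemma half_test_functionsE:
  assumes "y \<in> half_test_functions"
  obtains a b where "smooth_on UNIV y" "0 < a" "a < b" "b < 1" "\<And>x. x \<notin> {a..b} \<Longrightarrow> y x = 0"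
  using assms by (auto simp: half_test_functions_def)

lemma half_test_functionsI:
  "smooth_on UNIV y \<Longrightarrow> 0 < a \<Longrightarrow> a < b \<Longrightarrow> b < 1 \<Longrightarrow> (\<And>x. x \<notin> {a..b} \<Longrightarrow> y x = 0) \<Longrightarrow> y \<in> half_test_functions"
  by (auto simp: half_test_functions_def)

lemma half_test_smooth: "y \<in> half_test_functions \<Longrightarrow> smooth_on UNIV y"
  by (simp add: half_test_functions_def)

lemma half_test_zero: "y \<in> half_test_functions \<Longrightarrow> x \<notin> {0<..<1} \<Longrightarrow> y x = 0"
  by (erule half_test_functionsE) (metis atLeastAtMost_iff greaterThanLessThan_iff le_less_trans less_le_trans)

lemma half_test_subset_test_functions: "y \<in> half_test_functions \<Longrightarrow> y \<in> test_functions"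
  by (erule half_test_functionsE)
    (auto simp: test_functions_def smooth_on_def intro!: exI[of _ "_ :: real"] elim: less_trans[rotated])

lemma half_test_continuous: "y \<in> half_test_functions \<Longrightarrow> continuous_on S y"
proof -
  assume "y \<in> half_test_functions"
  then have "nth_derivative 0 y differentiable (at x)" for x
    by (auto simp: half_test_functions_def smooth_on_def simp del: nth_derivative_0)
  then show ?thesis by (auto intro!: continuous_at_imp_continuous_on differentiable_imp_continuous_within)
qed

lemma square_integrable_continuous:
  assumes "continuous_on {-1..1} f"
  shows "square_integrable f"
  unfolding square_integrable_def
proof
  show "f \<in> borel_measurable MI" using assms by (intro continuous_imp_measurable_on_sets_lebesgue) auto
  have "continuous_on (cbox (-1) 1) (\<lambda>x. (cmod (f x))\<^sup>2)" using assms by (auto intro!: continuous_intros)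
  then show "integrable MI (\<lambda>x. (cmod (f x))\<^sup>2)" using continuous_imp_integrable by fastforce
qed

lemma half_test_square_integrable: "y \<in> half_test_functions \<Longrightarrow> square_integrable y"
  by (intro square_integrable_continuous half_test_continuous)

lemma half_test_nth_derivative:
  assumes "y \<in> half_test_functions"
  shows "nth_derivative k y \<in> half_test_functions"
proof -
  obtain a b where ab: "smooth_on UNIV y" "0 < a" "a < b" "b < 1" "\<And>x. x \<notin> {a..b} \<Longrightarrow> y x = 0"
    using half_test_functionsE[OF assms] by metis
  show ?thesis
    by (rule half_test_functionsI[OF smooth_on_nth_derivative[OF ab(1)] ab(2-4)])
      (rule nth_derivative_zero_outside[OF ab(5)])
qed

text \<open>The factor matters only near the support, so it may be singular at \<open>0\<close> and arbitrary outside
  \<open>(0,1)\<close>. This is how the coefficient and its reciprocal act on test functions.\<close>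

lemma half_test_mult:
  assumes h: "smooth_on {0<..<1} h" and y: "y \<in> half_test_functions"
  shows "(\<lambda>x. h x * y x) \<in> half_test_functions"
proof -
  obtain a b where ab: "smooth_on UNIV y" "0 < a" "a < b" "b < 1" "\<And>x. x \<notin> {a..b} \<Longrightarrow> y x = 0"
    using half_test_functionsE[OF y] by metis
  have "smooth_on {0<..<1} (\<lambda>x. h x * y x)"
    using h ab(1) by (intro smooth_on_mult) (auto elim: smooth_on_subset)
  moreover have "smooth_on (- {a..b}) (\<lambda>x. h x * y x)"
    by (subst smooth_on_cong[where g="\<lambda>x. 0"]) (auto simp: ab(5) intro!: smooth_on_const)
  ultimately have "smooth_on ({0<..<1} \<union> - {a..b}) (\<lambda>x. h x * y x)" by (rule smooth_on_Un)
  moreover have "{0<..<1} \<union> - {a..b} = UNIV" using ab by auto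
  ultimately show ?thesis using ab by (intro half_test_functionsI[of _ a b]) auto
qed

lemma half_test_cmult: "y \<in> half_test_functions \<Longrightarrow> (\<lambda>x. z * y x) \<in> half_test_functions"
  by (rule half_test_mult[OF smooth_on_const]) auto

lemma half_test_add:
  assumes "f \<in> half_test_functions" "g \<in> half_test_functions"
  shows "(\<lambda>x. f x + g x) \<in> half_test_functions"
proof -
  obtain a b where ab: "smooth_on UNIV f" "0 < a" "a < b" "b < 1" "\<And>x. x \<notin> {a..b} \<Longrightarrow> f x = 0"
    using half_test_functionsE[OF assms(1)] by metis
  obtain c d where cd: "smooth_on UNIV g" "0 < c" "c < d" "d < 1" "\<And>x. x \<notin> {c..d} \<Longrightarrow> g x = 0"
    using half_test_functionsE[OF assms(2)] by metis
  have "f x + g x = 0" if "x \<notin> {min a c..max b d}" for x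
  proof -
    have "x \<notin> {a..b}" "x \<notin> {c..d}" using that by auto
    then show ?thesis using ab(5) cd(5) by simp
  qed
  then show ?thesis
    by (intro half_test_functionsI[of _ "min a c" "max b d"]) (use ab cd in \<open>auto intro: smooth_on_add\<close>)
qed

lemma half_test_integral_superset:
  assumes "\<phi> \<in> half_test_functions" "x \<le> 0" "1 \<le> y"
  shows "integral {x..y} \<phi> = integral {0..1} \<phi>"
proof -
  have "(\<phi> has_integral integral {0..1} \<phi>) {0..1}"
    using half_test_continuous[OF assms(1)] integrable_continuous_real by blast
  then have "(\<phi> has_integral integral {0..1} \<phi>) {x..y}"
    by (rule has_integral_on_superset) (use assms half_test_zero in auto)
  then show ?thesis by (rule integral_unique)
qed

text \<open>The integral from the left vanishes to the left of the support, and the vanishing total integral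
  makes it vanish to the right as well.\<close>

lemma half_test_antiderivative:
  assumes \<phi>: "\<phi> \<in> half_test_functions" and int0: "integral {0..1} \<phi> = 0"
  obtains \<psi> where "\<psi> \<in> half_test_functions" "nth_derivative 1 \<psi> = \<phi>"
proof -
  obtain a b where ab: "smooth_on UNIV \<phi>" "0 < a" "a < b" "b < 1" "\<And>x. x \<notin> {a..b} \<Longrightarrow> \<phi> x = 0"
    using half_test_functionsE[OF \<phi>] by metis
  define \<psi> where "\<psi> x = integral {-1..x} \<phi>" for x
  have left: "\<psi> x = 0" if "x < a" for x
  proof -
    have "integral {-1..x} \<phi> = integral {-1..x} (\<lambda>x. 0)"
      by (rule Henstock_Kurzweil_Integration.integral_cong) (use that ab(5) in auto)
    then show ?thesis by (simp add: \<psi>_def)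
  qed
  have right: "\<psi> x = 0" if "b < x" for x
  proof -
    have "(\<phi> has_integral integral {-1..x} \<phi>) {-1..x}"
      using half_test_continuous[OF \<phi>] integrable_continuous_real by blast
    then have "(\<phi> has_integral \<psi> x) {-1..max x 1}" unfolding \<psi>_def
      by (rule has_integral_on_superset) (use ab that in \<open>auto intro!: ab(5)\<close>)
    then have "integral {-1..max x 1} \<phi> = \<psi> x" by (rule integral_unique)
    then show ?thesis using half_test_integral_superset[OF \<phi>, of "-1" "max x 1"] int0 by simp
  qed
  have der: "(\<psi> has_vector_derivative \<phi> x) (at x)" for x
  proof (cases "x \<in> {a..b}")
    case True
    then have x: "x \<in> {-1<..<2}" using ab by auto
    have "((\<lambda>u. integral {-1..u} \<phi>) has_vector_derivative \<phi> x) (at x within {-1..2})"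
      using x by (intro integral_has_vector_derivative half_test_continuous[OF \<phi>]) auto
    then have "(\<psi> has_vector_derivative \<phi> x) (at x within {-1<..<2})"
      unfolding \<psi>_def by (rule has_vector_derivative_within_subset) auto
    then show ?thesis using at_within_open[OF x] by simp
  next
    case False
    have "(\<psi> has_vector_derivative 0) (at x) \<longleftrightarrow> ((\<lambda>x. 0 :: complex) has_vector_derivative 0) (at x)"
      proof (rule has_vector_derivative_cong_open)
      show "open (- {a..b})" "x \<in> - {a..b}" using False by auto
      show "\<psi> y = 0" if "y \<in> - {a..b}" for y
        using that left[of y] right[of y] by auto
    qed
    then show ?thesis using ab(5)[OF False] by simp
  qed
  have "smooth_on UNIV \<psi>" using smooth_on_antiderivative[OF open_UNIV der ab(1)] .
  then have "\<psi> \<in> half_test_functions" by (rule half_test_functionsI[OF _ ab(2-4)]) (use left right in auto)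
  moreover have "nth_derivative 1 \<psi> = \<phi>"
    using der by (simp add: nth_derivative_Suc' vector_derivative_at fun_eq_iff)
  ultimately show thesis using that by blast
qed

text \<open>As \<open>n\<close> grows, these functions tend pointwise to the indicator of \<open>(a,1)\<close> and stay below \<open>1\<close>. The
  shift by \<open>1\<close> keeps the support inside \<open>[a + 1/n, 1 - 1/n]\<close>, so \<open>a = 0\<close> is allowed.\<close>

lemma half_test_cutoff:
  assumes "0 \<le> a" "a < 1" "n > 0"
  shows "(\<lambda>x. of_real (flat 0 (real n * (x - a) - 1) * flat 0 (real n * (1 - x) - 1))) \<in> half_test_functions"
    (is "?y \<in> _")
proof -
  have "smooth_on UNIV (\<lambda>x. of_real (flat 0 (real n * x + (- real n * a - 1))) * of_real (flat 0 ((- real n) * x + (real n - 1))))"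
    by (intro smooth_on_mult smooth_on_affine[OF smooth_on_flat] open_UNIV)
  moreover have "(\<lambda>x. of_real (flat 0 (real n * x + (- real n * a - 1))) * of_real (flat 0 ((- real n) * x + (real n - 1)))) = ?y"
    by (simp add: fun_eq_iff algebra_simps)
  ultimately have s: "smooth_on UNIV ?y" by simp
  have z: "?y x = 0" if "x \<notin> {a + 1 / n..1 - 1 / n}" for x
    using that assms by (auto simp: flat_def field_simps)
  show ?thesis
  proof (cases "a + 1 / n < 1 - 1 / n")
    case True
    have "0 < a + 1 / n" using assms by (simp add: add_nonneg_pos)
    then show ?thesis by (rule half_test_functionsI[OF s _ True]) (use z assms in auto)
  next
    case False
    have "?y x = 0" for x
    proof (cases "x \<in> {a + 1 / n..1 - 1 / n}")
      case True
      then have "x = a + 1 / n" using False by auto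
      then show ?thesis using assms by (simp add: flat_def)
    qed (rule z)
    \<comment> \<open>the function vanishes identically; any support interval will do\<close>
    then show ?thesis by (intro half_test_functionsI[OF s, of "1/4" "1/2"]) auto
  qed
qed

lemma half_test_unit_integral:
  obtains \<rho> where "\<rho> \<in> half_test_functions" "integral {0..1} \<rho> = 1"
proof -
  define y where "y x = flat 0 (real 4 * (x - 0) - 1) * flat 0 (real 4 * (1 - x) - 1)" for x
  have yV: "(\<lambda>x. of_real (y x)) \<in> half_test_functions"
    unfolding y_def using half_test_cutoff[of 0 4] by simp
  have "continuous_on {0..1} (\<lambda>x. Re (of_real (y x)))"
    by (intro continuous_intros half_test_continuous[OF yV])
  then have cont: "continuous_on {0..1} y" by simp
  have "integral {0..1} y \<noteq> 0"
  proof
    assume "integral {0..1} y = 0"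
    then have "\<forall>x\<in>{0..1}. y x = 0"
      by (subst (asm) integral_eq_0_iff[OF cont]) (auto simp: y_def flat_def)
    then have "y (1/2) = 0" by simp
    then show False by (simp add: y_def flat_def)
  qed
  moreover have "integral {0..1} (\<lambda>x. complex_of_real (y x)) = of_real (integral {0..1} y)"
    using cont by (intro integral_unique has_integral_of_real integrable_integral integrable_continuous_real)
  ultimately have "integral {0..1} (\<lambda>x. inverse (complex_of_real (integral {0..1} y)) * of_real (y x)) = 1"
    by simp
  then show thesis using that half_test_cmult[OF yV] by blast
qed

definition function_subspace :: "(real \<Rightarrow> complex) set \<Rightarrow> bool" where
  "function_subspace N \<longleftrightarrow> (\<forall>f\<in>N. \<forall>g\<in>N. (\<lambda>x. f x + g x) \<in> N) \<and> (\<forall>z. \<forall>f\<in>N. (\<lambda>x. z * f x) \<in> N)"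

text \<open>Generation is expressed through all subspaces containing \<open>G\<close>, so that linear combinations never
  have to be written down.\<close>

definition generates_half_test :: "(real \<Rightarrow> complex) set \<Rightarrow> bool" where
  "generates_half_test G \<longleftrightarrow> (\<forall>N. function_subspace N \<longrightarrow> G \<subseteq> N \<longrightarrow> half_test_functions \<subseteq> N)"

text \<open>The complement of the range of the \<open>k\<close>-th derivative is spanned by the derivatives of order below
  \<open>k\<close> of one function with integral \<open>1\<close>.\<close>

lemma range_nth_derivative_finite_codim:
  "\<exists>\<Phi>. finite \<Phi> \<and> \<Phi> \<subseteq> half_test_functions \<and>
    generates_half_test (\<Phi> \<union> nth_derivative k ` half_test_functions)"
proof (induction k)
  case 0
  show ?case by (intro exI[of _ "{}"]) (auto simp: generates_half_test_def)
next
  case (Suc k)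
  then obtain \<Phi> where \<Phi>: "finite \<Phi>" "\<Phi> \<subseteq> half_test_functions"
    and gen: "generates_half_test (\<Phi> \<union> nth_derivative k ` half_test_functions)"
    by blast
  obtain \<rho> where \<rho>: "\<rho> \<in> half_test_functions" "integral {0..1} \<rho> = 1" by (rule half_test_unit_integral)
  have "generates_half_test (insert (nth_derivative k \<rho>) \<Phi> \<union> nth_derivative (Suc k) ` half_test_functions)"
    unfolding generates_half_test_def
  proof (intro allI impI)
    fix N assume N1: "function_subspace N"
      and N2: "insert (nth_derivative k \<rho>) \<Phi> \<union> nth_derivative (Suc k) ` half_test_functions \<subseteq> N"
    note N = N1 N2
    have "nth_derivative k ` half_test_functions \<subseteq> N"
    proof clarify
      fix \<phi> assume \<phi>: "\<phi> \<in> half_test_functions"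
      define z where "z = integral {0..1} \<phi>"
      have d: "(\<lambda>x. \<phi> x + (- z) * \<rho> x) \<in> half_test_functions"
        by (rule half_test_add[OF \<phi> half_test_cmult[OF \<rho>(1)]])
      have "integral {0..1} (\<lambda>x. \<phi> x + (- z) * \<rho> x) = integral {0..1} \<phi> + (- z) * integral {0..1} \<rho>"
      proof (rule integral_unique, rule has_integral_add)
        show "(\<phi> has_integral integral {0..1} \<phi>) {0..1}"
          by (intro integrable_integral integrable_continuous_real half_test_continuous \<phi>)
        have "(\<rho> has_integral integral {0..1} \<rho>) {0..1}"
          by (intro integrable_integral integrable_continuous_real half_test_continuous \<rho>)
        then show "((\<lambda>x. (- z) * \<rho> x) has_integral (- z) * integral {0..1} \<rho>) {0..1}"
          by (rule has_integral_mult_right)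
      qed
      then have "integral {0..1} (\<lambda>x. \<phi> x + (- z) * \<rho> x) = 0" using \<rho>(2) by (simp add: z_def)
      then obtain \<psi> where \<psi>: "\<psi> \<in> half_test_functions" "nth_derivative 1 \<psi> = (\<lambda>x. \<phi> x + (- z) * \<rho> x)"
        using half_test_antiderivative[OF d] by blast
      have "\<phi> = (\<lambda>x. nth_derivative 1 \<psi> x + z * \<rho> x)" using \<psi>(2) by simp
      then have "nth_derivative k \<phi> = nth_derivative k (\<lambda>x. 1 * nth_derivative 1 \<psi> x + z * \<rho> x)" by simp
      also have "\<dots> = (\<lambda>x. 1 * nth_derivative k (nth_derivative 1 \<psi>) x + z * nth_derivative k \<rho> x)"
        using half_test_smooth[OF \<psi>(1)] half_test_smooth[OF \<rho>(1)]
        by (intro nth_derivative_linear smooth_on_nth_derivative)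
      also have "\<dots> = (\<lambda>x. nth_derivative (Suc k) \<psi> x + z * nth_derivative k \<rho> x)"
        by (simp add: nth_derivative_add_index)
      finally have eq: "nth_derivative k \<phi> = (\<lambda>x. nth_derivative (Suc k) \<psi> x + z * nth_derivative k \<rho> x)" .
      have "nth_derivative (Suc k) \<psi> \<in> N" "nth_derivative k \<rho> \<in> N" using N(2) \<psi>(1) by auto
      then show "nth_derivative k \<phi> \<in> N" unfolding eq using N(1) by (simp add: function_subspace_def)
    qed
    then show "half_test_functions \<subseteq> N"
      using gen[unfolded generates_half_test_def, rule_format, OF N1] N2 by simp
  qed
  moreover have "finite (insert (nth_derivative k \<rho>) \<Phi>)" "insert (nth_derivative k \<rho>) \<Phi> \<subseteq> half_test_functions"
    using \<Phi> half_test_nth_derivative[OF \<rho>(1)] by auto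
  ultimately show ?case by blast
qed

lemma diff_expr_half_test:
  assumes "smooth_on {0<..<1} (\<lambda>x. of_real (c x))" "y \<in> half_test_functions"
  shows "diff_expr m c y \<in> half_test_functions"
proof -
  have "nth_derivative m (\<lambda>t. of_real (c t) * nth_derivative m y t) \<in> half_test_functions"
    by (rule half_test_nth_derivative[OF half_test_mult[OF assms(1) half_test_nth_derivative[OF assms(2)]]])
  from half_test_cmult[OF this, of "(-1)^m"] show ?thesis by (simp add: diff_expr_def[abs_def])
qed

text \<open>The set of \<open>\<phi>\<close> whose image under \<open>\<phi> \<mapsto> (c \<phi>)\<^bsup>(m)\<^esup>\<close> lies in a given subspace is itself a
  subspace, so finite codimension passes through the composition of the two derivatives; dividing
  by \<open>c\<close> shows that nothing is lost in between.\<close>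

lemma range_diff_expr_finite_codim:
  assumes c: "smooth_on {0<..<1} (\<lambda>x. of_real (c x))" "\<And>x. x \<in> {0<..<1} \<Longrightarrow> c x \<noteq> 0"
  obtains \<Phi> where "finite \<Phi>" "\<Phi> \<subseteq> half_test_functions"
    "generates_half_test (\<Phi> \<union> diff_expr m c ` half_test_functions)"
proof -
  obtain \<Phi> where \<Phi>: "finite \<Phi>" "\<Phi> \<subseteq> half_test_functions"
    and gen: "generates_half_test (\<Phi> \<union> nth_derivative m ` half_test_functions)"
    using range_nth_derivative_finite_codim[of m] by blast
  define L where "L \<phi> = nth_derivative m (\<lambda>x. of_real (c x) * \<phi> x)" for \<phi>
  have LV: "L \<phi> \<in> half_test_functions" if "\<phi> \<in> half_test_functions" for \<phi>
    unfolding L_def by (rule half_test_nth_derivative[OF half_test_mult[OF c(1) that]])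
  have smooth: "smooth_on UNIV (\<lambda>x. of_real (c x) * \<phi> x)" if "\<phi> \<in> half_test_functions" for \<phi>
    by (rule half_test_smooth[OF half_test_mult[OF c(1) that]])
  have Ladd: "L (\<lambda>x. f x + g x) = (\<lambda>x. L f x + L g x)" if "f \<in> half_test_functions" "g \<in> half_test_functions" for f g
    unfolding L_def distrib_left by (rule nth_derivative_add[OF smooth[OF that(1)] smooth[OF that(2)]])
  have Lcm: "L (\<lambda>x. z * f x) = (\<lambda>x. z * L f x)" if "f \<in> half_test_functions" for f z
    using nth_derivative_cmult[OF smooth[OF that], of m z] by (simp add: L_def mult_ac)
  have "generates_half_test ((\<Phi> \<union> L ` \<Phi>) \<union> diff_expr m c ` half_test_functions)"
    unfolding generates_half_test_def
  proof (intro allI impI)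
    fix N assume N1: "function_subspace N"
      and N2: "(\<Phi> \<union> L ` \<Phi>) \<union> diff_expr m c ` half_test_functions \<subseteq> N"
    then have N: "function_subspace N" "\<Phi> \<union> L ` \<Phi> \<subseteq> N" "diff_expr m c ` half_test_functions \<subseteq> N" by auto
    define N' where "N' = {\<phi> \<in> half_test_functions. L \<phi> \<in> N}"
    have "half_test_functions \<subseteq> N'"
    proof (rule gen[unfolded generates_half_test_def, rule_format, OF _ Un_least])
      show "function_subspace N'"
        using N(1) unfolding function_subspace_def N'_def
        by (auto simp: Ladd Lcm intro: half_test_add half_test_cmult)
      show "\<Phi> \<subseteq> N'" using \<Phi> N(2) by (auto simp: N'_def)
      show "nth_derivative m ` half_test_functions \<subseteq> N'"
      proof clarify
        fix y assume y: "y \<in> half_test_functions"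
        have "(\<lambda>x. (-1) ^ m * diff_expr m c y x) \<in> N"
          using N(1,3) y by (auto simp: function_subspace_def)
        moreover have "(\<lambda>x. (-1) ^ m * diff_expr m c y x) = L (nth_derivative m y)"
          by (simp add: diff_expr_def L_def fun_eq_iff flip: mult.assoc power_mult_distrib)
        ultimately show "nth_derivative m y \<in> N'"
          using half_test_nth_derivative[OF y] by (simp add: N'_def)
      qed
    qed
    have "nth_derivative m \<psi> \<in> N" if \<psi>: "\<psi> \<in> half_test_functions" for \<psi>
    proof -
      have "(\<lambda>x. inverse (complex_of_real (c x)) * \<psi> x) \<in> half_test_functions"
        by (rule half_test_mult[OF smooth_on_inverse[OF _ c(1)] \<psi>]) (use c(2) in auto)
      then have "L (\<lambda>x. inverse (complex_of_real (c x)) * \<psi> x) \<in> N"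
        using \<open>half_test_functions \<subseteq> N'\<close> by (auto simp: N'_def)
      moreover have "of_real (c x) * (inverse (complex_of_real (c x)) * \<psi> x) = \<psi> x" for x
        using c(2)[of x] half_test_zero[OF \<psi>, of x] by (cases "x \<in> {0<..<1}") auto
      ultimately show ?thesis by (simp add: L_def)
    qed
    then show "half_test_functions \<subseteq> N"
      using gen[unfolded generates_half_test_def, rule_format, OF N1] N(2) by auto
  qed
  moreover have "finite (\<Phi> \<union> L ` \<Phi>)" "\<Phi> \<union> L ` \<Phi> \<subseteq> half_test_functions" using \<Phi> LV by auto
  ultimately show thesis using that[of "\<Phi> \<union> L ` \<Phi>"] by simp
qed

section \<open>Test functions determine square integrable functions\<close>

text \<open>The positive and negative parts are densities of two finite measures that agree on half-lines,
  hence coincide.\<close>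

lemma AE_zero_if_tail_integrals_zero_lborel:
  fixes H :: "real \<Rightarrow> real"
  assumes H: "integrable lborel H" and zero: "\<And>a. (LINT x|lborel. indicator {a<..} x * H x) = 0"
  shows "AE x in lborel. H x = 0"
proof -
  have [measurable]: "H \<in> borel_measurable borel" using borel_measurable_integrable[OF H] by simp
  define P where "P x = ennreal (max 0 (H x))" for x
  define N where "N x = ennreal (max 0 (- H x))" for x
  have [measurable]: "P \<in> borel_measurable borel" "N \<in> borel_measurable borel"
    unfolding P_def N_def by measurable
  have ip: "integrable lborel (\<lambda>x. indicator {a<..} x * max 0 (H x))"
    and im: "integrable lborel (\<lambda>x. indicator {a<..} x * max 0 (- H x))" for a
    by (rule Bochner_Integration.integrable_bound[OF H], measurable, auto simp: indicator_def)+
  have pe: "emeasure (density lborel P) {a<..} = ennreal (LINT x|lborel. indicator {a<..} x * max 0 (H x))" for a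
  proof -
    have "emeasure (density lborel P) {a<..} = (\<integral>\<^sup>+x. ennreal (indicator {a<..} x * max 0 (H x)) \<partial>lborel)"
      by (subst emeasure_density) (auto simp: P_def indicator_def intro!: nn_integral_cong)
    then show ?thesis by (simp add: nn_integral_eq_integral[OF ip])
  qed
  have ne: "emeasure (density lborel N) {a<..} = ennreal (LINT x|lborel. indicator {a<..} x * max 0 (- H x))" for a
  proof -
    have "emeasure (density lborel N) {a<..} = (\<integral>\<^sup>+x. ennreal (indicator {a<..} x * max 0 (- H x)) \<partial>lborel)"
      by (subst emeasure_density) (auto simp: N_def indicator_def intro!: nn_integral_cong)
    then show ?thesis by (simp add: nn_integral_eq_integral[OF im])
  qed
  have eq: "(LINT x|lborel. indicator {a<..} x * max 0 (H x)) = (LINT x|lborel. indicator {a<..} x * max 0 (- H x))" for a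
  proof -
    have "(LINT x|lborel. indicator {a<..} x * max 0 (H x)) - (LINT x|lborel. indicator {a<..} x * max 0 (- H x))
        = (LINT x|lborel. indicator {a<..} x * max 0 (H x) - indicator {a<..} x * max 0 (- H x))"
      by (rule Bochner_Integration.integral_diff[OF ip im, symmetric])
    also have "\<dots> = (LINT x|lborel. indicator {a<..} x * H x)"
      by (rule Bochner_Integration.integral_cong) (auto simp: indicator_def)
    finally show ?thesis using zero by simp
  qed
  have "density lborel P = density lborel N"
    by (rule measure_eqI_lessThan) (simp_all add: pe ne eq)
  then have "AE x in lborel. P x = N x" by (intro sigma_finite_measure.density_unique[OF lborel.sigma_finite_measure_axioms]) auto
  then show ?thesis
    by eventually_elim (auto simp: P_def N_def max_def split: if_splits)
qed

lemma AE_zero_if_tail_integrals_zero: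
  fixes h :: "real \<Rightarrow> real"
  assumes h: "integrable MI h" and zero: "\<And>a. (LINT x|MI. indicator {a<..} x * h x) = 0"
  shows "AE x in MI. h x = 0"
proof -
  let ?k = "\<lambda>x. indicator {-1..1} x * h x"
  have k: "integrable lebesgue ?k"
    using h by (subst (asm) integrable_restrict_space) auto
  then obtain H where H: "H \<in> borel_measurable lborel" and kH: "AE x in lborel. ?k x = H x"
    using completion_ex_borel_measurable_real[of ?k lborel] borel_measurable_integrable by blast
  have kH': "AE x in lebesgue. ?k x = H x" using kH by (rule AE_completion)
  have H': "H \<in> borel_measurable lebesgue" using H by (rule measurable_completion)
  have "integrable lebesgue H"
    using k kH' H' by (subst integrable_cong_AE[of H lebesgue ?k]) (auto intro: borel_measurable_integrable)
  then have HI: "integrable lborel H" using integrable_completion[OF H] by simp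
  have "(LINT x|lborel. indicator {a<..} x * H x) = 0" for a
  proof -
    have "(LINT x|lborel. indicator {a<..} x * H x) = (LINT x|lebesgue. indicator {a<..} x * H x)"
      using H by (intro integral_completion[symmetric]) auto
    also have "\<dots> = (LINT x|lebesgue. indicator {a<..} x * ?k x)"
    proof (rule integral_cong_AE)
      show "(\<lambda>x. indicator {a<..} x * H x) \<in> borel_measurable lebesgue"
        using H' by (intro borel_measurable_times borel_measurable_indicator) auto
      show "(\<lambda>x. indicator {a<..} x * ?k x) \<in> borel_measurable lebesgue"
        using borel_measurable_integrable[OF k] by (intro borel_measurable_times[of _ _ ?k] borel_measurable_indicator) auto
      show "AE x in lebesgue. indicator {a<..} x * H x = indicator {a<..} x * ?k x"
        using kH' by eventually_elim simp
    qed
    also have "\<dots> = (LINT x|MI. indicator {a<..} x * h x)"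
      by (subst integral_restrict_space) (auto intro!: Bochner_Integration.integral_cong simp: mult_ac)
    finally show ?thesis using zero by simp
  qed
  from AE_zero_if_tail_integrals_zero_lborel[OF HI this]
  have "AE x in lebesgue. H x = 0" by (rule AE_completion)
  with kH' have "AE x in lebesgue. x \<in> {-1..1} \<longrightarrow> h x = 0"
    by eventually_elim (auto simp: indicator_def split: if_splits)
  then show ?thesis by (subst AE_restrict_space_iff) auto
qed

lemma borel_measurable_indicator_MI:
  "S \<in> sets borel \<Longrightarrow> (indicator S :: real \<Rightarrow> 'a::{real_normed_vector, zero_neq_one}) \<in> borel_measurable MI"
  by (intro measurable_restrict_space1 borel_measurable_indicator) auto

text \<open>Dominated convergence along the cut-off functions gives vanishing integrals over all intervals
  \<open>(a,1)\<close>, and then over all half-lines.\<close>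

lemma AE_zero_if_orthogonal_to_half_test:
  assumes w: "integrable MI w" and supp: "\<And>x. x \<notin> {0..1} \<Longrightarrow> w x = 0"
    and orth: "\<And>\<phi>. \<phi> \<in> half_test_functions \<Longrightarrow> (LINT x|MI. \<phi> x * w x) = 0"
  shows "AE x in MI. w x = 0"
proof -
  have wm: "w \<in> borel_measurable MI" using w by (rule borel_measurable_integrable)
  have iv: "(LINT x|MI. indicator {a<..<1} x * w x) = 0" if a: "0 \<le> a" "a < 1" for a
  proof -
    define y where "y n x = flat 0 (real (Suc n) * (x - a) - 1) * flat 0 (real (Suc n) * (1 - x) - 1)" for n x
    have yV: "(\<lambda>x. of_real (y n x)) \<in> half_test_functions" for n
      unfolding y_def by (rule half_test_cutoff[OF a]) simp
    have ym: "(\<lambda>x. complex_of_real (y n x)) \<in> borel_measurable MI" for n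
      using half_test_continuous[OF yV] by (intro continuous_imp_measurable_on_sets_lebesgue) auto
    have "(\<lambda>n. LINT x|MI. of_real (y n x) * w x) \<longlonglongrightarrow> (LINT x|MI. indicator {a<..<1} x * w x)"
    proof (rule integral_dominated_convergence[where w="\<lambda>x. norm (w x)"])
      show "(\<lambda>x. indicator {a<..<1} x * w x) \<in> borel_measurable MI"
        using wm by (intro borel_measurable_times borel_measurable_indicator_MI) auto
      show "(\<lambda>x. of_real (y n x) * w x) \<in> borel_measurable MI" for n
        using ym wm by (rule borel_measurable_times)
      show "integrable MI (\<lambda>x. norm (w x))" using w by (rule integrable_norm)
      have flat1: "0 \<le> flat 0 s \<and> flat 0 s \<le> 1" for s by (simp add: flat_def)
      have lim1: "(\<lambda>n. flat 0 (real (Suc n) * t - 1)) \<longlonglongrightarrow> (if t > 0 then 1 else 0)" for t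
      proof (cases "t > 0")
        case True
        have top: "filterlim (\<lambda>n. real (Suc n) * t - 1) at_top sequentially"
          using True by real_asymp
        then have ev: "\<forall>\<^sub>F n in sequentially. real (Suc n) * t - 1 > 0"
          by (rule filterlim_at_top_dense[THEN iffD1, rule_format])
        have "(\<lambda>n. exp (- (1 / (real (Suc n) * t - 1)))) \<longlonglongrightarrow> exp (- 0)"
          by (intro tendsto_intros tendsto_divide_0[OF tendsto_const] filterlim_at_top_imp_at_infinity top)
        then have "(\<lambda>n. flat 0 (real (Suc n) * t - 1)) \<longlonglongrightarrow> exp (- 0)"
          by (rule Lim_transform_eventually) (use ev in \<open>eventually_elim, simp add: flat_def\<close>)
        then show ?thesis using True by simp
      next
        case False
        then have "real (Suc n) * t - 1 \<le> 0" for n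
          by (smt (verit) mult_nonneg_nonpos of_nat_0_le_iff)
        then show ?thesis using False by (simp add: flat_def not_less[THEN iffD2] del: of_nat_Suc)
      qed
      have "(\<lambda>n. y n x) \<longlonglongrightarrow> (if x - a > 0 then 1 else 0) * (if 1 - x > 0 then 1 else 0)" for x
        unfolding y_def by (intro tendsto_mult lim1)
      then have "(\<lambda>n. complex_of_real (y n x)) \<longlonglongrightarrow> of_real ((if x - a > 0 then 1 else 0) * (if 1 - x > 0 then 1 else 0))" for x
        by (intro tendsto_of_real)
      moreover have "complex_of_real ((if x - a > 0 then 1 else 0) * (if 1 - x > 0 then 1 else 0)) = indicator {a<..<1} x" for x
        by (auto simp: indicator_def)
      ultimately have "(\<lambda>n. of_real (y n x) * w x) \<longlonglongrightarrow> indicator {a<..<1} x * w x" for x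
        by (intro tendsto_mult tendsto_const) simp
      then show "AE x in MI. (\<lambda>n. of_real (y n x) * w x) \<longlonglongrightarrow> indicator {a<..<1} x * w x" by simp
      have "\<bar>y n x\<bar> \<le> 1" for n x
        using flat1 unfolding y_def by (simp add: abs_mult mult_le_one)
      then show "AE x in MI. norm (of_real (y n x) * w x) \<le> norm (w x)" for n
        by (intro AE_I2) (simp add: norm_mult mult_left_le_one_le)
    qed
    moreover have "(LINT x|MI. of_real (y n x) * w x) = 0" for n by (rule orth[OF yV])
    ultimately show ?thesis using LIMSEQ_unique[OF _ tendsto_const] by simp
  qed
  have tail: "(LINT x|MI. indicator {a<..} x * w x) = 0" for a
  proof (cases "a < 1")
    case True
    have "AE x in lebesgue. x \<noteq> 0 \<and> x \<noteq> 1" by (intro AE_conjI AE_completion AE_lborel_singleton)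
    then have "AE x in MI. x \<noteq> 0 \<and> x \<noteq> 1" by (subst AE_restrict_space_iff) auto
    then have ae: "AE x in MI. indicator {a<..} x * w x = indicator {max a 0<..<1} x * w x"
    proof eventually_elim
      case (elim x)
      then show ?case using supp[of x] True by (auto simp: indicator_def)
    qed
    have "(LINT x|MI. indicator {a<..} x * w x) = (LINT x|MI. indicator {max a 0<..<1} x * w x)"
      by (rule integral_cong_AE[OF _ _ ae]; intro borel_measurable_times borel_measurable_indicator_MI wm) auto
    then show ?thesis using iv[of "max a 0"] True by simp
  next
    case False
    then have "(LINT x|MI. indicator {a<..} x * w x) = (LINT x|MI. 0)"
      by (intro Bochner_Integration.integral_cong) (auto simp: indicator_def intro!: supp)
    then show ?thesis by simp
  qed
  have it: "integrable MI (\<lambda>x. indicator {a<..} x * w x)" for a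
  proof (rule Bochner_Integration.integrable_bound[OF w])
    show "(\<lambda>x. indicator {a<..} x * w x) \<in> borel_measurable MI"
      by (intro borel_measurable_times borel_measurable_indicator_MI wm) auto
  qed (auto simp: indicator_def)
  have "(LINT x|MI. indicator {a<..} x * Re (w x)) = 0" for a
  proof -
    have "(LINT x|MI. indicator {a<..} x * Re (w x)) = Re (LINT x|MI. indicator {a<..} x * w x)"
      unfolding Bochner_Integration.integral_Re[OF it, symmetric]
      by (rule Bochner_Integration.integral_cong) (auto simp: indicator_def)
    then show ?thesis using tail by simp
  qed
  then have re: "AE x in MI. Re (w x) = 0" by (intro AE_zero_if_tail_integrals_zero integrable_Re w)
  have "(LINT x|MI. indicator {a<..} x * Im (w x)) = 0" for a
  proof -
    have "(LINT x|MI. indicator {a<..} x * Im (w x)) = Im (LINT x|MI. indicator {a<..} x * w x)"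
      unfolding Bochner_Integration.integral_Im[OF it, symmetric]
      by (rule Bochner_Integration.integral_cong) (auto simp: indicator_def)
    then show ?thesis using tail by simp
  qed
  then have im: "AE x in MI. Im (w x) = 0" by (intro AE_zero_if_tail_integrals_zero integrable_Im w)
  show ?thesis using re im by eventually_elim (simp add: complex_eq_iff)
qed

section \<open>A compact right inverse on the half-interval\<close>

lemma square_integrable_bounded:
  assumes "f \<in> borel_measurable MI" "\<And>x. cmod (f x) \<le> K"
  shows "square_integrable f"
  unfolding square_integrable_def
proof
  show "integrable MI (\<lambda>x. (cmod (f x))\<^sup>2)"
  proof (rule Bochner_Integration.integrable_bound)
    show "integrable MI (\<lambda>x. K\<^sup>2)" by (rule finite_measure.integrable_const[OF finite_measure_lebesgue_on]) simp
    show "(\<lambda>x. (cmod (f x))\<^sup>2) \<in> borel_measurable MI" using assms(1) by measurable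
    show "AE x in MI. norm ((cmod (f x))\<^sup>2) \<le> norm (K\<^sup>2)"
      using assms(2) by (intro AE_I2) (auto intro: power_mono)
  qed
qed (rule assms)

text \<open>What is needed of the coefficient on one side of its zero. The lower bound encodes that the order
  of the zero is at most \<open>2m - 1\<close>.\<close>

locale half_interval_coefficient =
  fixes m :: nat and c :: "real \<Rightarrow> real" and \<kappa> :: real
  assumes m: "m \<ge> 1"
    and c_smooth: "smooth_on {0<..<1} (\<lambda>x. of_real (c x))"
    and c_cont: "continuous_on {0..1} c"
    and \<kappa>: "\<kappa> > 0"
    and c_lower: "\<And>x. 0 < x \<Longrightarrow> x \<le> 1 \<Longrightarrow> \<kappa> * x ^ (2 * m - 1) \<le> \<bar>c x\<bar>"
begin

text \<open>Cauchy's kernel of \<open>m\<close>-fold integration. Read in its second argument it integrates from \<open>0\<close> (the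
  operator \<open>J\<close>), read in its first argument it integrates towards \<open>1\<close>. Since \<open>Q\<close> is \<open>J\<close> divided by
  \<open>c\<close>, the composite \<open>G\<close> has the symmetric kernel \<open>\<integral> kern s x * kern s t / c s ds\<close>.\<close>

definition kern :: "real \<Rightarrow> real \<Rightarrow> real" where
  "kern s x = (if 0 \<le> x \<and> x < s then (s - x) ^ (m - 1) / fact (m - 1) else 0)"

definition J :: "(real \<Rightarrow> complex) \<Rightarrow> real \<Rightarrow> complex" where
  "J \<phi> s = (LINT t|MI. of_real (kern s t) * \<phi> t)"

definition Q :: "(real \<Rightarrow> complex) \<Rightarrow> real \<Rightarrow> complex" where
  "Q \<phi> s = (if 0 < s \<and> s \<le> 1 then J \<phi> s / of_real (c s) else 0)"

definition G :: "(real \<Rightarrow> complex) \<Rightarrow> real \<Rightarrow> complex" where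
  "G \<phi> x = (LINT s|MI. of_real (kern s x) * Q \<phi> s)"

text \<open>Bounds for \<open>J\<close>, \<open>Q\<close>, \<open>G\<close> are stated with this inhomogeneous quantity: it is bounded on
  bounded sets, and it comes directly from the inequality \<open>a \<le> r a\<^sup>2 + 1/r\<close> for \<open>r > 0\<close>.\<close>

definition mass :: "(real \<Rightarrow> complex) \<Rightarrow> real" where
  "mass \<phi> = 1 + (LINT x|MI. (cmod (\<phi> x))\<^sup>2)"

text \<open>\<open>weight\<close> dominates \<open>Q\<close>, and \<open>inverse_sqrt\<close> dominates \<open>weight\<close> times the kernel.\<close>

definition weight :: "real \<Rightarrow> real" where
  "weight s = (if 0 < s \<and> s \<le> 1 then 1 / (s ^ (m - 1) * sqrt s) else 0)"

definition inverse_sqrt :: "real \<Rightarrow> real" where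
  "inverse_sqrt s = (if 0 < s \<and> s \<le> 1 then 1 / sqrt s else 0)"

lemma c_nonzero: "0 < x \<Longrightarrow> x \<le> 1 \<Longrightarrow> c x \<noteq> 0"
  using c_lower[of x] \<kappa> by (metis abs_zero mult_pos_pos not_less zero_less_power)

lemma kern_nonneg: "0 \<le> kern s x"
  by (simp add: kern_def)

lemma kern_le: "0 \<le> s \<Longrightarrow> kern s x \<le> s ^ (m - 1)"
proof -
  assume s: "0 \<le> s"
  have "(s - x) ^ (m - 1) / fact (m - 1) \<le> s ^ (m - 1)" if "0 \<le> x" "x < s"
  proof -
    have "(s - x) ^ (m - 1) / fact (m - 1) \<le> (s - x) ^ (m - 1) / 1"
      using that by (intro divide_left_mono) auto
    also have "\<dots> \<le> s ^ (m - 1)" using that by (auto intro: power_mono)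
    finally show ?thesis .
  qed
  then show ?thesis using s by (simp add: kern_def)
qed

lemma kern_eq_0: "s \<le> 0 \<Longrightarrow> kern s x = 0"
  by (simp add: kern_def)

lemma borel_measurable_id_MI [measurable]: "(\<lambda>x. x) \<in> borel_measurable MI"
  using measurable_completion[of "\<lambda>x. x" lborel borel] by (intro measurable_restrict_space1) simp

lemma borel_measurable_fst_MI [measurable]: "fst \<in> borel_measurable (MI \<Otimes>\<^sub>M MI)"
  using measurable_compose[OF measurable_fst borel_measurable_id_MI] by simp

lemma borel_measurable_snd_MI [measurable]: "snd \<in> borel_measurable (MI \<Otimes>\<^sub>M MI)"
  using measurable_compose[OF measurable_snd borel_measurable_id_MI] by simp

lemma kern_measurable2: "(\<lambda>p. kern (fst p) (snd p)) \<in> borel_measurable (MI \<Otimes>\<^sub>M MI)"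
  and kern_measurable2': "(\<lambda>p. kern (snd p) (fst p)) \<in> borel_measurable (MI \<Otimes>\<^sub>M MI)"
  and kern_measurable: "kern s \<in> borel_measurable MI"
  and kern_measurable': "(\<lambda>s. kern s x) \<in> borel_measurable MI"
  unfolding kern_def by measurable

lemma sigma_finite_MI: "sigma_finite_measure MI"
  using finite_measure_lebesgue_on[of "{-1..1::real}"] by (simp add: finite_measure_def)

lemma J_measurable: "\<phi> \<in> borel_measurable MI \<Longrightarrow> J \<phi> \<in> borel_measurable MI"
proof -
  assume [measurable]: "\<phi> \<in> borel_measurable MI"
  have "(\<lambda>p. complex_of_real (kern (fst p) (snd p)) * \<phi> (snd p)) \<in> borel_measurable (MI \<Otimes>\<^sub>M MI)"
    using kern_measurable2 measurable_compose[OF measurable_snd \<open>\<phi> \<in> borel_measurable MI\<close>, of MI]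
    by (intro borel_measurable_times borel_measurable_of_real) auto
  then show ?thesis unfolding J_def[abs_def]
    by (intro sigma_finite_measure.borel_measurable_lebesgue_integral[OF sigma_finite_MI])
      (simp add: split_beta')
qed

lemma Q_measurable:
  assumes "\<phi> \<in> borel_measurable MI"
  shows "Q \<phi> \<in> borel_measurable MI"
proof -
  have "continuous_on {0<..1} (\<lambda>x. 1 / c x)"
    using c_nonzero by (intro continuous_intros continuous_on_subset[OF c_cont]) auto
  then have "(\<lambda>x. indicator {0<..1} x *\<^sub>R (1 / c x)) \<in> borel_measurable borel"
    by (intro borel_measurable_continuous_on_indicator) auto
  also have "(\<lambda>x. indicator {0<..1} x *\<^sub>R (1 / c x)) = (\<lambda>x. if x \<in> {0<..1} then 1 / c x else 0)"
    by (auto simp: indicator_def)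
  finally have "(\<lambda>x. if x \<in> {0<..1} then 1 / c x else 0) \<in> borel_measurable borel" .
  from measurable_completion[of _ lborel borel, simplified, OF this]
  have "(\<lambda>x. if x \<in> {0<..1} then 1 / c x else 0) \<in> borel_measurable MI"
    by (intro measurable_restrict_space1) simp
  from measurable_compose[OF this borel_measurable_of_real]
  have "(\<lambda>x. complex_of_real (if x \<in> {0<..1} then 1 / c x else 0) * J \<phi> x) \<in> borel_measurable MI"
    by (intro borel_measurable_times J_measurable assms)
  moreover have "(\<lambda>x. complex_of_real (if x \<in> {0<..1} then 1 / c x else 0) * J \<phi> x) = Q \<phi>"
    by (auto simp: Q_def fun_eq_iff)
  ultimately show ?thesis by simp
qed

lemma mass_pos: "mass \<phi> > 0"
  unfolding mass_def by (intro add_pos_nonneg Bochner_Integration.integral_nonneg) auto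

lemma kern_mult_integrable:
  fixes \<phi> :: "real \<Rightarrow> complex"
  assumes "integrable MI \<phi>"
  shows "integrable MI (\<lambda>t. of_real (kern s t) * \<phi> t)"
proof (rule Bochner_Integration.integrable_bound)
  show "integrable MI (\<lambda>t. \<bar>s\<bar> ^ (m - 1) * norm (\<phi> t))" using assms by (intro integrable_mult_right integrable_norm)
  show "(\<lambda>t. of_real (kern s t) * \<phi> t) \<in> borel_measurable MI"
    using assms kern_measurable by (intro borel_measurable_times borel_measurable_of_real) auto
  have "kern s t \<le> \<bar>s\<bar> ^ (m - 1)" for t
    using kern_le[of s t] kern_eq_0[of s t] by (cases "s \<le> 0") auto
  then show "AE t in MI. norm (of_real (kern s t) * \<phi> t) \<le> norm (\<bar>s\<bar> ^ (m - 1) * norm (\<phi> t))"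
    by (intro AE_I2) (auto simp: norm_mult kern_nonneg intro!: mult_right_mono)
qed

text \<open>The \<open>m\<close>-fold integral from \<open>0\<close> gains the factor \<open>s\<^bsup>m - 1/2\<^esup>\<close>; this is what compensates the
  division by a coefficient of order at most \<open>2m - 1\<close>.\<close>

lemma J_bound:
  assumes \<phi>: "square_integrable \<phi>" and s: "0 < s" "s \<le> 1"
  shows "cmod (J \<phi> s) \<le> s ^ (m - 1) * sqrt s * mass \<phi>"
proof -
  have \<phi>i: "integrable MI \<phi>" by (rule integrable_if_square_integrable[OF \<phi>])
  have sq: "integrable MI (\<lambda>x. (cmod (\<phi> x))\<^sup>2)" using \<phi> by (simp add: square_integrable_def)
  have ind: "integrable MI (indicator {0..s} :: real \<Rightarrow> real)" "(LINT t|MI. indicator {0..s} t) = s"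
  proof -
    have "{0..s} \<inter> {-1..1} = {0..s}" using s by auto
    then have "emeasure MI {0..s} = ennreal s" "measure MI {0..s} = s" "{0..s} \<in> sets MI"
      using s by (auto simp: emeasure_restrict_space measure_restrict_space sets_restrict_space_iff)
    then show "integrable MI (indicator {0..s} :: real \<Rightarrow> real)" "(LINT t|MI. indicator {0..s} t) = s"
      using s by (auto simp: integrable_indicator_iff min_def)
  qed
  have "cmod (J \<phi> s) \<le> (LINT t|MI. s ^ (m - 1) * (sqrt s * (cmod (\<phi> t))\<^sup>2 + indicator {0..s} t / sqrt s))"
    unfolding J_def
  proof (rule Bochner_Integration.integral_norm_bound_integral)
    show "integrable MI (\<lambda>t. of_real (kern s t) * \<phi> t)" by (rule kern_mult_integrable[OF \<phi>i])
    show "integrable MI (\<lambda>t. s ^ (m - 1) * (sqrt s * (cmod (\<phi> t))\<^sup>2 + indicator {0..s} t / sqrt s))"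
      using sq ind(1) by (intro integrable_mult_right Bochner_Integration.integrable_add integrable_divide)
    fix t
    show "cmod (of_real (kern s t) * \<phi> t) \<le> s ^ (m - 1) * (sqrt s * (cmod (\<phi> t))\<^sup>2 + indicator {0..s} t / sqrt s)"
    proof (cases "t \<in> {0..s}")
      case True
      \<comment> \<open>the factor \<open>sqrt s\<close> balances the two terms after integration over an interval of length \<open>s\<close>\<close>
      have "cmod (\<phi> t) \<le> sqrt s * (cmod (\<phi> t))\<^sup>2 + 1 / sqrt s"
      proof (cases "cmod (\<phi> t) \<le> 1 / sqrt s")
        case False
        then have "1 \<le> sqrt s * cmod (\<phi> t)" using s by (simp add: field_simps)
        then have "cmod (\<phi> t) * 1 \<le> cmod (\<phi> t) * (sqrt s * cmod (\<phi> t))" by (rule mult_left_mono) simp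
        then have "cmod (\<phi> t) \<le> sqrt s * (cmod (\<phi> t))\<^sup>2" by (simp add: power2_eq_square mult_ac)
        moreover have "0 \<le> 1 / sqrt s" using s by simp
        ultimately show ?thesis by linarith
      qed (use s in \<open>simp add: add_increasing\<close>)
      then have "kern s t * cmod (\<phi> t) \<le> s ^ (m - 1) * (sqrt s * (cmod (\<phi> t))\<^sup>2 + 1 / sqrt s)"
        using s by (intro mult_mono kern_le) auto
      then show ?thesis using True by (simp add: norm_mult kern_nonneg)
    next
      case False
      then have "kern s t = 0" by (auto simp: kern_def)
      then show ?thesis using s by simp
    qed
  qed
  also have "\<dots> = s ^ (m - 1) * (sqrt s * (LINT t|MI. (cmod (\<phi> t))\<^sup>2) + s / sqrt s)"
    using sq ind by simp
  also have "\<dots> = s ^ (m - 1) * sqrt s * mass \<phi>"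
    using s by (simp add: mass_def real_div_sqrt algebra_simps)
  finally show ?thesis .
qed

lemma Q_bound:
  assumes "square_integrable \<phi>"
  shows "cmod (Q \<phi> s) \<le> mass \<phi> / \<kappa> * weight s"
proof (cases "0 < s \<and> s \<le> 1")
  case True
  then have s: "0 < s" "s \<le> 1" by auto
  define S where "S = s ^ (m - 1)"
  have S: "S > 0" using s by (simp add: S_def)
  have pow: "s ^ (2 * m - 1) = S * S * s"
  proof -
    have "2 * m - 1 = (m - 1) + (m - 1) + 1" using m by simp
    then show ?thesis by (simp only: power_add S_def power_one_right)
  qed
  have cs: "\<kappa> * (S * S * s) \<le> \<bar>c s\<bar>" using c_lower[OF s] pow by simp
  have pos: "\<kappa> * (S * S * s) > 0" using \<kappa> S s by simp
  have Jb: "cmod (J \<phi> s) \<le> S * sqrt s * mass \<phi>" unfolding S_def by (rule J_bound[OF assms s])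
  have "cmod (Q \<phi> s) = cmod (J \<phi> s) / \<bar>c s\<bar>" using s by (simp add: Q_def norm_divide)
  also have "\<dots> \<le> (S * sqrt s * mass \<phi>) / (\<kappa> * (S * S * s))"
    using Jb cs pos mass_pos[of \<phi>] S s by (intro frac_le) auto
  also have "\<dots> = (S * sqrt s * mass \<phi>) / (\<kappa> * (S * S * (sqrt s * sqrt s)))" using s by simp
  also have "\<dots> = mass \<phi> / \<kappa> * (1 / (S * sqrt s))" using S s \<kappa> by (simp add: divide_simps)
  finally show ?thesis using s by (simp add: weight_def S_def)
next
  case False
  then have "Q \<phi> s = 0" "weight s = 0" by (auto simp: Q_def weight_def)
  then show ?thesis by simp
qed

lemma kern_weight_le: "kern s x * weight s \<le> inverse_sqrt s"
proof (cases "0 < s \<and> s \<le> 1")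
  case True
  then have "kern s x * weight s \<le> s ^ (m - 1) * weight s" by (intro mult_right_mono kern_le) (auto simp: weight_def)
  also have "\<dots> = inverse_sqrt s" using True by (simp add: weight_def inverse_sqrt_def)
  finally show ?thesis .
qed (auto simp: weight_def inverse_sqrt_def)

lemma weight_nonneg: "0 \<le> weight s" and inverse_sqrt_nonneg: "0 \<le> inverse_sqrt s"
  by (simp_all add: weight_def inverse_sqrt_def)

lemma weight_measurable: "weight \<in> borel_measurable MI"
  unfolding weight_def by measurable

lemma inverse_sqrt_integrable: "integrable MI inverse_sqrt"
proof -
  have "((\<lambda>x. x powr (-1/2)) has_integral (1 powr (-1/2 + 1) / (-1/2 + 1))) {0..1::real}"
    by (rule has_integral_powr_from_0) auto
  then have "(inverse_sqrt has_integral 2) {0..1}"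
    by (rule has_integral_eq_rhs[OF has_integral_cong[THEN iffD1, rotated]])
      (auto simp: inverse_sqrt_def powr_minus_divide powr_half_sqrt)
  then have "(inverse_sqrt has_integral 2) {-1..1}"
    by (rule has_integral_on_superset) (auto simp: inverse_sqrt_def)
  then have "inverse_sqrt absolutely_integrable_on {-1..1}"
    by (intro nonnegative_absolutely_integrable_1) (auto simp: inverse_sqrt_nonneg integrable_on_def)
  then show ?thesis by (subst integrable_restrict_space) (auto simp: set_integrable_def)
qed

lemma kern_Q_bound:
  assumes "square_integrable \<phi>"
  shows "cmod (of_real (kern s x) * Q \<phi> s) \<le> mass \<phi> / \<kappa> * inverse_sqrt s"
proof -
  have "cmod (of_real (kern s x) * Q \<phi> s) \<le> kern s x * (mass \<phi> / \<kappa> * weight s)"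
    unfolding norm_mult norm_of_real abs_of_nonneg[OF kern_nonneg]
    by (intro mult_left_mono Q_bound assms kern_nonneg)
  also have "\<dots> = mass \<phi> / \<kappa> * (kern s x * weight s)" by simp
  also have "\<dots> \<le> mass \<phi> / \<kappa> * inverse_sqrt s"
    using mass_pos[of \<phi>] \<kappa> by (intro mult_left_mono kern_weight_le) auto
  finally show ?thesis .
qed

lemma kern_Q_integrable:
  assumes "square_integrable \<phi>"
  shows "integrable MI (\<lambda>s. of_real (kern s x) * Q \<phi> s)"
proof (rule Bochner_Integration.integrable_bound)
  show "integrable MI (\<lambda>s. mass \<phi> / \<kappa> * inverse_sqrt s)" by (intro integrable_mult_right inverse_sqrt_integrable)
  have "\<phi> \<in> borel_measurable MI" using assms by (simp add: square_integrable_def)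
  then show "(\<lambda>s. of_real (kern s x) * Q \<phi> s) \<in> borel_measurable MI"
    using kern_measurable' Q_measurable by (intro borel_measurable_times borel_measurable_of_real) auto
  show "AE s in MI. cmod (of_real (kern s x) * Q \<phi> s) \<le> norm (mass \<phi> / \<kappa> * inverse_sqrt s)"
    using order_trans[OF kern_Q_bound[OF assms, of _ x] abs_ge_self] by (intro AE_I2) (simp only: real_norm_def)
qed

lemma G_bound:
  assumes "square_integrable \<phi>"
  shows "cmod (G \<phi> x) \<le> mass \<phi> / \<kappa> * (LINT s|MI. inverse_sqrt s)"
proof -
  have "cmod (G \<phi> x) \<le> (LINT s|MI. mass \<phi> / \<kappa> * inverse_sqrt s)"
    unfolding G_def
    by (rule Bochner_Integration.integral_norm_bound_integral[OF kern_Q_integrable[OF assms] integrable_mult_right[OF inverse_sqrt_integrable]])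
      (rule kern_Q_bound[OF assms])
  then show ?thesis by simp
qed

text \<open>A common modulus of continuity for all functions \<open>G \<phi>\<close> with bounded \<open>mass\<close>.\<close>

definition modulus :: "real \<Rightarrow> real \<Rightarrow> real" where
  "modulus x y = (LINT s|MI. \<bar>kern s x - kern s y\<bar> * weight s)"

lemma modulus_integrand_le: "\<bar>kern s x - kern s y\<bar> * weight s \<le> inverse_sqrt s"
proof -
  have "\<bar>kern s x - kern s y\<bar> \<le> max (kern s x) (kern s y)"
    using kern_nonneg[of s x] kern_nonneg[of s y] by linarith
  then have "\<bar>kern s x - kern s y\<bar> * weight s \<le> max (kern s x) (kern s y) * weight s"
    by (rule mult_right_mono[OF _ weight_nonneg])
  then show ?thesis using kern_weight_le[of s x] kern_weight_le[of s y] by (auto simp: max_def split: if_splits)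
qed

lemma modulus_integrand_measurable: "(\<lambda>s. \<bar>kern s x - kern s y\<bar> * weight s) \<in> borel_measurable MI"
  using kern_measurable'[of x] kern_measurable'[of y] weight_measurable by measurable

lemma modulus_integrand_integrable: "integrable MI (\<lambda>s. \<bar>kern s x - kern s y\<bar> * weight s)"
  by (rule Bochner_Integration.integrable_bound[OF inverse_sqrt_integrable modulus_integrand_measurable])
    (use modulus_integrand_le in \<open>auto simp: weight_nonneg inverse_sqrt_nonneg abs_mult\<close>)

lemma G_modulus:
  assumes "square_integrable \<phi>"
  shows "cmod (G \<phi> x - G \<phi> y) \<le> mass \<phi> / \<kappa> * modulus x y"
proof -
  have diff: "G \<phi> x - G \<phi> y = (LINT s|MI. of_real (kern s x) * Q \<phi> s - of_real (kern s y) * Q \<phi> s)"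
    unfolding G_def by (rule Bochner_Integration.integral_diff[symmetric]) (rule kern_Q_integrable[OF assms])+
  have "cmod (LINT s|MI. of_real (kern s x) * Q \<phi> s - of_real (kern s y) * Q \<phi> s)
      \<le> (LINT s|MI. mass \<phi> / \<kappa> * (\<bar>kern s x - kern s y\<bar> * weight s))"
  proof (rule Bochner_Integration.integral_norm_bound_integral)
    show "integrable MI (\<lambda>s. of_real (kern s x) * Q \<phi> s - of_real (kern s y) * Q \<phi> s)"
      by (intro Bochner_Integration.integrable_diff kern_Q_integrable assms)
    show "integrable MI (\<lambda>s. mass \<phi> / \<kappa> * (\<bar>kern s x - kern s y\<bar> * weight s))"
      by (intro integrable_mult_right modulus_integrand_integrable)
    fix s
    have "cmod (of_real (kern s x) * Q \<phi> s - of_real (kern s y) * Q \<phi> s)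
        = \<bar>kern s x - kern s y\<bar> * cmod (Q \<phi> s)"
      unfolding left_diff_distrib[symmetric] of_real_diff[symmetric] norm_mult norm_of_real ..
    moreover have "\<bar>kern s x - kern s y\<bar> * cmod (Q \<phi> s) \<le> \<bar>kern s x - kern s y\<bar> * (mass \<phi> / \<kappa> * weight s)"
      by (intro mult_left_mono Q_bound assms) simp
    ultimately show "cmod (of_real (kern s x) * Q \<phi> s - of_real (kern s y) * Q \<phi> s)
        \<le> mass \<phi> / \<kappa> * (\<bar>kern s x - kern s y\<bar> * weight s)" by (simp add: mult_ac)
  qed
  then show ?thesis unfolding diff modulus_def by simp
qed

text \<open>For \<open>s \<noteq> x\<close> the kernel is continuous at \<open>x\<close> (for \<open>m = 1\<close> it jumps at \<open>s = x\<close>), and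
  \<open>inverse_sqrt\<close> is a dominating function.\<close>

lemma modulus_tendsto: "((\<lambda>y. modulus x y) \<longlongrightarrow> 0) (at x within {0..1})" if x: "x \<in> {0..1}"
proof (rule tendsto_at_iff_sequentially[THEN iffD2], intro allI impI)
  fix X :: "nat \<Rightarrow> real" assume X: "\<forall>i. X i \<in> {0..1} - {x}" "X \<longlonglongrightarrow> x"
  have "(\<lambda>n. LINT s|MI. \<bar>kern s x - kern s (X n)\<bar> * weight s) \<longlonglongrightarrow> (LINT s|MI. 0)"
  proof (rule integral_dominated_convergence[OF _ modulus_integrand_measurable inverse_sqrt_integrable])
    have "AE s in MI. s \<noteq> x"
      by (subst AE_restrict_space_iff) (auto intro: AE_mp[OF AE_completion[OF AE_lborel_singleton[of x]]])
    then show "AE s in MI. (\<lambda>n. \<bar>kern s x - kern s (X n)\<bar> * weight s) \<longlonglongrightarrow> 0"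
    proof eventually_elim
      case (elim s)
      have "(\<lambda>n. kern s (X n)) \<longlonglongrightarrow> kern s x"
      proof (cases "s < x")
        case True
        have "\<forall>\<^sub>F n in sequentially. s < X n" using X(2) True by (rule order_tendstoD(1))
        then have "\<forall>\<^sub>F n in sequentially. kern s x = kern s (X n)"
          by eventually_elim (use True in \<open>simp add: kern_def\<close>)
        from Lim_transform_eventually[OF tendsto_const this] show ?thesis .
      next
        case False
        then have "x < s" using elim by simp
        then have "\<forall>\<^sub>F n in sequentially. X n < s" using X(2) by (intro order_tendstoD(2))
        then have ev: "\<forall>\<^sub>F n in sequentially. (s - X n) ^ (m - 1) / fact (m - 1) = kern s (X n)"
          by eventually_elim (use X(1) in \<open>auto simp: kern_def\<close>)
        have "(\<lambda>n. (s - X n) ^ (m - 1) / fact (m - 1)) \<longlonglongrightarrow> (s - x) ^ (m - 1) / fact (m - 1)"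
          by (intro tendsto_intros X(2)) simp
        from Lim_transform_eventually[OF this ev] show ?thesis using \<open>x < s\<close> x by (simp add: kern_def)
      qed
      then have "(\<lambda>n. \<bar>kern s x - kern s (X n)\<bar> * weight s) \<longlonglongrightarrow> \<bar>kern s x - kern s x\<bar> * weight s"
        by (intro tendsto_intros)
      then show ?case by simp
    qed
    show "AE s in MI. norm (\<bar>kern s x - kern s (X n)\<bar> * weight s) \<le> inverse_sqrt s" for n
      using modulus_integrand_le by (intro AE_I2) (simp add: abs_mult weight_nonneg)
  qed simp
  then show "((\<lambda>y. modulus x y) \<circ> X) \<longlonglongrightarrow> 0" by (simp add: o_def modulus_def)
qed

lemma G_zero_outside: "x \<notin> {0..1} \<Longrightarrow> G \<phi> x = 0"
proof -
  assume "x \<notin> {0..1}"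
  then have "kern s x = 0" if "s \<in> {-1..1}" for s using that by (auto simp: kern_def)
  then have "(LINT s|MI. of_real (kern s x) * Q \<phi> s) = (LINT s|MI. 0)"
    by (intro Bochner_Integration.integral_cong) auto
  then show ?thesis by (simp add: G_def)
qed

lemma G_measurable:
  assumes "square_integrable \<phi>"
  shows "G \<phi> \<in> borel_measurable MI"
proof -
  have "\<phi> \<in> borel_measurable MI" using assms by (simp add: square_integrable_def)
  then have "(\<lambda>p. complex_of_real (kern (snd p) (fst p)) * Q \<phi> (snd p)) \<in> borel_measurable (MI \<Otimes>\<^sub>M MI)"
    using kern_measurable2' measurable_compose[OF measurable_snd Q_measurable, of \<phi> MI]
    by (intro borel_measurable_times borel_measurable_of_real) auto
  then show ?thesis unfolding G_def[abs_def]
    by (intro sigma_finite_measure.borel_measurable_lebesgue_integral[OF sigma_finite_MI])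
      (simp add: split_beta')
qed

lemma G_square_integrable: "square_integrable \<phi> \<Longrightarrow> square_integrable (G \<phi>)"
  by (rule square_integrable_bounded[OF G_measurable G_bound])

text \<open>The right-hand side is the hermitian form \<open>\<integral> J \<phi> * cnj (J u) / c\<close>, from which symmetry of \<open>G\<close>
  follows; the coefficient is real.\<close>

lemma G_form:
  assumes \<phi>: "square_integrable \<phi>" and u: "square_integrable u"
  shows "(LINT x|MI. G \<phi> x * cnj (u x)) = (LINT s|MI. Q \<phi> s * cnj (J u s))"
proof -
  interpret pair_sigma_finite MI MI
    by (simp add: pair_sigma_finite_def sigma_finite_MI)
  define F where "F p = of_real (kern (snd p) (fst p)) * Q \<phi> (snd p) * cnj (u (fst p))" for p
  have um: "u \<in> borel_measurable MI" and \<phi>m: "\<phi> \<in> borel_measurable MI"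
    using u \<phi> by (auto simp: square_integrable_def)
  have cu: "(\<lambda>x. cnj (u x)) \<in> borel_measurable MI" using um
    by (rule measurable_compose[OF _ borel_measurable_continuous_onI[OF continuous_on_cnj[OF continuous_on_id]]])
  have ui: "integrable MI u" by (rule integrable_if_square_integrable[OF u])
  have Fm: "F \<in> borel_measurable (MI \<Otimes>\<^sub>M MI)"
    unfolding F_def
    using kern_measurable2' measurable_compose[OF measurable_snd Q_measurable[OF \<phi>m], of MI]
      measurable_compose[OF measurable_fst cu, of MI]
    by (intro borel_measurable_times borel_measurable_of_real) auto
  have Fi: "integrable MI (\<lambda>s. F (x, s))" for x
    unfolding F_def fst_conv snd_conv by (intro integrable_mult_left kern_Q_integrable[OF \<phi>])
  have "integrable (MI \<Otimes>\<^sub>M MI) F"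
  proof (rule Fubini_integrable[OF Fm])
    show "integrable MI (\<lambda>x. LINT s|MI. norm (F (x, s)))"
    proof (rule Bochner_Integration.integrable_bound)
      show "integrable MI (\<lambda>x. mass \<phi> / \<kappa> * (LINT s|MI. inverse_sqrt s) * norm (u x))"
        by (intro integrable_mult_right integrable_norm ui)
      show "(\<lambda>x. LINT s|MI. norm (F (x, s))) \<in> borel_measurable MI"
        using Fm by (intro sigma_finite_measure.borel_measurable_lebesgue_integral[OF sigma_finite_MI]) simp
      show "AE x in MI. norm (LINT s|MI. norm (F (x, s))) \<le> norm (mass \<phi> / \<kappa> * (LINT s|MI. inverse_sqrt s) * norm (u x))"
      proof (rule AE_I2)
        fix x
        have "(LINT s|MI. norm (F (x, s))) \<le> (LINT s|MI. mass \<phi> / \<kappa> * inverse_sqrt s * norm (u x))"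
        proof (rule integral_mono)
          show "integrable MI (\<lambda>s. norm (F (x, s)))" by (intro integrable_norm Fi)
          show "integrable MI (\<lambda>s. mass \<phi> / \<kappa> * inverse_sqrt s * norm (u x))"
            by (intro integrable_mult_left integrable_mult_right inverse_sqrt_integrable)
          show "norm (F (x, s)) \<le> mass \<phi> / \<kappa> * inverse_sqrt s * norm (u x)" for s
            using mult_right_mono[OF kern_Q_bound[OF \<phi>, of s x] norm_ge_zero[of "u x"]]
            by (simp add: F_def norm_mult)
        qed
        also have "\<dots> = mass \<phi> / \<kappa> * (LINT s|MI. inverse_sqrt s) * norm (u x)" by simp
        finally have le: "(LINT s|MI. norm (F (x, s))) \<le> mass \<phi> / \<kappa> * (LINT s|MI. inverse_sqrt s) * norm (u x)" .
        have "0 \<le> (LINT s|MI. norm (F (x, s)))" by (rule Bochner_Integration.integral_nonneg) simp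
        with le show "norm (LINT s|MI. norm (F (x, s))) \<le> norm (mass \<phi> / \<kappa> * (LINT s|MI. inverse_sqrt s) * norm (u x))"
          unfolding real_norm_def by linarith
      qed
    qed
    show "AE x in MI. integrable MI (\<lambda>s. F (x, s))" using Fi by simp
  qed
  then have "integrable (MI \<Otimes>\<^sub>M MI) (\<lambda>(x, s). F (x, s))" by simp
  from Fubini_integral[OF this]
  have "(LINT s|MI. LINT x|MI. F (x, s)) = (LINT x|MI. LINT s|MI. F (x, s))" .
  moreover have "(LINT s|MI. F (x, s)) = G \<phi> x * cnj (u x)" for x
    by (simp add: F_def G_def)
  moreover have "(LINT x|MI. F (x, s)) = Q \<phi> s * cnj (J u s)" for s
  proof -
    have "(LINT x|MI. F (x, s)) = (LINT x|MI. Q \<phi> s * cnj (of_real (kern s x) * u x))"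
      by (rule Bochner_Integration.integral_cong) (auto simp: F_def)
    also have "\<dots> = Q \<phi> s * (LINT x|MI. cnj (of_real (kern s x) * u x))" by (rule integral_mult_right_zero)
    also have "(LINT x|MI. cnj (of_real (kern s x) * u x)) = cnj (J u s)"
      unfolding J_def by (rule Bochner_Integration.integral_cnj)
    finally show ?thesis .
  qed
  ultimately show ?thesis by simp
qed

lemma G_symmetric:
  assumes \<phi>: "square_integrable \<phi>" and u: "square_integrable u"
  shows "(LINT x|MI. G \<phi> x * cnj (u x)) = (LINT x|MI. \<phi> x * cnj (G u x))"
proof -
  have "(LINT x|MI. \<phi> x * cnj (G u x)) = cnj (LINT x|MI. G u x * cnj (\<phi> x))"
    unfolding Bochner_Integration.integral_cnj[symmetric] by (simp add: mult.commute)
  also have "\<dots> = cnj (LINT s|MI. Q u s * cnj (J \<phi> s))" by (simp only: G_form[OF u \<phi>])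
  also have "\<dots> = (LINT s|MI. cnj (Q u s) * J \<phi> s)"
    unfolding Bochner_Integration.integral_cnj[symmetric] by simp
  also have "\<dots> = (LINT s|MI. Q \<phi> s * cnj (J u s))"
    by (rule Bochner_Integration.integral_cong) (auto simp: Q_def)
  finally show ?thesis by (simp only: G_form[OF \<phi> u])
qed

end

definition cut :: "(real \<Rightarrow> complex) \<Rightarrow> real \<Rightarrow> complex" where
  "cut f x = indicator {0..1} x * f x"

lemma cut_square_integrable:
  assumes f: "square_integrable f"
  shows "square_integrable (cut f)" "norm (abs_L2I (cut f)) \<le> norm (abs_L2I f)"
proof -
  have fm: "f \<in> borel_measurable MI" and fi: "integrable MI (\<lambda>x. (cmod (f x))\<^sup>2)"
    using f by (auto simp: square_integrable_def)
  have m: "cut f \<in> borel_measurable MI"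
    unfolding cut_def[abs_def] by (intro borel_measurable_times borel_measurable_indicator_MI fm) auto
  have le: "(cmod (cut f x))\<^sup>2 \<le> (cmod (f x))\<^sup>2" for x by (simp add: cut_def indicator_def)
  have i: "integrable MI (\<lambda>x. (cmod (cut f x))\<^sup>2)"
    by (rule Bochner_Integration.integrable_bound[OF fi]) (use m le in auto)
  show s: "square_integrable (cut f)" using m i by (simp add: square_integrable_def)
  show "norm (abs_L2I (cut f)) \<le> norm (abs_L2I f)"
  proof (rule power2_le_imp_le)
    show "(norm (abs_L2I (cut f)))\<^sup>2 \<le> (norm (abs_L2I f))\<^sup>2"
      unfolding norm_abs_L2I[OF s] norm_abs_L2I[OF f] by (rule integral_mono[OF i fi le])
  qed simp
qed

lemma lebesgue_integral_eqI:
  fixes f :: "real \<Rightarrow> complex"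
  assumes "integrable MI f" "(f has_integral I) S" "S \<subseteq> {-1..1}" "\<And>x. x \<notin> S \<Longrightarrow> f x = 0"
  shows "(LINT x|MI. f x) = I"
proof -
  have "(f has_integral I) {-1..1}" by (rule has_integral_on_superset[OF assms(2,4,3)])
  then show ?thesis using lebesgue_integral_eq_integral[OF assms(1)] integral_unique by force
qed

context half_interval_coefficient
begin

text \<open>For functions vanishing near the endpoints, Taylor's formula with integral remainder says that
  the \<open>m\<close>-fold integrals from the left and, up to the sign \<open>(-1)\<^sup>m\<close>, from the right invert
  \<open>m\<close>-fold differentiation.\<close>

lemma J_nth_derivative:
  assumes \<psi>: "\<psi> \<in> half_test_functions" and s: "0 \<le> s" "s \<le> 1"
  shows "J (nth_derivative m \<psi>) s = \<psi> s"
proof -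
  let ?i = "\<lambda>x. ((s - x) ^ (m - 1) / fact (m - 1)) *\<^sub>R nth_derivative m \<psi> x"
  have "(?i has_integral \<psi> s - (\<Sum>i<m. ((s - 0) ^ i / fact i) *\<^sub>R nth_derivative i \<psi> 0)) {0..s}"
    using m s by (intro Taylor_has_integral)
      (auto intro!: has_vector_derivative_at_within smooth_on_has_vector_derivative[OF half_test_smooth[OF \<psi>]])
  moreover have "nth_derivative i \<psi> 0 = 0" for i
    using half_test_zero[OF half_test_nth_derivative[OF \<psi>]] by simp
  ultimately have "(?i has_integral \<psi> s) {0..s}" by simp
  then have "((\<lambda>t. of_real (kern s t) * nth_derivative m \<psi> t) has_integral \<psi> s) {0..s}"
    by (rule has_integral_spike_finite[of "{s}", rotated 2]) (auto simp: kern_def scaleR_conv_of_real)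
  then show ?thesis unfolding J_def
  proof (rule lebesgue_integral_eqI[rotated])
    show "integrable MI (\<lambda>t. of_real (kern s t) * nth_derivative m \<psi> t)"
      by (rule kern_mult_integrable[OF integrable_if_square_integrable(1)[OF half_test_square_integrable[OF half_test_nth_derivative[OF \<psi>]]]])
  qed (use s in \<open>auto simp: kern_def\<close>)
qed

lemma integral_kern_nth_derivative:
  assumes y: "y \<in> half_test_functions" and x: "0 \<le> x" "x \<le> 1"
  shows "(LINT s|MI. of_real (kern s x) * nth_derivative m y s) = (-1) ^ m * y x"
proof -
  define g where "g t = y (- t)" for t
  have gs: "smooth_on UNIV g"
    unfolding g_def using smooth_on_affine[OF half_test_smooth[OF y], of "-1" 0] by simp
  have dg: "nth_derivative i g = (\<lambda>t. (-1) ^ i * nth_derivative i y (- t))" for i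
    unfolding g_def by (rule nth_derivative_reflect[OF half_test_smooth[OF y]])
  let ?i = "\<lambda>t. ((- x - t) ^ (m - 1) / fact (m - 1)) *\<^sub>R nth_derivative m g t"
  have "(?i has_integral g (- x) - (\<Sum>i<m. ((- x - (-1)) ^ i / fact i) *\<^sub>R nth_derivative i g (-1))) {-1..- x}"
    using m x by (intro Taylor_has_integral)
      (auto intro!: has_vector_derivative_at_within smooth_on_has_vector_derivative[OF gs])
  moreover have "nth_derivative i g (-1) = 0" for i
    unfolding dg using half_test_zero[OF half_test_nth_derivative[OF y]] by simp
  ultimately have "(?i has_integral y x) {-1..- x}" by (simp add: g_def)
  then have "((\<lambda>s. ?i (- s)) has_integral y x) {x..1}"
    using has_integral_reflect_real[of ?i "y x" "- x" "- 1"] by simp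
  then have "((\<lambda>s. (-1) ^ m * ?i (- s)) has_integral (-1) ^ m * y x) {x..1}"
    by (rule has_integral_mult_right)
  then have "((\<lambda>s. of_real (kern s x) * nth_derivative m y s) has_integral (-1) ^ m * y x) {x..1}"
    by (rule has_integral_spike_finite[of "{x}", rotated 2])
      (use x in \<open>auto simp: kern_def dg scaleR_conv_of_real mult_ac simp flip: power_mult_distrib\<close>)
  then show ?thesis
  proof (rule lebesgue_integral_eqI[rotated])
    have d: "nth_derivative m y \<in> half_test_functions" by (rule half_test_nth_derivative[OF y])
    show "integrable MI (\<lambda>s. of_real (kern s x) * nth_derivative m y s)"
    proof (rule Bochner_Integration.integrable_bound)
      show "integrable MI (nth_derivative m y)"
        by (rule integrable_if_square_integrable(1)[OF half_test_square_integrable[OF d]])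
      show "(\<lambda>s. of_real (kern s x) * nth_derivative m y s) \<in> borel_measurable MI"
        using measurable_compose[OF kern_measurable' borel_measurable_of_real] half_test_square_integrable[OF d]
        by (intro borel_measurable_times) (auto simp: square_integrable_def)
      have k1: "kern s x \<le> 1" if "s \<le> 1" for s
      proof (cases "0 \<le> s")
        case True
        then show ?thesis using kern_le[of s x] power_le_one[of s "m - 1"] that by linarith
      qed (simp add: kern_def)
      show "AE s in MI. norm (of_real (kern s x) * nth_derivative m y s) \<le> norm (nth_derivative m y s)"
      proof (rule AE_I2)
        fix s assume "s \<in> space MI"
        then have "kern s x \<le> 1" by (intro k1) simp
        then show "norm (of_real (kern s x) * nth_derivative m y s) \<le> norm (nth_derivative m y s)"
          unfolding norm_mult norm_of_real abs_of_nonneg[OF kern_nonneg]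
          by (rule mult_left_le_one_le[OF norm_ge_zero kern_nonneg])
      qed
    qed
    fix s assume s: "s \<notin> {x..1}"
    show "of_real (kern s x) * nth_derivative m y s = 0"
    proof (cases "s < x")
      case False
      then have "nth_derivative m y s = 0" using s by (intro half_test_zero[OF d]) auto
      then show ?thesis by simp
    qed (simp add: kern_def)
  qed (use x in auto)
qed

lemma G_diff_expr:
  assumes y: "y \<in> half_test_functions"
  shows "G (diff_expr m c y) x = y x"
proof (cases "x \<in> {0..1}")
  case False
  then show ?thesis using half_test_zero[OF y, of x] by (auto simp: G_zero_outside)
next
  case True
  let ?\<psi> = "\<lambda>t. of_real (c t) * nth_derivative m y t"
  have \<psi>: "?\<psi> \<in> half_test_functions"
    by (rule half_test_mult[OF c_smooth half_test_nth_derivative[OF y]])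
  have J: "J (diff_expr m c y) s = (-1) ^ m * ?\<psi> s" if s: "0 \<le> s" "s \<le> 1" for s
  proof -
    have "J (diff_expr m c y) s = (LINT t|MI. (-1) ^ m * (of_real (kern s t) * nth_derivative m ?\<psi> t))"
      unfolding J_def diff_expr_def by (simp only: mult.left_commute)
    also have "\<dots> = (-1) ^ m * J (nth_derivative m ?\<psi>) s"
      unfolding J_def by (rule integral_mult_right_zero)
    finally show ?thesis by (simp only: J_nth_derivative[OF \<psi> s])
  qed
  have Q: "Q (diff_expr m c y) s = (-1) ^ m * nth_derivative m y s" for s
  proof (cases "0 < s \<and> s \<le> 1")
    case True
    then show ?thesis using c_nonzero[of s] J[of s] by (simp add: Q_def)
  next
    case False
    then have "nth_derivative m y s = 0" by (intro half_test_zero[OF half_test_nth_derivative[OF y]]) auto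
    then show ?thesis using False by (auto simp: Q_def)
  qed
  have "G (diff_expr m c y) x = (LINT s|MI. (-1) ^ m * (of_real (kern s x) * nth_derivative m y s))"
    unfolding G_def Q by (simp only: mult.left_commute)
  also have "\<dots> = (-1) ^ m * (LINT s|MI. of_real (kern s x) * nth_derivative m y s)"
    by (rule integral_mult_right_zero)
  also have "\<dots> = (-1) ^ m * ((-1) ^ m * y x)"
    using True by (simp only: integral_kern_nth_derivative[OF y] atLeastAtMost_iff)
  finally show ?thesis by (simp flip: mult.assoc power_mult_distrib)
qed

text \<open>Compactness into \<open>C[0,1]\<close> by the Arzela-Ascoli theorem, hence into \<open>L\<^sub>2(I)\<close>; outside \<open>[0,1]\<close> the
  functions vanish.\<close>

lemma G_compact:
  assumes u: "\<And>n. square_integrable (u n)" and K: "\<And>n. norm (abs_L2I (u n)) \<le> K"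
  obtains r where "strict_mono (r :: nat \<Rightarrow> nat)" "convergent (\<lambda>n. abs_L2I (G (u (r n))))"
proof -
  define B where "B = (1 + K\<^sup>2) / \<kappa>"
  have mass: "mass (u n) / \<kappa> \<le> B" for n
  proof -
    have "(norm (abs_L2I (u n)))\<^sup>2 \<le> K\<^sup>2" by (intro power_mono K) simp
    then show ?thesis using \<kappa> unfolding B_def mass_def norm_abs_L2I[OF u] by (intro divide_right_mono) auto
  qed
  have B: "B > 0" using \<kappa> unfolding B_def by (intro divide_pos_pos add_pos_nonneg) auto
  have R: "0 \<le> (LINT s|MI. inverse_sqrt s)" by (rule Bochner_Integration.integral_nonneg) (simp add: inverse_sqrt_nonneg)
  have bd: "cmod (G (u n) x) \<le> B * (LINT s|MI. inverse_sqrt s)" for n x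
    using G_bound[OF u, of n x] mult_right_mono[OF mass R, of n] by linarith
  have equi: "\<exists>d>0. \<forall>n y. y \<in> {0..1} \<and> norm (x - y) < d \<longrightarrow> norm (G (u n) x - G (u n) y) < e"
    if x: "x \<in> {0..1}" and e: "0 < e" for x e
  proof -
    have "\<forall>\<^sub>F y in at x within {0..1}. modulus x y < e / B"
      using modulus_tendsto[OF x] by (rule order_tendstoD(2)) (use e B in simp)
    then obtain d where d: "d > 0" "\<And>y. y \<in> {0..1} \<Longrightarrow> y \<noteq> x \<Longrightarrow> dist y x < d \<Longrightarrow> modulus x y < e / B"
      unfolding eventually_at by blast
    have "norm (G (u n) x - G (u n) y) < e" if y: "y \<in> {0..1}" "norm (x - y) < d" for n y
    proof (cases "y = x")
      case False
      have "0 \<le> modulus x y"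
        unfolding modulus_def by (rule Bochner_Integration.integral_nonneg) (simp add: weight_nonneg)
      then have "norm (G (u n) x - G (u n) y) \<le> B * modulus x y"
        using G_modulus[OF u, of n x y] mult_right_mono[OF mass, of "modulus x y" n] by linarith
      also have "\<dots> < B * (e / B)"
        using d(2)[OF y(1) False] y(2) B by (intro mult_strict_left_mono) (auto simp: dist_norm norm_minus_commute)
      finally show ?thesis using B by simp
    qed (use e in simp)
    then show ?thesis using d(1) by blast
  qed
  obtain g r where g: "continuous_on {0..1} g" and r: "strict_mono (r :: nat \<Rightarrow> nat)"
    and unif: "\<And>e. 0 < e \<Longrightarrow> \<exists>N. \<forall>n x. n \<ge> N \<and> x \<in> {0..1} \<longrightarrow> norm (G (u (r n)) x - g x) < e"
    using Arzela_Ascoli[OF compact_Icc, of 0 1 "\<lambda>n. G (u n)" "B * (LINT s|MI. inverse_sqrt s)"] bd equi by metis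
  define h where "h x = indicator {0..1} x * g x" for x
  have hm: "h \<in> borel_measurable MI"
  proof -
    have "(\<lambda>x. indicator {0..1} x *\<^sub>R g x) \<in> borel_measurable borel"
      by (intro borel_measurable_continuous_on_indicator g) auto
    also have "(\<lambda>x. indicator {0..1} x *\<^sub>R g x) = h" by (auto simp: h_def indicator_def)
    finally show ?thesis
      by (intro measurable_restrict_space1 measurable_completion[of _ lborel borel, simplified])
  qed
  obtain Kg where "\<forall>z\<in>g ` {0..1}. norm z \<le> Kg"
    using compact_imp_bounded[OF compact_continuous_image[OF g compact_Icc]] unfolding bounded_iff by blast
  then have Kg: "norm (g x) \<le> Kg" if "x \<in> {0..1}" for x using that by blast
  have "0 \<le> Kg" using Kg[of 0] norm_ge_zero[of "g 0"] by (metis atLeastAtMost_iff order_trans order_refl zero_le_one)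
  then have "cmod (h x) \<le> Kg" for x using Kg[of x] by (auto simp: h_def indicator_def)
  then have h: "square_integrable h" by (rule square_integrable_bounded[OF hm])
  have "(\<lambda>n. abs_L2I (G (u (r n)))) \<longlonglongrightarrow> abs_L2I h"
  proof (rule LIMSEQ_I)
    fix e :: real assume e: "0 < e"
    then obtain N where N: "\<And>n x. n \<ge> N \<Longrightarrow> x \<in> {0..1} \<Longrightarrow> norm (G (u (r n)) x - g x) < e / 2"
      using unif[of "e / 2"] by auto
    have "norm (abs_L2I (G (u (r n))) - abs_L2I h) < e" if n: "n \<ge> N" for n
    proof -
      let ?d = "\<lambda>x. G (u (r n)) x - h x"
      have d: "square_integrable ?d" by (intro square_integrable_diff G_square_integrable u h)
      have le: "cmod (?d x) \<le> e / 2" for x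
        using N[OF n, of x] e by (cases "x \<in> {0..1}") (auto simp: h_def G_zero_outside less_imp_le)
      have "(norm (abs_L2I (G (u (r n))) - abs_L2I h))\<^sup>2 = (LINT x|MI. (cmod (?d x))\<^sup>2)"
        by (simp add: abs_L2I_diff G_square_integrable u h norm_abs_L2I[OF d])
      also have "\<dots> \<le> (LINT x|MI. (e / 2)\<^sup>2)"
      proof (rule integral_mono)
        show "integrable MI (\<lambda>x. (cmod (?d x))\<^sup>2)" using d by (simp add: square_integrable_def)
        show "integrable MI (\<lambda>x. (e / 2)\<^sup>2)"
          by (rule finite_measure.integrable_const[OF finite_measure_lebesgue_on]) simp
      qed (intro power_mono le norm_ge_zero)
      also have "\<dots> = e\<^sup>2 / 2" by (simp add: measure_restrict_space power_divide)
      also have "\<dots> < e\<^sup>2" using e by simp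
      finally show ?thesis using e power_less_imp_less_base by (metis less_imp_le)
    qed
    then show "\<exists>no. \<forall>n\<ge>no. norm (abs_L2I (G (u (r n))) - abs_L2I h) < e" by blast
  qed
  then show thesis using that[OF r] convergentI by blast
qed

text \<open>The weak solutions in \<open>L\<^sub>2(0,1)\<close> of the homogeneous equation \<open>l[h] = 0\<close>, extended by zero.\<close>

definition annihilator :: "L2I set" where
  "annihilator = {abs_L2I h | h. square_integrable h \<and> (\<forall>x. x \<notin> {0..1} \<longrightarrow> h x = 0) \<and>
     (\<forall>y\<in>half_test_functions. (LINT x|MI. diff_expr m c y x * cnj (h x)) = 0)}"

lemma diff_expr_square_integrable:
  "y \<in> half_test_functions \<Longrightarrow> square_integrable (diff_expr m c y)"
  by (rule half_test_square_integrable[OF diff_expr_half_test[OF c_smooth]])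

lemma annihilator_subspace: "complex_subspace annihilator"
  unfolding complex_subspace_def
proof (intro conjI ballI allI)
  show "0 \<in> annihilator"
    unfolding annihilator_def zero_L2I.abs_eq using square_integrable_zero by (auto intro!: exI[of _ "\<lambda>x. 0"])
  fix f assume "f \<in> annihilator"
  then obtain h where f: "f = abs_L2I h" and h: "square_integrable h" "\<And>x. x \<notin> {0..1} \<Longrightarrow> h x = 0"
    "\<And>y. y \<in> half_test_functions \<Longrightarrow> (LINT x|MI. diff_expr m c y x * cnj (h x)) = 0"
    unfolding annihilator_def by blast
  show "z *\<^sub>C f \<in> annihilator" for z
  proof -
    have "(LINT x|MI. diff_expr m c y x * cnj (z * h x)) = 0" if "y \<in> half_test_functions" for y
      using h(3)[OF that] by (simp add: mult.left_commute)
    then show ?thesis unfolding f abs_L2I_scaleC[OF h(1)] annihilator_def mem_Collect_eq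
      using h by (intro exI[of _ "\<lambda>x. z * h x"]) (auto intro: square_integrable_cmult)
  qed
  fix g assume "g \<in> annihilator"
  then obtain k where g: "g = abs_L2I k" and k: "square_integrable k" "\<And>x. x \<notin> {0..1} \<Longrightarrow> k x = 0"
    "\<And>y. y \<in> half_test_functions \<Longrightarrow> (LINT x|MI. diff_expr m c y x * cnj (k x)) = 0"
    unfolding annihilator_def by blast
  have "(LINT x|MI. diff_expr m c y x * cnj (h x + k x)) = 0" if y: "y \<in> half_test_functions" for y
    using h(3)[OF y] k(3)[OF y] square_integrable_prod[OF diff_expr_square_integrable[OF y] h(1)]
      square_integrable_prod[OF diff_expr_square_integrable[OF y] k(1)]
    by (simp add: distrib_left)
  then show "f + g \<in> annihilator" unfolding f g abs_L2I_add[OF h(1) k(1)] annihilator_def mem_Collect_eq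
    using h k by (intro exI[of _ "\<lambda>x. h x + k x"]) (auto intro: square_integrable_add)
qed

text \<open>An element of the annihilator that is also orthogonal to the finitely many generators of a
  complement of the range is orthogonal to all test functions.\<close>

lemma annihilator_separated:
  obtains \<Phi> where "finite \<Phi>" "\<And>w. w \<in> annihilator \<Longrightarrow> (\<forall>\<phi>\<in>\<Phi>. cinner w \<phi> = 0) \<Longrightarrow> w = 0"
proof -
  have "c x \<noteq> 0" if "x \<in> {0<..<1}" for x using c_nonzero that by auto
  then obtain \<Phi> where \<Phi>: "finite \<Phi>" "\<Phi> \<subseteq> half_test_functions"
    and gen: "generates_half_test (\<Phi> \<union> diff_expr m c ` half_test_functions)"
    using range_diff_expr_finite_codim[OF c_smooth] by metis
  have "w = 0" if w: "w \<in> annihilator" and orth: "\<forall>\<phi>\<in>abs_L2I ` \<Phi>. cinner w \<phi> = 0" for w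
  proof -
    obtain h where wh: "w = abs_L2I h" and h: "square_integrable h" "\<And>x. x \<notin> {0..1} \<Longrightarrow> h x = 0"
      "\<And>y. y \<in> half_test_functions \<Longrightarrow> (LINT x|MI. diff_expr m c y x * cnj (h x)) = 0"
      using w unfolding annihilator_def by blast
    define N where "N = {\<phi> \<in> half_test_functions. (LINT x|MI. \<phi> x * cnj (h x)) = 0}"
    have "function_subspace N"
      unfolding function_subspace_def
    proof (intro conjI ballI allI)
      fix f assume f: "f \<in> N"
      then show "(\<lambda>x. z * f x) \<in> N" for z by (auto simp: N_def half_test_cmult mult.assoc)
      fix g assume g: "g \<in> N"
      have "(LINT x|MI. (f x + g x) * cnj (h x)) = 0"
        using f g h(1) by (simp add: N_def distrib_right square_integrable_prod half_test_square_integrable)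
      then show "(\<lambda>x. f x + g x) \<in> N" using f g by (simp add: N_def half_test_add)
    qed
    moreover have "\<Phi> \<union> diff_expr m c ` half_test_functions \<subseteq> N"
    proof -
      have "(LINT x|MI. \<phi> x * cnj (h x)) = 0" if "\<phi> \<in> \<Phi>" for \<phi>
      proof -
        have "cinner w (abs_L2I \<phi>) = 0" using orth that by blast
        then have "cinner (abs_L2I \<phi>) w = 0" by (subst cinner_commute) simp
        then show ?thesis using \<Phi>(2) that
          by (subst (asm) wh, subst (asm) cinner_abs_L2I) (auto intro: half_test_square_integrable h(1))
      qed
      then show ?thesis using \<Phi>(2) h(3) diff_expr_half_test[OF c_smooth] by (auto simp: N_def)
    qed
    ultimately have VN: "half_test_functions \<subseteq> N" using gen unfolding generates_half_test_def by blast
    have "AE x in MI. cnj (h x) = 0"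
    proof (rule AE_zero_if_orthogonal_to_half_test)
      show "integrable MI (\<lambda>x. cnj (h x))" using integrable_if_square_integrable(1)[OF h(1)] by simp
    qed (use VN h(2) in \<open>auto simp: N_def\<close>)
    then have "AE x in MI. h x = 0" by eventually_elim simp
    then show ?thesis unfolding wh zero_L2I.abs_eq by (intro abs_L2I_eqI h(1) square_integrable_zero)
  qed
  then show thesis using that[of "abs_L2I ` \<Phi>"] \<Phi>(1) by simp
qed

text \<open>A solution of the inhomogeneous equation is the compact part \<open>G u\<close> plus a solution of the
  homogeneous equation, and the latter form a finite-dimensional space.\<close>

theorem half_interval_compactness:
  assumes f: "\<And>n. square_integrable (f n)" and u: "\<And>n. square_integrable (u n)"
    and fK: "\<And>n. norm (abs_L2I (f n)) \<le> K" and uK: "\<And>n. norm (abs_L2I (u n)) \<le> K"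
    and weak: "\<And>n y. y \<in> half_test_functions \<Longrightarrow>
      (LINT x|MI. diff_expr m c y x * cnj (f n x)) = (LINT x|MI. y x * cnj (u n x))"
  obtains r where "strict_mono (r :: nat \<Rightarrow> nat)" "convergent (\<lambda>n. abs_L2I (cut (f (r n))))"
proof -
  define w where "w n = abs_L2I (cut (f n)) - abs_L2I (G (u n))" for n
  have w_mem: "w n \<in> annihilator" for n
  proof -
    have "(LINT x|MI. diff_expr m c y x * cnj (cut (f n) x - G (u n) x)) = 0" if y: "y \<in> half_test_functions" for y
    proof -
      note ly = diff_expr_square_integrable[OF y]
      have "(LINT x|MI. diff_expr m c y x * cnj (cut (f n) x - G (u n) x))
          = (LINT x|MI. diff_expr m c y x * cnj (cut (f n) x)) - (LINT x|MI. diff_expr m c y x * cnj (G (u n) x))"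
        using square_integrable_prod[OF ly cut_square_integrable(1)[OF f]]
          square_integrable_prod[OF ly G_square_integrable[OF u]] by (simp add: right_diff_distrib)
      also have "(LINT x|MI. diff_expr m c y x * cnj (cut (f n) x)) = (LINT x|MI. diff_expr m c y x * cnj (f n x))"
        using half_test_zero[OF diff_expr_half_test[OF c_smooth y]]
        by (intro Bochner_Integration.integral_cong) (auto simp: cut_def indicator_def)
      also have "\<dots> = (LINT x|MI. y x * cnj (u n x))" by (rule weak[OF y])
      also have "(LINT x|MI. diff_expr m c y x * cnj (G (u n) x)) = (LINT x|MI. G (diff_expr m c y) x * cnj (u n x))"
        by (rule G_symmetric[OF ly u, symmetric])
      finally show ?thesis by (simp add: G_diff_expr[OF y])
    qed
    then show ?thesis
      unfolding w_def annihilator_def abs_L2I_diff[OF cut_square_integrable(1)[OF f] G_square_integrable[OF u]] mem_Collect_eq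
      by (intro exI[of _ "\<lambda>x. cut (f n) x - G (u n) x"])
        (auto simp: cut_def G_zero_outside intro!: square_integrable_diff G_square_integrable u
          cut_square_integrable(1)[OF f, unfolded cut_def[abs_def]])
  qed
  obtain r where r: "strict_mono r" "convergent (\<lambda>n. abs_L2I (G (u (r n))))" using G_compact[OF u uK] .
  obtain K' where K': "\<And>n. norm (abs_L2I (G (u (r n)))) \<le> K'"
    using convergent_imp_Bseq[OF r(2)] by (auto simp: Bseq_def)
  have "norm (w (r n)) \<le> K + K'" for n
    unfolding w_def using norm_triangle_ineq4 cut_square_integrable(2)[OF f, of "r n"] fK[of "r n"] K'[of n]
    by (smt (verit))
  obtain \<Phi> where \<Phi>: "finite \<Phi>" "\<And>w. w \<in> annihilator \<Longrightarrow> (\<forall>\<phi>\<in>\<Phi>. cinner w \<phi> = 0) \<Longrightarrow> w = 0"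
    using annihilator_separated by metis
  have "\<exists>q. strict_mono (q::nat \<Rightarrow> nat) \<and> convergent (\<lambda>n. w (r (q n)))"
    using finite_dimensional_if_separated[OF \<Phi>(1) annihilator_subspace \<Phi>(2), THEN conjunct2, rule_format, of "\<lambda>n. w (r n)" "K + K'"]
      w_mem \<open>\<And>n. norm (w (r n)) \<le> K + K'\<close> by blast
  then obtain q where q: "strict_mono (q::nat \<Rightarrow> nat)" "convergent (\<lambda>n. w (r (q n)))" by blast
  have "convergent (\<lambda>n. abs_L2I (G (u (r (q n)))))"
    using convergent_subseq_convergent[OF r(2) q(1)] by (simp add: o_def)
  from convergent_add[OF q(2) this] have "convergent (\<lambda>n. abs_L2I (cut (f ((r \<circ> q) n))))"
    by (simp add: w_def)
  then show thesis using that strict_mono_o[OF r(1) q(1)] by blast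
qed

end

section \<open>Both half-intervals\<close>

text \<open>The constant \<open>\<kappa>\<close> is the minimum of \<open>\<bar>a\<bar>\<close> on \<open>[0,1]\<close>; it is positive because \<open>a 0\<close> is the leading
  coefficient of the series and \<open>c\<close> vanishes only at \<open>0\<close>.\<close>

lemma half_interval_coefficient_if_degenerate:
  assumes c: "degenerate_coefficient p q c" and m: "m \<ge> 1" and p: "p \<in> {1..2 * m - 1}"
  obtains \<kappa> where "half_interval_coefficient m c \<kappa>"
proof -
  obtain a \<alpha> where nz: "\<And>x. x \<in> {-1..1} \<Longrightarrow> c x = 0 \<longleftrightarrow> x = 0"
    and a: "\<And>x. \<bar>x\<bar> < 1 \<Longrightarrow> (\<lambda>j. \<alpha> j * x ^ j) sums a x" "\<alpha> 0 \<noteq> 0" "continuous_on {0..1} a"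
    and ca: "\<And>x. x \<in> {0..1} \<Longrightarrow> c x = x ^ p * a x"
    using c unfolding degenerate_coefficient_def by (elim conjE exE) blast
  have "(\<lambda>j. \<alpha> j * 0 ^ j) sums \<alpha> 0" using powser_sums_zero[of \<alpha>] by simp
  then have a0: "a 0 = \<alpha> 0" using a(1)[of 0] sums_unique2 by auto
  have an: "a x \<noteq> 0" if "x \<in> {0..1}" for x
    using nz[of x] ca[OF that] that a(2) a0 by (cases "x = 0") auto
  have cont: "continuous_on {0..1} (\<lambda>x. \<bar>a x\<bar>)" by (intro continuous_intros a)
  obtain x0 where x0: "x0 \<in> {0..1}" "\<And>x. x \<in> {0..1} \<Longrightarrow> \<bar>a x0\<bar> \<le> \<bar>a x\<bar>"
    using continuous_attains_inf[OF compact_Icc _ cont] by auto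
  have "half_interval_coefficient m c \<bar>a x0\<bar>"
  proof
    show "m \<ge> 1" by (rule m)
    show "0 < \<bar>a x0\<bar>" using an[OF x0(1)] by simp
    have "continuous_on {0..1} (\<lambda>x. x ^ p * a x)" by (intro continuous_intros a)
    then show "continuous_on {0..1} c" by (rule continuous_on_eq) (simp add: ca)
    show "\<bar>a x0\<bar> * x ^ (2 * m - 1) \<le> \<bar>c x\<bar>" if x: "0 < x" "x \<le> 1" for x
    proof -
      have "\<bar>a x0\<bar> * x ^ (2 * m - 1) \<le> \<bar>a x\<bar> * x ^ p"
        using x p by (intro mult_mono x0 power_decreasing) auto
      then show ?thesis using x by (simp add: ca abs_mult mult.commute)
    qed
    have eq: "complex_of_real (c x) = of_real x ^ p * of_real (\<Sum>j. \<alpha> j * x ^ j)" if "x \<in> {0<..<1}" for x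
      using that ca[of x] sums_unique[OF a(1)[of x]] by simp
    have "smooth_on {0<..<1} (\<lambda>x. of_real (\<Sum>j. \<alpha> j * x ^ j))"
      by (rule smooth_on_subset[OF smooth_on_power_series[OF sums_summable[OF a(1)]]]) auto
    then have "smooth_on {0<..<1} (\<lambda>x. of_real x ^ p * of_real (\<Sum>j. \<alpha> j * x ^ j))"
      by (intro smooth_on_mult smooth_on_power smooth_on_of_real) auto
    then show "smooth_on {0<..<1} (\<lambda>x. of_real (c x))"
      by (subst smooth_on_cong[OF _ eq]) auto
  qed
  then show thesis by (rule that)
qed

lemma degenerate_coefficient_reflect:
  assumes "degenerate_coefficient p q c"
  shows "degenerate_coefficient q p (\<lambda>x. c (- x))"
proof -
  obtain a b \<alpha> \<beta> where nz: "\<forall>x\<in>{-1..1}. c x = 0 \<longleftrightarrow> x = 0"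
    and a: "\<forall>x. \<bar>x\<bar> < 1 \<longrightarrow> (\<lambda>j. \<alpha> j * x ^ j) sums a x" "\<alpha> 0 \<noteq> 0" "continuous_on {0..1} a"
    and b: "\<forall>x. \<bar>x\<bar> < 1 \<longrightarrow> (\<lambda>j. \<beta> j * x ^ j) sums b x" "\<beta> 0 \<noteq> 0" "continuous_on {-1..0} b"
    and c: "\<forall>x\<in>{0..1}. c x = x ^ p * a x" "\<forall>x\<in>{-1..0}. c x = (- x) ^ q * b x"
    using assms unfolding degenerate_coefficient_def by (elim conjE exE)
  have sums: "(\<lambda>j. ((-1) ^ j * \<gamma> j) * x ^ j) sums g (- x)"
    if "\<forall>x. \<bar>x\<bar> < 1 \<longrightarrow> (\<lambda>j. \<gamma> j * x ^ j) sums g x" "\<bar>x\<bar> < 1" for \<gamma> g and x :: real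
  proof -
    have "(\<lambda>j. \<gamma> j * (- x) ^ j) sums g (- x)" using that by simp
    moreover have "\<gamma> j * (- x) ^ j = ((-1) ^ j * \<gamma> j) * x ^ j" for j
      by (subst power_minus) simp
    ultimately show ?thesis by simp
  qed
  have cont: "continuous_on {0..1} (\<lambda>x. b (- x))" "continuous_on {-1..0} (\<lambda>x. a (- x))"
    by (rule continuous_on_compose2[OF b(3)] continuous_on_compose2[OF a(3)], auto intro: continuous_intros)+
  have "\<forall>x\<in>{-1..1}. c (- x) = 0 \<longleftrightarrow> x = 0" using nz by auto
  moreover have "\<forall>x\<in>{0..1}. c (- x) = x ^ q * b (- x)" "\<forall>x\<in>{-1..0}. c (- x) = (- x) ^ p * a (- x)"
    using c by auto
  moreover have "\<forall>x. \<bar>x\<bar> < 1 \<longrightarrow> (\<lambda>j. ((-1) ^ j * \<beta> j) * x ^ j) sums b (- x)"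
    "\<forall>x. \<bar>x\<bar> < 1 \<longrightarrow> (\<lambda>j. ((-1) ^ j * \<alpha> j) * x ^ j) sums a (- x)"
    using sums[OF a(1)] sums[OF b(1)] by blast+
  moreover have "(-1) ^ 0 * \<beta> 0 \<noteq> 0" "(-1) ^ 0 * \<alpha> 0 \<noteq> 0" using a(2) b(2) by simp_all
  ultimately show ?thesis
    unfolding degenerate_coefficient_def
    by - (rule conjI, assumption,
      rule exI[of _ "\<lambda>x. b (- x)"], rule exI[of _ "\<lambda>x. a (- x)"],
      rule exI[of _ "\<lambda>j. (-1) ^ j * \<beta> j"], rule exI[of _ "\<lambda>j. (-1) ^ j * \<alpha> j"],
      intro conjI cont; assumption)
qed

lemma integral_reflect_MI:
  fixes f :: "real \<Rightarrow> 'a::euclidean_space"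
  shows "(LINT x|MI. f (- x)) = (LINT x|MI. f x)"
  using Equivalence_Lebesgue_Henstock_Integration.integral_reflect_real[of 1 "-1" f] by simp

lemma square_integrable_reflect:
  assumes "square_integrable f"
  shows "square_integrable (\<lambda>x. f (- x))" "norm (abs_L2I (\<lambda>x. f (- x))) = norm (abs_L2I f)"
proof -
  note refl = Equivalence_Lebesgue_Henstock_Integration.integrable_reflect_real[of 1 "-1", simplified]
  have "integrable MI (\<lambda>x. f (- x))" using refl[of f] integrable_if_square_integrable(1)[OF assms] by simp
  moreover have "integrable MI (\<lambda>x. (cmod (f (- x)))\<^sup>2)"
    using refl[of "\<lambda>x. (cmod (f x))\<^sup>2"] assms by (simp add: square_integrable_def)
  ultimately show s: "square_integrable (\<lambda>x. f (- x))"
    by (simp add: square_integrable_def borel_measurable_integrable)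
  have "(norm (abs_L2I (\<lambda>x. f (- x))))\<^sup>2 = (norm (abs_L2I f))\<^sup>2"
    unfolding norm_abs_L2I[OF s] norm_abs_L2I[OF assms] by (rule integral_reflect_MI)
  then show "norm (abs_L2I (\<lambda>x. f (- x))) = norm (abs_L2I f)" by (rule power2_eq_imp_eq) simp_all
qed

lemma reflect_test_function:
  assumes y: "y \<in> half_test_functions"
  shows "(\<lambda>x. y (- x)) \<in> test_functions"
proof -
  obtain a b where ab: "smooth_on UNIV y" "0 < a" "a < b" "b < 1" "\<And>x. x \<notin> {a..b} \<Longrightarrow> y x = 0"
    using half_test_functionsE[OF y] by metis
  have "smooth_on UNIV (\<lambda>x. y (- x))" using smooth_on_affine[OF ab(1), of "-1" 0] by simp
  moreover have "-1 < -b \<and> -b < -a \<and> -a < 1 \<and> (\<forall>x. x \<notin> {-b..-a} \<longrightarrow> y (- x) = 0)"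
    using ab(2-4) by (auto intro!: ab(5))
  ultimately show ?thesis unfolding test_functions_def smooth_on_def by blast
qed

text \<open>The order of the expression is even, so reflection introduces no sign.\<close>

lemma diff_expr_reflect:
  assumes y: "y \<in> half_test_functions" and c: "smooth_on {0<..<1} (\<lambda>x. of_real (c (- x)))"
  shows "diff_expr m c (\<lambda>x. y (- x)) = (\<lambda>x. diff_expr m (\<lambda>x. c (- x)) y (- x))"
proof -
  define g where "g s = (-1) ^ m * (complex_of_real (c (- s)) * nth_derivative m y s)" for s
  have g0: "(\<lambda>s. complex_of_real (c (- s)) * nth_derivative m y s) \<in> half_test_functions"
    by (rule half_test_mult[OF c half_test_nth_derivative[OF y]])
  have gs: "smooth_on UNIV g" unfolding g_def by (rule half_test_smooth[OF half_test_cmult[OF g0]])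
  have "(\<lambda>t. complex_of_real (c t) * nth_derivative m (\<lambda>x. y (- x)) t) = (\<lambda>t. g (- t))"
    by (simp add: g_def nth_derivative_reflect[OF half_test_smooth[OF y]] mult.left_commute)
  then have outer: "diff_expr m c (\<lambda>x. y (- x)) x = (-1) ^ m * ((-1) ^ m * nth_derivative m g (- x))" for x
    unfolding diff_expr_def by (simp only: nth_derivative_reflect[OF gs])
  have inner: "nth_derivative m g = (\<lambda>x. (-1) ^ m * nth_derivative m (\<lambda>s. complex_of_real (c (- s)) * nth_derivative m y s) x)"
    unfolding g_def[abs_def] by (rule nth_derivative_cmult[OF half_test_smooth[OF g0]])
  show ?thesis
    by (rule ext, subst outer) (simp add: inner diff_expr_def flip: mult.assoc power_mult_distrib)
qed

text \<open>Symmetry of the extension, tested on the domain of the operator that it extends.\<close>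

lemma extension_weak_equation:
  assumes sa: "self_adjoint_operator A" and ext: "minimal_operator m c \<subseteq> A"
    and A: "(abs_L2I f, abs_L2I u) \<in> A" and f: "square_integrable f" and u: "square_integrable u"
    and y: "y \<in> test_functions" "square_integrable y" "square_integrable (diff_expr m c y)"
  shows "(LINT x|MI. diff_expr m c y x * cnj (f x)) = (LINT x|MI. y x * cnj (u x))"
proof -
  have "(abs_L2I y, abs_L2I (diff_expr m c y)) \<in> preminimal_operator m c"
    using y(1) by (auto simp: preminimal_operator_def)
  then have "(abs_L2I y, abs_L2I (diff_expr m c y)) \<in> A"
    using ext closure_subset unfolding minimal_operator_def by blast
  from graph_symmetric[OF sa this A] show ?thesis by (simp add: cinner_abs_L2I f u y)
qed

theorem extension_compactly_embedded:
  assumes m: "m \<ge> 1" and p: "p \<in> {1..2 * m - 1}" and q: "q \<in> {1..2 * m - 1}"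
    and c: "degenerate_coefficient p q c"
    and sa: "self_adjoint_operator A" and ext: "minimal_operator m c \<subseteq> A"
  shows "compactly_embedded_domain A"
  unfolding compactly_embedded_domain_def
proof (intro allI impI)
  fix F U :: "nat \<Rightarrow> L2I" and K
  assume FU: "\<forall>n. (F n, U n) \<in> A \<and> norm (F n) \<le> K \<and> norm (U n) \<le> K"
  have "\<forall>n. \<exists>f. square_integrable f \<and> F n = abs_L2I f" "\<forall>n. \<exists>u. square_integrable u \<and> U n = abs_L2I u"
    using L2I_cases by metis+
  then obtain f u where f: "\<And>n. square_integrable (f n)" "\<And>n. F n = abs_L2I (f n)"
    and u: "\<And>n. square_integrable (u n)" "\<And>n. U n = abs_L2I (u n)" by metis
  have A: "(abs_L2I (f n), abs_L2I (u n)) \<in> A" and fK: "norm (abs_L2I (f n)) \<le> K"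
    and uK: "norm (abs_L2I (u n)) \<le> K" for n using FU f(2) u(2) by (metis, metis, metis)
  obtain \<kappa> where "half_interval_coefficient m c \<kappa>"
    using half_interval_coefficient_if_degenerate[OF c m p] .
  then interpret right: half_interval_coefficient m c \<kappa> .
  obtain \<kappa>' where "half_interval_coefficient m (\<lambda>x. c (- x)) \<kappa>'"
    using half_interval_coefficient_if_degenerate[OF degenerate_coefficient_reflect[OF c] m q] .
  then interpret left: half_interval_coefficient m "\<lambda>x. c (- x)" \<kappa>' .
  have "(LINT x|MI. diff_expr m c y x * cnj (f n x)) = (LINT x|MI. y x * cnj (u n x))"
    if "y \<in> half_test_functions" for n y
    using that by (intro extension_weak_equation[OF sa ext A f(1) u(1)] half_test_subset_test_functions
        half_test_square_integrable right.diff_expr_square_integrable)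
  from right.half_interval_compactness[OF f(1) u(1) fK uK this]
  obtain r where r: "strict_mono r" "convergent (\<lambda>n. abs_L2I (cut (f (r n))))" .
  \<comment> \<open>the left half, reflected, along the subsequence found for the right half\<close>
  define f' where "f' n x = f (r n) (- x)" for n x
  define u' where "u' n x = u (r n) (- x)" for n x
  have f': "square_integrable (f' n)" "norm (abs_L2I (f' n)) \<le> K" for n
    unfolding f'_def square_integrable_reflect(2)[OF f(1)] by (rule square_integrable_reflect(1)[OF f(1)], rule fK)
  have u': "square_integrable (u' n)" "norm (abs_L2I (u' n)) \<le> K" for n
    unfolding u'_def square_integrable_reflect(2)[OF u(1)] by (rule square_integrable_reflect(1)[OF u(1)], rule uK)
  have "(LINT x|MI. diff_expr m (\<lambda>x. c (- x)) y x * cnj (f' n x)) = (LINT x|MI. y x * cnj (u' n x))"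
    if y: "y \<in> half_test_functions" for n y
  proof -
    let ?y = "\<lambda>x. y (- x)"
    have ly: "diff_expr m c ?y = (\<lambda>x. diff_expr m (\<lambda>x. c (- x)) y (- x))"
      by (rule diff_expr_reflect[OF y left.c_smooth])
    have "(LINT x|MI. diff_expr m c ?y x * cnj (f (r n) x)) = (LINT x|MI. ?y x * cnj (u (r n) x))"
    proof (rule extension_weak_equation[OF sa ext A f(1) u(1) reflect_test_function[OF y]])
      show "square_integrable ?y" by (intro square_integrable_reflect half_test_square_integrable y)
      show "square_integrable (diff_expr m c ?y)"
        unfolding ly by (intro square_integrable_reflect left.diff_expr_square_integrable y)
    qed
    then show ?thesis
      using integral_reflect_MI[of "\<lambda>x. diff_expr m (\<lambda>x. c (- x)) y x * cnj (f' n x)"]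
        integral_reflect_MI[of "\<lambda>x. y x * cnj (u' n x)"]
      by (simp add: ly f'_def u'_def)
  qed
  from left.half_interval_compactness[OF f'(1) u'(1) f'(2) u'(2) this]
  obtain s where s: "strict_mono s" "convergent (\<lambda>n. abs_L2I (cut (f' (s n))))" .
  define g where "g n x = cut (f' (s n)) (- x)" for n x
  have cf': "square_integrable (cut (f' n))" for n by (rule cut_square_integrable(1)[OF f'(1)])
  have g: "square_integrable (g n)" for n unfolding g_def by (rule square_integrable_reflect(1)[OF cf'])
  have gn: "norm (abs_L2I (g i) - abs_L2I (g j)) = norm (abs_L2I (cut (f' (s i))) - abs_L2I (cut (f' (s j))))" for i j
    using square_integrable_reflect(2)[OF square_integrable_diff[OF cf' cf'], of "s i" "s j"]
    by (simp add: abs_L2I_diff g cf') (simp add: g_def)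
  have "Cauchy (\<lambda>n. abs_L2I (g n))"
    using convergent_Cauchy[OF s(2)] unfolding Cauchy_def dist_norm gn .
  then have gc: "convergent (\<lambda>n. abs_L2I (g n))" by (rule L2I_Cauchy_convergent)
  have "convergent (\<lambda>n. abs_L2I (cut (f (r (s n)))))"
    using convergent_subseq_convergent[OF r(2) s(1)] by (simp add: o_def)
  from convergent_add[OF this gc]
  have "convergent (\<lambda>n. abs_L2I (cut (f (r (s n)))) + abs_L2I (g n))" .
  moreover have "abs_L2I (cut (f (r (s n)))) + abs_L2I (g n) = F ((r \<circ> s) n)" for n
  proof -
    \<comment> \<open>the two pieces overlap at the point \<open>0\<close>, where they add up to twice the value\<close>
    have "AE x in lebesgue. x \<noteq> (0::real)" by (intro AE_completion AE_lborel_singleton)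
    then have "AE x in MI. x \<noteq> 0" by (subst AE_restrict_space_iff) auto
    moreover have "AE x in MI. x \<in> {-1..1}" by (rule AE_I2) simp
    ultimately have "AE x in MI. cut (f (r (s n))) x + g n x = f (r (s n)) x"
      by eventually_elim (auto simp: cut_def g_def f'_def indicator_def)
    then show ?thesis
      by (simp add: abs_L2I_add cut_square_integrable f g)
        (intro abs_L2I_eqI square_integrable_add cut_square_integrable f g)
  qed
  ultimately have "convergent (\<lambda>n. F ((r \<circ> s) n))" by simp
  then show "\<exists>r. strict_mono r \<and> convergent (\<lambda>n. F (r n))"
    using strict_mono_o[OF r(1) s(1)] by blast
qed

theorem theorem5p2:
  fixes m p q :: nat
    and c :: "real \<Rightarrow> real"
    and A :: "(L2I \<times> L2I) set"
  assumes "m \<ge> 1"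
    and "p \<in> {1..2 * m - 1}" and "q \<in> {1..2 * m - 1}"
    and "degenerate_coefficient p q c"
    and "self_adjoint_operator A"
    and "minimal_operator m c \<subseteq> A"
  shows "discrete_spectrum A"
  using discrete_spectrum_if_compactly_embedded[OF assms(5) extension_compactly_embedded[OF assms]] .

end
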